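(* Let $X=(X_t)_{t\ge 0}$ be a uniformly ergodic diffusion on $S$ with stationary distribution $\pi$ and deviation kernel $Q^{\sharp}$, and let $f:S\to\mathbb{R}$ be a bounded function. Then for any $\varepsilon>0$, any $t>\frac{2\|f\|\,\|Q^{\sharp}\|}{\varepsilon}$ and any $x\in S$, $$\mathbb{P}_{x}\left(\frac1t\int_0^t f(X_s)\,ds-\pi(f)\ge \varepsilon\right)\le \exp\left\{\frac{-2\left(t\varepsilon-2\|f\|\,\|Q^{\sharp}\|\right)^2}{(t+1)\,\|f\|^2\left(2\|Q^{\sharp}\|+1\right)^2}\right\}.$$
   Context: Let $(\Omega,\mathcal F,(\mathcal F_t)_{t\ge0},\mathbb P)$ be a filtered probability space satisfying the usual conditions, and let $X=(X_t)_{t\ge 0}$ be an ergodic (one-dimensional) diffusion process on a state space $S$ (an interval $(l,u)$), with transition semigroup $(P^t)_{t\ge 0}$ and stationary distribution $\pi$. Its infinitesimal generator acts on twice differentiable functions by $\mathcal A=\mu(x)\frac{d}{dx}+\frac12\sigma^2(x)\frac{d^2}{dx^2}$, where $\mu$ is the drift and $\sigma^2$ the diffusion coefficient. Write $\mathbb P_x(\cdot)=\mathbb P(\cdot\mid X_0=x)$ and $\mathbb{E}_x[\cdot]=\mathbb{E}[\cdot\mid X_0=x]$. Functions $f$ are implicitly (Borel) measurable, and $\pi(f):=\int_S f(x)\,\pi(dx)$. $X$ is uniformly ergodic if there are constants $C<\infty$, $\beta>0$ such that for all $t\ge0$, $\sup_{x\in S}\|P^t(x,\cdot)-\pi\|_{TV}\le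 Ce^{-\beta t}$, where $\|P^t(x,\cdot)-\pi\|_{TV}:=\sup_A|P^t(x,A)-\pi(A)|$ (supremum over measurable sets $A$). The deviation kernel of $X$ is $Q^{\sharp}:=\int_0^\infty (P^t-\Pi)\,dt$, where $\Pi$ is the projection kernel $\Pi(x,dy)=\pi(dy)$ for all $x\in S$; that is, $Q^{\sharp}f(x)=\int_0^\infty (P^tf(x)-\pi(f))\,dt$. For bounded $f$, $\|f\|:=\sup_x|f(x)|$, and $\|Q^{\sharp}\|:=\sup_{\|f\|\le1}\|Q^{\sharp}f\|$ is the induced operator norm on the space of bounded functions. *)

theory Defs
  imports "HOL-Probability.Probability"
begin

section \<open>Filtered probability spaces and Markov processes\<close>

locale usual_filtered_prob_space = prob_space M + complete_measure M
  for M :: "'w measure" +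
  fixes F :: "real \<Rightarrow> 'w measure"
  assumes subalg: "0 \<le> t \<Longrightarrow> subalgebra M (F t)"
    and mono: "0 \<le> s \<Longrightarrow> s \<le> t \<Longrightarrow> sets (F s) \<subseteq> sets (F t)"
    and null: "null_sets M \<subseteq> sets (F 0)"
    and right_cont: "0 \<le> t \<Longrightarrow> sets (F t) = (\<Inter>s\<in>{t<..}. sets (F s))"

definition transition_semigroup :: "'s measure \<Rightarrow> (real \<Rightarrow> 's \<Rightarrow> 's measure) \<Rightarrow> bool" where
  "transition_semigroup E P \<longleftrightarrow>
     (\<forall>t\<ge>0. P t \<in> E \<rightarrow>\<^sub>M prob_algebra E) \<and>
     (\<forall>x\<in>space E. P 0 x = return E x) \<and>
     (\<forall>s\<ge>0. \<forall>t\<ge>0. \<forall>x\<in>space E. P (s + t) x = P s x \<bind> P t)"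

text \<open>Markov property with respect to the filtration \<open>F\<close>:
  \<open>\<bbbP>(X\<^sub>s\<^sub>+\<^sub>t \<in> A | F\<^sub>s) = P\<^sup>t(X\<^sub>s, A)\<close> almost surely.\<close>

definition markov_process ::
  "'w measure \<Rightarrow> (real \<Rightarrow> 'w measure) \<Rightarrow> (real \<Rightarrow> 'w \<Rightarrow> 's) \<Rightarrow> 's measure
     \<Rightarrow> (real \<Rightarrow> 's \<Rightarrow> 's measure) \<Rightarrow> bool" where
  "markov_process M F X E P \<longleftrightarrow>
     (\<forall>t\<ge>0. X t \<in> F t \<rightarrow>\<^sub>M E) \<and>
     (\<forall>s\<ge>0. \<forall>t\<ge>0. \<forall>A\<in>sets E. AE \<omega> in M.
        real_cond_exp M (F s) (\<lambda>\<omega>. indicator A (X (s + t) \<omega>)) \<omega> = measure (P t (X s \<omega>)) A)"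

definition generated_by ::
  "'w set \<Rightarrow> real set \<Rightarrow> (real \<Rightarrow> 'w \<Rightarrow> 's) \<Rightarrow> 's measure \<Rightarrow> 'w measure" where
  "generated_by \<Omega> T X E = sigma \<Omega> {X s -` A \<inter> \<Omega> | s A. s \<in> T \<and> A \<in> sets E}"

section \<open>One-dimensional diffusions\<close>

text \<open>The state space is the open interval \<open>(l, u)\<close>, possibly unbounded, with its Borel sets.\<close>

abbreviation state_space :: "ereal \<Rightarrow> ereal \<Rightarrow> real measure" where
  "state_space l u \<equiv> restrict_space borel (einterval l u)"

text \<open>\<open>test_function S g g' g''\<close>: \<open>g\<close> is twice continuously differentiable with compact
  support in \<open>S\<close>, with derivatives \<open>g'\<close> and \<open>g''\<close>.\<close>

definition test_function ::
  "real set \<Rightarrow> (real \<Rightarrow> real) \<Rightarrow> (real \<Rightarrow> real) \<Rightarrow> (real \<Rightarrow> real) \<Rightarrow> bool" where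
  "test_function S g g' g'' \<longleftrightarrow>
     (\<forall>x\<in>S. (g has_real_derivative g' x) (at x)) \<and>
     (\<forall>x\<in>S. (g' has_real_derivative g'' x) (at x)) \<and>
     continuous_on S g'' \<and>
     (\<exists>K. compact K \<and> K \<subseteq> S \<and> (\<forall>x\<in>S - K. g x = 0))"

text \<open>\<open>Px x\<close> is the law \<open>\<bbbP>\<^sub>x = \<bbbP>( \<sqdot> | X\<^sub>0 = x)\<close>. It is a probability measure on the
  sigma-algebra generated by \<open>X\<close>, and not on the completed one carrying \<open>M\<close>, because a set that
  is null for \<open>M\<close> need not be measurable for every \<open>\<bbbP>\<^sub>x\<close>. The conditional probability given
  \<open>X\<^sub>0\<close> determines \<open>\<bbbP>\<^sub>x\<close> only for almost every \<open>x\<close> under the law of \<open>X\<^sub>0\<close>; as usual, the version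
  meant is the one under which, for every \<open>x\<close>, \<open>X\<close> starts at \<open>x\<close> and is Markov with the same
  semigroup \<open>P\<close>. The infinitesimal generator is the derivative of the semigroup at time zero,
  taken pointwise on test functions.\<close>

locale diffusion = usual_filtered_prob_space M F
  for M :: "'w measure" and F :: "real \<Rightarrow> 'w measure" +
  fixes X :: "real \<Rightarrow> 'w \<Rightarrow> real"
    and Px :: "real \<Rightarrow> 'w measure"
    and P :: "real \<Rightarrow> real \<Rightarrow> real measure"
    and l u :: ereal
    and \<mu> \<sigma> :: "real \<Rightarrow> real"
  assumes interval: "l < u"
    and continuous_paths: "\<omega> \<in> space M \<Longrightarrow> continuous_on {0..} (\<lambda>t. X t \<omega>)"
    and semigroup: "transition_semigroup (state_space l u) P"
    and markov: "markov_process M F X (state_space l u) P"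
    and Px_kernel: "Px \<in> state_space l u \<rightarrow>\<^sub>M
          prob_algebra (generated_by (space M) {0..} X (state_space l u))"
    and Px_conditional: "A \<in> sets (generated_by (space M) {0..} X (state_space l u)) \<Longrightarrow>
          AE \<omega> in M. real_cond_exp M (vimage_algebra (space M) (X 0) (state_space l u))
            (indicator A) \<omega> = measure (Px (X 0 \<omega>)) A"
    and Px_start: "x \<in> einterval l u \<Longrightarrow> AE \<omega> in Px x. X 0 \<omega> = x"
    and Px_markov: "x \<in> einterval l u \<Longrightarrow>
          markov_process (Px x) (\<lambda>t. generated_by (space M) {0..t} X (state_space l u)) X
            (state_space l u) P"
    and generator: "test_function (einterval l u) g g' g'' \<Longrightarrow> x \<in> einterval l u \<Longrightarrow>
          ((\<lambda>t. ((\<integral>y. g y \<partial>P t x) - g x) / t)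
             \<longlongrightarrow> \<mu> x * g' x + 1 / 2 * (\<sigma> x)\<^sup>2 * g'' x) (at_right 0)"

section \<open>Uniform ergodicity and the deviation kernel\<close>

definition stationary_distribution ::
  "'s measure \<Rightarrow> (real \<Rightarrow> 's \<Rightarrow> 's measure) \<Rightarrow> 's measure \<Rightarrow> bool" where
  "stationary_distribution E P \<pi> \<longleftrightarrow>
     \<pi> \<in> space (prob_algebra E) \<and> (\<forall>t\<ge>0. \<pi> \<bind> P t = \<pi>)"

definition tv_dist :: "'s measure \<Rightarrow> 's measure \<Rightarrow> real" where
  "tv_dist \<nu> \<pi> = (SUP A\<in>sets \<pi>. \<bar>measure \<nu> A - measure \<pi> A\<bar>)"

definition uniformly_ergodic ::
  "'s measure \<Rightarrow> (real \<Rightarrow> 's \<Rightarrow> 's measure) \<Rightarrow> 's measure \<Rightarrow> bool" where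
  "uniformly_ergodic E P \<pi> \<longleftrightarrow>
     (\<exists>C. \<exists>\<beta>>0. \<forall>t\<ge>0. (SUP x\<in>space E. tv_dist (P t x) \<pi>) \<le> C * exp (- \<beta> * t))"

definition bounded_functions :: "'s measure \<Rightarrow> ('s \<Rightarrow> real) set" where
  "bounded_functions E = {f \<in> borel_measurable E. bounded (f ` space E)}"

definition sup_norm :: "'s measure \<Rightarrow> ('s \<Rightarrow> real) \<Rightarrow> real" where
  "sup_norm E f = (SUP x\<in>space E. \<bar>f x\<bar>)"

definition deviation_kernel ::
  "(real \<Rightarrow> 's \<Rightarrow> 's measure) \<Rightarrow> 's measure \<Rightarrow> ('s \<Rightarrow> real) \<Rightarrow> 's \<Rightarrow> real" where
  "deviation_kernel P \<pi> f x = (LBINT t:{0..}. (\<integral>y. f y \<partial>P t x) - (\<integral>y. f y \<partial>\<pi>))"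

text \<open>The suprema are taken in the reals; uniform ergodicity makes the operator norm finite, since
  \<open>\<bar>deviation_kernel P \<pi> f x\<bar> \<le> 2 * C / \<beta>\<close> whenever \<open>sup_norm E f \<le> 1\<close>.\<close>

definition operator_norm ::
  "'s measure \<Rightarrow> (('s \<Rightarrow> real) \<Rightarrow> 's \<Rightarrow> real) \<Rightarrow> real" where
  "operator_norm E Q = (SUP f\<in>{f \<in> bounded_functions E. sup_norm E f \<le> 1}. sup_norm E (Q f))"

end

theory Submission
  imports Defs
begin

text \<open>
  After rescaling, \<open>f\<close> takes values in \<open>[0, 1]\<close>; let \<open>p\<close> be its stationary mean and \<open>w\<close> its image
  under the deviation kernel, so that \<open>|w| \<le> q / 2\<close> when \<open>q\<close> bounds the operator norm. Dynkin's formula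
  for \<open>w\<close> says that the generator maps \<open>u = 1 + \<theta> w\<close> to \<open>- \<theta> (f - p)\<close>. Hence the exponential of
  the time integral of \<open>V = \<theta> (f - p) / u\<close>, multiplied by \<open>u\<close> at the current state, has constant
  expectation, and Chernoff's bound for the time average of \<open>f\<close> follows from an affine minorant of \<open>V\<close>
  in \<open>f\<close>. For a mean deviation \<open>e\<close>, in time units of \<open>q\<close>, the resulting rate is at least \<open>e\<^sup>2\<close>, whatever the
  value of \<open>p\<close>, which is what the claim requires because \<open>8 q \<le> (2 q + 1)\<^sup>2\<close>. The prefactor
  \<open>sup u / inf u\<close> is absorbed by the summand \<open>1\<close> in \<open>t + 1\<close> and the shift of \<open>t \<epsilon>\<close>, except when \<open>e\<close> is
  close to its largest possible value; then \<open>p\<close> is small, the lower bound for \<open>w\<close> improves, and with it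
  the rate.
\<close>

section \<open>Elementary inequalities\<close>

text \<open>Put \<open>k = \<theta> q / 2\<close> and \<open>T = t / q\<close>. In time units of
  \<open>q\<close> the affine minorant gives the rate
  \<open>(2 k e - k^2 (1 + e^2) + k^2 (1 - 2 p - e)^2) / (1 - k^2)\<close>. The worst mean is
  \<open>p = (1 - e) / 2\<close>, and the maximum over \<open>k\<close>, attained at
  \<open>k = e\<close>, is then exactly \<open>e^2\<close>. At finite time the prefactor
  \<open>(1 + k) / (1 - k)\<close> has to be paid too, so the smaller
  \<open>k = (T e - 1) / (T + 1)\<close> is taken. At \<open>e = 1\<close> this makes the prefactor
  equal to \<open>T\<close>, with unbounded logarithm, while the slack available for it stays below
  4; this is why \<open>e\<close> near 1 needs a sharper lower bound for \<open>w\<close>. The other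
  delicate spot is \<open>q\<close> near 1/2, where \<open>8 q = (2 q + 1)^2\<close> leaves nothing
  to spare in leading order.

  Since \<open>f\<close> is only measurable, \<open>w\<close> need not be differentiable and Ito's
  formula is not at hand. Dynkin's formula and the exponential martingale are derived from the
  semigroup and the Markov property; path continuity enters through joint measurability in time and
  space.\<close>

lemma frac_le_frac:
  fixes a b c d :: real
  assumes "0 < b" "0 < d" "a * d \<le> c * b"
  shows "a / b \<le> c / d"
  using assms by (simp add: field_simps)

text \<open>The logarithm is \<open>2 (k + k^3/3 + k^5/5 + k^7/7 + ...)\<close>, and from
  \<open>k^5/5\<close> on the series is compared with a geometric one. The ratio
  \<open>5/7 k^2\<close> would match the next term but fall short of the later ones; the larger
  \<open>84/100 k^2\<close> suffices up to \<open>k = 93/100\<close>.\<close>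

lemma ln_ratio_bound:
  fixes k :: real
  assumes "0 \<le> k" "k \<le> 93/100"
  shows "ln ((1 + k) / (1 - k)) \<le> 2 * k + 2 * (k^3/3 + (k^5/5) / (1 - 84/100 * k\<^sup>2))"
proof -
  define D where "D = (\<lambda>x::real. 1 - 84/100 * x\<^sup>2)"
  define \<Phi> where "\<Phi> = (\<lambda>x. 2 * x + 2 * (x^3/3 + (x^5/5) / D x) - ln ((1 + x) / (1 - x)))"
  define \<Phi>' where "\<Phi>' = (\<lambda>x. 2 + 2 * (x\<^sup>2 + (x^4 * D x + 84/250 * x^6) / (D x)\<^sup>2) - 2 / (1 - x\<^sup>2))"
  have sq: "x\<^sup>2 \<le> 8649/10000" if "0 \<le> x" "x \<le> 93/100" for x :: real
    using power_mono[OF that(2) that(1), of 2] by (simp add: power2_eq_square)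
  have "\<Phi> 0 \<le> \<Phi> k"
  proof (rule DERIV_nonneg_imp_nondecreasing[OF assms(1)])
    fix x :: real assume x: "0 \<le> x" "x \<le> k"
    then have x1: "x\<^sup>2 \<le> 8649/10000" using sq assms by simp
    then have D0: "D x > 0" by (simp add: D_def)
    have x2: "x < 1" using x assms by simp
    have x3: "1 - x\<^sup>2 > 0" using x1 by simp
    have "(\<Phi> has_real_derivative \<Phi>' x) (at x)"
    proof -
      have "(D has_real_derivative - (168/100) * x) (at x)"
        unfolding D_def by (auto intro!: derivative_eq_intros)
      then have "((\<lambda>x. (x^5/5) / D x) has_real_derivative
          (x^4 * D x - (x^5/5) * (- (168/100) * x)) / (D x * D x)) (at x)"
        using D0 by (intro DERIV_divide) (auto intro!: derivative_eq_intros)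
      moreover have "(x^5/5) * (- (168/100) * x) = - (84/250 * x^6)"
        by (simp add: eval_nat_numeral)
      moreover have "x^4 * D x - - (84/250 * x^6) = x^4 * D x + 84/250 * x^6" by simp
      ultimately have "((\<lambda>x. (x^5/5) / D x) has_real_derivative
          (x^4 * D x + 84/250 * x^6) / (D x)\<^sup>2) (at x)"
        unfolding power2_eq_square by metis
      then have "((\<lambda>x. 2 * x + 2 * (x^3/3 + (x^5/5) / D x)) has_real_derivative
         2 + 2 * (x\<^sup>2 + (x^4 * D x + 84/250 * x^6) / (D x)\<^sup>2)) (at x)"
        by (intro DERIV_add[OF _ DERIV_cmult[OF DERIV_add]]) (auto intro!: derivative_eq_intros)
      moreover have "((\<lambda>x. ln ((1 + x) / (1 - x))) has_real_derivative 2 / (1 - x\<^sup>2)) (at x)"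
      proof -
        have "((\<lambda>x. ln (1 + x) - ln (1 - x)) has_real_derivative 1 / (1 + x) + 1 / (1 - x)) (at x)"
          using x x2 by (auto intro!: derivative_eq_intros)
        moreover have "1 / (1 + x) + 1 / (1 - x) = 2 / (1 - x\<^sup>2)"
          using x x2 x3 by (simp add: divide_simps power2_eq_square) (simp add: algebra_simps)
        moreover have "\<forall>\<^sub>F y in nhds x. ln (1 + y) - ln (1 - y) = ln ((1 + y) / (1 - y))"
          using x x2
          by (intro eventually_nhds_in_open[of "{-1<..<1}", THEN eventually_mono]) (auto simp: ln_div)
        ultimately show ?thesis
          by (subst DERIV_cong_ev[OF refl _ refl, symmetric]) auto
      qed
      ultimately show ?thesis unfolding \<Phi>_def \<Phi>'_def by (rule DERIV_diff)
    qed
    moreover have "0 \<le> \<Phi>' x"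
    proof -
      \<comment> \<open>\<open>5 * c\<close> is the factor 84/100 of the geometric ratio. All terms
        below \<open>x^6\<close> cancel, and the remaining bracket is nonnegative for
        \<open>x^2\<close> up to about 0.873, just beyond \<open>(93/100)^2\<close>.\<close>
      define c where "c = (21/125 :: real)"
      have Dc: "D x = 1 - 5 * c * x\<^sup>2" by (simp add: D_def c_def)
      define B where "B = 1 - x\<^sup>2"
      have B: "B > 0" using x3 by (simp add: B_def)
      have "\<Phi>' x = 2 + 2 * (x\<^sup>2 + (x^4 * D x + 2 * c * x^6) / (D x)\<^sup>2) - 2 / B"
        by (simp add: \<Phi>'_def B_def c_def)
      also have "\<dots> * ((D x)\<^sup>2 * B) = 2 * ((1 + x\<^sup>2) * (D x)\<^sup>2 * B + (x^4 * D x + 2 * c * x^6) * B - (D x)\<^sup>2)"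
        using D0 B by (simp add: field_simps)
      also have "\<dots> = 2 * x^6 * ((7 * c - 1) - (25 * c\<^sup>2 - 3 * c) * x\<^sup>2)"
        unfolding Dc B_def by (simp add: power2_eq_square eval_nat_numeral algebra_simps)
      also have "\<dots> \<ge> 0" using x1 by (simp add: c_def power2_eq_square)
      finally show ?thesis using D0 B by (metis mult_pos_pos zero_le_mult_iff not_le zero_less_power)
    qed
    ultimately show "\<exists>y. (\<Phi> has_real_derivative y) (at x) \<and> 0 \<le> y" by blast
  qed
  then show ?thesis by (simp add: \<Phi>_def D_def)
qed

section \<open>Passing from \<open>t\<close> to the rescaled time \<open>T = t / q\<close>\<close>

text \<open>In the application \<open>s = 2 q - 1\<close>, the defect in
  \<open>(2 q + 1)^2 = 8 q + s^2\<close>. Only \<open>T s < 2\<close> is critical, and there the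
  first square exceeds 4 and has to outweigh the negative product.\<close>

lemma time_rescaling_bound:
  fixes T s :: real
  assumes "T \<ge> 1" "s > -1"
  shows "0 \<le> (T * s - 4)\<^sup>2 + s\<^sup>2 * (T + 4) * (T * s - 2)"
proof (cases "T * s \<ge> 2")
  case True
  then show ?thesis using assms by simp
next
  case False
  show ?thesis
  proof (cases "s \<ge> 0")
    case True
    define y where "y = T * s"
    have y: "0 \<le> y" "y < 2" using True False assms by (auto simp: y_def)
    have "s\<^sup>2 * (T + 4) \<le> 5 * y\<^sup>2"
    proof -
      have "T \<le> T\<^sup>2" using assms by (simp add: power2_eq_square)
      then have "T + 4 \<le> 5 * T\<^sup>2" using assms by linarith
      then have "s\<^sup>2 * (T + 4) \<le> s\<^sup>2 * (5 * T\<^sup>2)" by (intro mult_left_mono) auto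
      then show ?thesis unfolding y_def power_mult_distrib by (simp add: mult_ac)
    qed
    then have "s\<^sup>2 * (T + 4) * (2 - y) \<le> 5 * y\<^sup>2 * (2 - y)"
      using y by (intro mult_right_mono) auto
    moreover have "0 \<le> (y - 4)\<^sup>2 - 5 * y\<^sup>2 * (2 - y)"
    proof -
      \<comment> \<open>309/200 approximates the minimiser of this cubic; making it a double root
        leaves an affine remainder.\<close>
      have "(y - 4)\<^sup>2 - 5 * y\<^sup>2 * (2 - y)
        = 5 * (y - 309/200)\<^sup>2 * (y + 129/100) - 37/8000 * y + 482951/800000"
        by (simp add: power2_eq_square field_simps)
      moreover have "0 \<le> 5 * (y - 309/200)\<^sup>2 * (y + 129/100)" using y by simp
      moreover have "37/8000 * y \<le> 482951/800000"
        using y by (simp add: power2_eq_square)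
      ultimately show ?thesis by linarith
    qed
    moreover have "s\<^sup>2 * (T + 4) * (T * s - 2) = - (s\<^sup>2 * (T + 4) * (2 - y))"
      by (simp add: y_def algebra_simps)
    ultimately show ?thesis unfolding y_def by linarith
  next
    case F: False
    define a where "a = - s"
    have a: "0 < a" "a < 1" using F assms by (auto simp: a_def)
    have "(T * s - 4)\<^sup>2 + s\<^sup>2 * (T + 4) * (T * s - 2) = 2*T*a*(1-a) + 6*T*a+8*(1-a\<^sup>2) + 8 + T\<^sup>2*a\<^sup>2*(1-a) + 4*T*a*(1-a\<^sup>2) - 4*T*a"
      by (simp add: a_def power2_eq_square algebra_simps)
    also have "\<dots> \<ge> 0"
    proof -
      have "a\<^sup>2 \<le> 1" using a by (simp add: power_le_one)
      then have "0 \<le> 2*T*a*(1-a)" "0 \<le> T\<^sup>2*a\<^sup>2*(1-a)" "0 \<le> 4*T*a*(1-a\<^sup>2)" "0 \<le> T*a" "0 \<le> 8*(1-a\<^sup>2)"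
        using a assms by auto
      then show ?thesis by linarith
    qed
    finally show ?thesis .
  qed
qed

text \<open>For fixed large \<open>T\<close> the factor
  \<open>8 q^2 / ((T q + 1) (2 q + 1)^2)\<close> is largest near \<open>2 q - 1 = 4 / T\<close>,
  whence the square \<open>(T s - 4)^2\<close> in \<open>time_rescaling_bound\<close>. The quotient
  \<open>(T + 4) / (T^2 + 6 T + 4)\<close> is a rational majorant valid for all \<open>q\<close>, so
  that the later estimates involve \<open>T\<close>, \<open>e\<close> and \<open>p\<close>
  only.\<close>

lemma time_rescaling:
  fixes t q e :: real
  assumes "q > 0" "t \<ge> q"
  defines "T \<equiv> t / q"
  shows "8 * (t * e - q)\<^sup>2 / ((t + 1) * (2 * q + 1)\<^sup>2)
    \<le> (T * e - 1)\<^sup>2 * (T + 4) / (T\<^sup>2 + 6 * T + 4)"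
proof -
  have T: "T \<ge> 1" "t = T * q" using assms by auto
  have eq: "t * e - q = q * (T * e - 1)" by (simp add: T algebra_simps)
  have "(T + 4) * ((t + 1) * (2 * q + 1)\<^sup>2) - 8 * q\<^sup>2 * (T\<^sup>2 + 6 * T + 4)
    = ((T * (2 * q - 1) - 4)\<^sup>2 + (2 * q - 1)\<^sup>2 * (T + 4) * (T * (2 * q - 1) - 2)) / 2"
    by (simp add: T power2_eq_square field_simps)
  also have "\<dots> \<ge> 0"
    using time_rescaling_bound[OF T(1), of "2 * q - 1"] assms by simp
  finally have "8 * q\<^sup>2 * (T\<^sup>2 + 6 * T + 4) \<le> (T + 4) * ((t + 1) * (2 * q + 1)\<^sup>2)" by simp
  then have *: "8 * q\<^sup>2 / ((t + 1) * (2 * q + 1)\<^sup>2) \<le> (T + 4) / (T\<^sup>2 + 6 * T + 4)"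
  proof (rule frac_le_frac[rotated 2])
    show "0 < (t + 1) * (2 * q + 1)\<^sup>2" using assms(1,2) by simp
    show "0 < T\<^sup>2 + 6 * T + 4" using T(1) by (smt (verit) zero_le_power2)
  qed
  have "8 * (q * (T * e - 1))\<^sup>2 / ((t + 1) * (2 * q + 1)\<^sup>2)
      = (T * e - 1)\<^sup>2 * (8 * q\<^sup>2 / ((t + 1) * (2 * q + 1)\<^sup>2))"
    by (simp add: power_mult_distrib)
  also have "\<dots> \<le> (T * e - 1)\<^sup>2 * ((T + 4) / (T\<^sup>2 + 6 * T + 4))"
    by (intro mult_left_mono *) simp
  finally show ?thesis unfolding eq by simp
qed

section \<open>The logarithm of the prefactor against the available slack\<close>

text \<open>For \<open>e <= 1\<close> the choice of \<open>k\<close> in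
  \<open>exponent_bound_small_mean\<close> forces \<open>T >= (1 + k) / (1 - k)\<close>. The
  fraction on the right is the slack \<open>S\<close> of that proof at this smallest
  \<open>T\<close>. The limit 46/100 comes from \<open>T <= 27/10\<close>.\<close>

lemma ln_ratio_near:
  fixes k :: real
  assumes "0 \<le> k" "k \<le> 46/100"
  shows "ln ((1 + k) / (1 - k)) \<le> 2 * k + k\<^sup>2 * (2 * (1 + k) / (11 - 6 * k - k\<^sup>2))"
proof -
  define D where "D = 1 - 84/100 * k\<^sup>2"
  have k2: "k\<^sup>2 \<le> 2116/10000" using power_mono[OF assms(2,1), of 2] by (simp add: power2_eq_square)
  have D: "D > 0" using k2 by (simp add: D_def)
  have m: "11 - 6 * k - k\<^sup>2 > 0" using k2 assms by simp
  \<comment> \<open>Bernstein form of degree five on \<open>[0, 23/50]\<close>: all coefficients are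
    positive.\<close>
  have "(1 + k) * D - (k/3 * D + k^3/5) * (11 - 6 * k - k\<^sup>2) = 312500000/6436343 * k^0 * (23/50 - k)^5 + 3537500000/19309029 * k^1 * (23/50 - k)^4 + 5005115000/19309029 * k^2 * (23/50 - k)^3 + 3199412600/19309029 * k^3 * (23/50 - k)^2 + 275277216/6436343 * k^4 * (23/50 - k)^1 + 749733142/482725725 * k^5 * (23/50 - k)^0"
    unfolding D_def by (simp add: power2_eq_square eval_nat_numeral field_simps)
  also have "\<dots> \<ge> 0" using assms by (intro add_nonneg_nonneg mult_nonneg_nonneg zero_le_power) auto
  finally have "(k/3 * D + k^3/5) * (11 - 6 * k - k\<^sup>2) \<le> (1 + k) * D" by simp
  then have "k/3 + (k^3/5) / D \<le> (1 + k) / (11 - 6 * k - k\<^sup>2)"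
    using D m by (simp add: field_simps)
  then have "k\<^sup>2 * (2 * (k/3 + (k^3/5) / D)) \<le> k\<^sup>2 * (2 * (1 + k) / (11 - 6 * k - k\<^sup>2))"
    by (intro mult_left_mono) (simp_all add: add_divide_distrib)
  moreover have "2 * (k^3/3 + (k^5/5) / D) = k\<^sup>2 * (2 * (k/3 + (k^3/5) / D))"
    by (simp add: power2_eq_square eval_nat_numeral field_simps)
  ultimately show ?thesis
    using ln_ratio_bound[of k] assms unfolding D_def by linarith
qed

text \<open>Nonnegativity is read off Bernstein expansions on the overlapping intervals \<open>[0, 50]\<close> and \<open>[43, 93]\<close>.\<close>

lemma ln_ratio_far_poly:
  fixes K :: real
  assumes "0 \<le> K" "K \<le> 93"
  defines "D \<equiv> 1000000 - 84 * K\<^sup>2"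
  shows "0 \<le> 600 * (100 - K) * (565 - 4 * K) * D - 300 * (93 - K) * (565 - 4 * K) * D
    - 1500 * (93 - K) * (100 - K) * D - 2 * (K * D + 60 * K^3) * (100 - K) * (565 - 4 * K)" (is "0 \<le> ?P")
proof (cases "K \<le> 50")
  case True
  have "125 * ?P = 1674600 * (K^0 * (50 - K)^5) + 5945000 * (K^1 * (50 - K)^4) + 8312334 * (K^2 * (50 - K)^3) + 5783882 * (K^3 * (50 - K)^2) + 1984962 * (K^4 * (50 - K)^1) + 267014 * (K^5 * (50 - K)^0)"
    unfolding D_def by (simp add: eval_nat_numeral algebra_simps)
  also have "\<dots> \<ge> 0"
    using assms True by (intro add_nonneg_nonneg mult_nonneg_nonneg zero_le_power) auto
  finally show ?thesis by simp
next
  case False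
  have "19531250 * ?P = 57601702071 * ((K - 43)^0 * (93 - K)^5) + 162019287855 * ((K - 43)^1 * (93 - K)^4) + 166677718210 * ((K - 43)^2 * (93 - K)^3) + 67489448210 * ((K - 43)^3 * (93 - K)^2) + 2889382855 * ((K - 43)^4 * (93 - K)^1) + 1410067071 * ((K - 43)^5 * (93 - K)^0)"
    unfolding D_def by (simp add: eval_nat_numeral algebra_simps)
  also have "\<dots> \<ge> 0"
    using assms False by (intro add_nonneg_nonneg mult_nonneg_nonneg zero_le_power) auto
  finally show ?thesis by simp
qed

text \<open>For \<open>e <= 93/100\<close> one has \<open>T >= (1 + k) / (93/100 - k)\<close>.
  Inserting this into the two subtracted terms of the slack \<open>S\<close>, after
  \<open>(5 T + 4) / (T^2 + 6 T + 4) <= 5 / (T + 5)\<close>, gives the bracket on the right.\<close>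

lemma ln_ratio_far:
  fixes k :: real
  assumes "0 \<le> k" "k < 93/100"
  shows "ln ((1 + k) / (1 - k)) \<le> 2 * k + k\<^sup>2 *
    (2 - (93/100 - k) / (1 - k) - 5 * (93/100 - k) / (565/100 - 4 * k))"
proof -
  define D where "D = 1 - 84/100 * k\<^sup>2"
  define d1 where "d1 = 1 - k"
  define d2 where "d2 = 565/100 - 4 * k"
  define h where "h = 93/100 - k"
  have k2: "k\<^sup>2 \<le> 8649/10000" using power_mono[of k "93/100" 2] assms by (simp add: power2_eq_square)
  have D: "D > 0" "d1 > 0" "d2 > 0" using k2 assms by (auto simp: D_def d1_def d2_def)
  \<comment> \<open>The desired difference multiplied by its positive denominators;
    \<open>K = 100 * k\<close> turns it into a polynomial with integer coefficients.\<close>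
  let ?B = "2 * d1 * d2 * D - h * d2 * D - 5 * h * d1 * D - 2 * (k/3 * D + k^3/5) * d1 * d2"
  have "?B \<ge> 0"
    using ln_ratio_far_poly[of "100 * k"] assms
    unfolding D_def d1_def d2_def h_def by (simp add: eval_nat_numeral field_simps)
  moreover have "?B / (d1 * d2 * D) = 2 - h / d1 - 5 * h / d2 - 2 * (k/3 + (k^3/5) / D)"
    using D by (simp add: field_simps)
  ultimately have "2 * (k/3 + (k^3/5) / D) \<le> 2 - h / d1 - 5 * h / d2"
    using D by (smt (verit) divide_nonneg_nonneg mult_nonneg_nonneg)
  then have "k\<^sup>2 * (2 * (k/3 + (k^3/5) / D)) \<le> k\<^sup>2 * (2 - h / d1 - 5 * h / d2)"
    by (intro mult_left_mono) auto
  moreover have "2 * (k^3/3 + (k^5/5) / D) = k\<^sup>2 * (2 * (k/3 + (k^3/5) / D))"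
    by (simp add: power2_eq_square eval_nat_numeral field_simps)
  ultimately show ?thesis
    using ln_ratio_bound[of k] assms unfolding D_def d1_def d2_def h_def by linarith
qed

section \<open>The exponent for a suitable Chernoff parameter\<close>

text \<open>In the application \<open>T = t / q\<close>, and \<open>k\<close> is a nearly optimal choice of \<open>\<theta> q / 2\<close>.\<close>

lemma exponent_bound_small_mean:
  fixes e T p :: real
  assumes "0 < e" "e \<le> 1" "1 < T * e" "T \<le> 27/10 \<or> e \<le> 93/100"
  defines "k \<equiv> (T * e - 1) / (T + 1)"
  shows "0 < k" "k < 1"
    "(1 + k) / (1 - k) * exp (- (T * (2 * k) * ((1 - p) * (p + e) / (1 + k) - p * (1 - p - e) / (1 - k))))
       \<le> exp (- ((T * e - 1)\<^sup>2 * (T + 4) / (T\<^sup>2 + 6 * T + 4)))"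
proof -
  have T: "T > 0" using assms(1,3) by (metis less_trans zero_less_one zero_less_mult_pos2)
  have Te: "T * e \<le> T" using assms(2) T by simp
  then have T1: "T > 1" using assms(3) by simp
  show k0: "0 < k" using T assms(3) by (simp add: k_def)
  have kT: "T * e - 1 = k * (T + 1)" using T by (simp add: k_def)
  have "k * (T + 1) < 1 * (T + 1)" unfolding kT[symmetric] using Te by simp
  then show k1: "k < 1" using T by (simp add: mult_less_cancel_right)
  define M where "M = T\<^sup>2 + 6 * T + 4"
  have M: "M > 0" using T by (simp add: M_def add_pos_pos)
  define R where "R = T * (2 * k) * ((1 - p) * (p + e) / (1 + k) - p * (1 - p - e) / (1 - k))"
  \<comment> \<open>\<open>k^2 * S\<close> is the surplus of the rate over the target once
    \<open>2 * k\<close>, the first-order part of the logarithm of the prefactor, is set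
    aside.\<close>
  define S where "S = (2 - (1 + k) / (T * (1 - k)) - (5 * T + 4) / M)"
  \<comment> \<open>Completing the square isolates the dependence on \<open>p\<close>. The square
    vanishes at \<open>p = (1 - e) / 2\<close>, and dropping it makes the estimate uniform in
    \<open>p\<close>.\<close>
  have "(2 * k) * ((1 - p) * (p + e) / (1 + k) - p * (1 - p - e) / (1 - k))
      = (k * (2 * e - k * (1 + e\<^sup>2)) + k\<^sup>2 * (1 - 2 * p - e)\<^sup>2) / ((1 + k) * (1 - k))"
    using k0 k1 by (simp add: field_simps power2_eq_square)
  also have "\<dots> \<ge> (k * (2 * e - k * (1 + e\<^sup>2))) / ((1 + k) * (1 - k))"
    using k0 k1 by (intro divide_right_mono) auto
  finally have "T * ((k * (2 * e - k * (1 + e\<^sup>2))) / ((1 + k) * (1 - k))) \<le> R"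
    unfolding R_def mult.assoc using T by (intro mult_left_mono) auto
  moreover have "T * ((k * (2 * e - k * (1 + e\<^sup>2))) / ((1 + k) * (1 - k)))
      = 2 * k + k\<^sup>2 * (T + 2 - (1 + k) / (T * (1 - k)))"
  proof -
    have e: "e = (1 + k * (T + 1)) / T" using T kT by (simp add: field_simps)
    show ?thesis unfolding e using T k0 k1 
      by (simp add: divide_simps) (simp add: power2_eq_square algebra_simps)
  qed
  moreover have "(T * e - 1)\<^sup>2 * (T + 4) / M = k\<^sup>2 * (T + (5 * T + 4) / M)"
  proof -
    have "(T + 1)\<^sup>2 * (T + 4) / M = T + (5 * T + 4) / M"
      using M by (simp add: field_simps) (simp add: M_def power2_eq_square algebra_simps)
    then show ?thesis unfolding kT power_mult_distrib by (metis mult.assoc times_divide_eq_right)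
  qed
  ultimately have R: "2 * k + k\<^sup>2 * S \<le> R - (T * e - 1)\<^sup>2 * (T + 4) / M"
    by (simp add: S_def algebra_simps)
  have "ln ((1 + k) / (1 - k)) \<le> 2 * k + k\<^sup>2 * S"
    using assms(4)
  proof
    assume T27: "T \<le> 27/10"
    have kT1: "k * (T + 1) \<le> T - 1" using kT Te by simp
    have kb: "k \<le> 46/100"
    proof (rule ccontr)
      assume "\<not> k \<le> 46/100"
      then have "46/100 * (T + 1) < k * (T + 1)" using T by (intro mult_strict_right_mono) auto
      then show False using kT1 T27 by simp
    qed
    have x: "T * (1 - k) - (1 + k) \<ge> 0" using kT1 by (simp add: algebra_simps)
    have m: "11 - 6 * k - k\<^sup>2 > 0" using kb k0 power_le_one[of k 2] k1 by simp
    \<comment> \<open>The difference factors because equality holds at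
      \<open>T = (1 + k) / (1 - k)\<close>, the least \<open>T\<close> that \<open>e <= 1\<close>
      allows.\<close>
    have "(9 + k) * (1 - k) * M - (5 * T + 4) * (11 - 6 * k - k\<^sup>2) = (T * (1 - k) - (1 + k)) * ((9 + k) * T + 8)"
      by (simp add: M_def power2_eq_square algebra_simps)
    also have "\<dots> \<ge> 0" using x T k0 by simp
    finally have "(5 * T + 4) / M \<le> ((9 + k) * (1 - k)) / (11 - 6 * k - k\<^sup>2)"
      using M m by (intro frac_le_frac) auto
    also have "\<dots> = 1 - 2 * (1 + k) / (11 - 6 * k - k\<^sup>2)"
      using m by (simp add: field_simps power2_eq_square)
    finally have "(5 * T + 4) / M \<le> 1 - 2 * (1 + k) / (11 - 6 * k - k\<^sup>2)" .
    moreover have "(1 + k) / (T * (1 - k)) \<le> 1" using x T k1 by simp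
    ultimately have "2 * (1 + k) / (11 - 6 * k - k\<^sup>2) \<le> S" by (simp add: S_def)
    then have "k\<^sup>2 * (2 * (1 + k) / (11 - 6 * k - k\<^sup>2)) \<le> k\<^sup>2 * S" by (intro mult_left_mono) auto
    then show ?thesis using ln_ratio_near[of k] k0 kb by linarith
  next
    assume e93: "e \<le> 93/100"
    have "T * e \<le> T * (93/100)" using e93 T by (intro mult_left_mono) auto
    then have x: "1 + k \<le> T * (93/100 - k)" using kT by (simp add: algebra_simps)
    have k93: "k < 93/100"
    proof (rule ccontr)
      assume "\<not> k < 93/100"
      then have "T * (93/100 - k) \<le> 0" using T by (simp add: mult_le_0_iff)
      then show False using x k0 by simp
    qed
    have "(1 + k) / (T * (1 - k)) \<le> (T * (93/100 - k)) / (T * (1 - k))"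
      using x T k1 by (intro divide_right_mono) auto
    also have "\<dots> = (93/100 - k) / (1 - k)" using T by simp
    finally have 1: "(1 + k) / (T * (1 - k)) \<le> (93/100 - k) / (1 - k)" .
    have "(5 * T + 4) / M \<le> 5 / (T + 5)"
      using M T by (intro frac_le_frac) (auto simp: M_def power2_eq_square algebra_simps)
    also have "\<dots> \<le> (5 * (93/100 - k)) / (565/100 - 4 * k)"
      using x T k93 by (intro frac_le_frac) (auto simp: algebra_simps)
    finally have 2: "(5 * T + 4) / M \<le> (5 * (93/100 - k)) / (565/100 - 4 * k)" .
    have "k\<^sup>2 * (2 - (93/100 - k) / (1 - k) - 5 * (93/100 - k) / (565/100 - 4 * k)) \<le> k\<^sup>2 * S"
      using 1 2 by (intro mult_left_mono) (auto simp: S_def)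
    then show ?thesis using ln_ratio_far[of k] k0 k93 by linarith
  qed
  then have "ln ((1 + k) / (1 - k)) - R \<le> - ((T * e - 1)\<^sup>2 * (T + 4) / M)"
    using R by linarith
  then have "exp (ln ((1 + k) / (1 - k)) - R) \<le> exp (- ((T * e - 1)\<^sup>2 * (T + 4) / M))" by simp
  moreover have "exp (ln ((1 + k) / (1 - k)) - R) = (1 + k) / (1 - k) * exp (- R)"
    using k0 k1 by (simp add: exp_diff exp_minus divide_inverse)
  ultimately show "(1 + k) / (1 - k) * exp (- (T * (2 * k) * ((1 - p) * (p + e) / (1 + k) - p * (1 - p - e) / (1 - k))))
       \<le> exp (- ((T * e - 1)\<^sup>2 * (T + 4) / (T\<^sup>2 + 6 * T + 4)))"
    unfolding R_def M_def by metis
qed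

text \<open>The constant \<open>7/10\<close> is the bound \<open>35/100 q\<close> of \<open>deviation_kernel_lower_bound\<close> multiplied by
  \<open>\<theta> = 2 / q\<close>.\<close>

lemma exponent_bound_large_mean:
  fixes e T p :: real
  assumes "93/100 \<le> e" "e \<le> 1" "27/10 \<le> T" "0 \<le> p" "p \<le> 1 - e"
  shows "(1 + 1) / (1 - 7/10) * exp (- (T * 2 * ((1 - p) * (p + e) / (1 + 1) - p * (1 - p - e) / (1 - 7/10))))
       \<le> exp (- ((T * e - 1)\<^sup>2 * (T + 4) / (T\<^sup>2 + 6 * T + 4)))"
proof -
  define z where "z = 1 - e"
  have z: "0 \<le> z" "z \<le> 7/100" and e: "e = 1 - z" using assms by (auto simp: z_def)
  define M where "M = T\<^sup>2 + 6 * T + 4"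
  have M: "M > 0" using assms by (simp add: M_def add_pos_pos)
  define R where "R = T * 2 * ((1 - p) * (p + e) / (1 + 1) - p * (1 - p - e) / (1 - 7/10))"
  \<comment> \<open>The worst mean is again the midpoint, here of the range
    \<open>[0, z]\<close>.\<close>
  have "p * (z - p) \<le> z\<^sup>2 / 4"
    using zero_le_power2[of "p - z/2"] by (simp add: power2_eq_square algebra_simps)
  then have "e - 17/12 * z\<^sup>2 \<le> e - 17/3 * (p * (z - p))" by simp
  also have "\<dots> = 2 * ((1 - p) * (p + e) / (1 + 1) - p * (1 - p - e) / (1 - 7/10))"
    by (simp add: e field_simps)
  finally have R: "T * (e - 17/12 * z\<^sup>2) \<le> R"
    unfolding R_def mult.assoc using assms by (intro mult_left_mono) auto
  \<comment> \<open>20/3 is the prefactor \<open>2 / (3/10)\<close>, and \<open>17/23\<close> is the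
    \<open>k\<close> with \<open>(1 + k) / (1 - k) = 20/3\<close>.\<close>
  have l: "ln (20/3) \<le> (192/100 :: real)"
    using ln_ratio_bound[of "17/23"] by (simp add: power_divide)
  define B where "B = T * (T\<^sup>2 * (1 - 29/12 * (7/100)) - 875/1000 * T - (12 + 17/3 * (7/100)))"
  have "0 \<le> (T * (e - 17/12 * z\<^sup>2) - 192/100) * M - (T * e - 1)\<^sup>2 * (T + 4)"
  proof -
    have z2: "z\<^sup>2 \<le> 7/100 * z" using mult_right_mono[OF z(2,1)] by (simp add: power2_eq_square)
    have "(T * (e - 17/12 * z\<^sup>2) - 192/100) * M - (T * e - 1)\<^sup>2 * (T + 4)
      = T^3 * z - 52/100 * T + 208/100 * T\<^sup>2 - 12 * T * z - 1168/100
        - (29/12 * T^3 + 125/10 * T\<^sup>2 + 17/3 * T) * z\<^sup>2"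
      by (simp add: e M_def power2_eq_square power3_eq_cube field_simps)
    moreover have "(29/12 * T^3 + 125/10 * T\<^sup>2 + 17/3 * T) * z\<^sup>2 \<le> (29/12 * T^3 + 125/10 * T\<^sup>2 + 17/3 * T) * (7/100 * z)"
      using z2 assms by (intro mult_left_mono) auto
    moreover have "T^3 * z - 52/100 * T + 208/100 * T\<^sup>2 - 12 * T * z - 1168/100
        - (29/12 * T^3 + 125/10 * T\<^sup>2 + 17/3 * T) * (7/100 * z) = z * B + (208/100 * T\<^sup>2 - 52/100 * T - 1168/100)"
      by (simp add: B_def power2_eq_square power3_eq_cube field_simps)
    \<comment> \<open>After \<open>z^2 <= 7/100 * z\<close> the expression is affine in
      \<open>z\<close>, so only the ends \<open>z = 0\<close> and \<open>z = 7/100\<close> matter;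
      the sign of \<open>B\<close> tells which one.\<close>
    moreover have "0 \<le> z * B + (208/100 * T\<^sup>2 - 52/100 * T - 1168/100)"
    proof -
      define x where "x = T - 27/10"
      have x: "x \<ge> 0" "T = x + 27/10" using assms by (auto simp: x_def)
      have p: "208/100 * T\<^sup>2 - 52/100 * T - 1168/100 \<ge> 0"
        unfolding x(2) using x(1) by (simp add: power2_eq_square field_simps)
      show ?thesis
      proof (cases "B \<ge> 0")
        case True
        then show ?thesis using p z by simp
      next
        case False
        then have "7/100 * B \<le> z * B" using z by (intro mult_right_mono_neg) auto
        moreover have "0 \<le> 7/100 * B + (208/100 * T\<^sup>2 - 52/100 * T - 1168/100)"
          unfolding B_def x(2) using x(1) by (simp add: power2_eq_square field_simps)
        ultimately show ?thesis by linarith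
      qed
    qed
    ultimately show ?thesis by linarith
  qed
  then have "(T * e - 1)\<^sup>2 * (T + 4) / M \<le> T * (e - 17/12 * z\<^sup>2) - 192/100"
    using M by (simp add: pos_divide_le_eq)
  then have "ln (20/3) - R \<le> - ((T * e - 1)\<^sup>2 * (T + 4) / M)" using R l by linarith
  then have "exp (ln (20/3) - R) \<le> exp (- ((T * e - 1)\<^sup>2 * (T + 4) / M))" by simp
  moreover have "exp (ln (20/3) - R) = (1 + 1) / (1 - 7/10) * exp (- R)"
    by (simp add: exp_diff exp_minus inverse_eq_divide)
  ultimately show ?thesis unfolding R_def M_def by metis
qed

section \<open>Ergodic semigroups and the deviation kernel\<close>

lemma integrable_bounded_prob:
  assumes "prob_space N" "h \<in> borel_measurable N" "\<And>y. y \<in> space N \<Longrightarrow> \<bar>h y :: real\<bar> \<le> B"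
  shows "integrable N h"
proof -
  interpret prob_space N by fact
  show ?thesis using assms by (intro integrable_const_bound[of _ B]) auto
qed

lemma integral_bounded_prob:
  assumes "prob_space N" "h \<in> borel_measurable N" "\<And>y. y \<in> space N \<Longrightarrow> \<bar>h y :: real\<bar> \<le> B"
  shows "\<bar>\<integral>y. h y \<partial>N\<bar> \<le> B"
proof -
  interpret prob_space N by fact
  have i: "integrable N h" by (rule integrable_bounded_prob[OF assms])
  have "(\<integral>y. h y \<partial>N) \<le> B" "- B \<le> (\<integral>y. h y \<partial>N)"
    using assms(3) i by (auto intro!: integral_le_const integral_ge_const simp: abs_le_iff minus_le_iff)
  then show ?thesis by linarith
qed

text \<open>Layer-cake representation: \<open>h y\<close> is the Lebesgue measure of the levels \<open>r \<in> [0, 1]\<close> below it.\<close>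

lemma abs_integral_diff_le_tv_dist:
  assumes "prob_space N" "prob_space N'" and sets: "sets N = sets N'"
    and h: "h \<in> borel_measurable N'" "\<And>y. y \<in> space N' \<Longrightarrow> 0 \<le> h y \<and> h y \<le> 1"
  shows "\<bar>(\<integral>y. h y \<partial>N) - (\<integral>y. h y \<partial>N')\<bar> \<le> tv_dist N N'"
proof -
  interpret N: prob_space N by fact
  interpret N': prob_space N' by fact
  have space: "space N = space N'" by (rule sets_eq_imp_space_eq[OF sets])
  have bdd: "bdd_above ((\<lambda>A. \<bar>measure N A - measure N' A\<bar>) ` sets N')"
  proof (rule bdd_aboveI2[where M = 1])
    fix A assume "A \<in> sets N'"
    show "\<bar>measure N A - measure N' A\<bar> \<le> 1"
      using N.prob_le_1[of A] N'.prob_le_1[of A] measure_nonneg[of N A] measure_nonneg[of N' A] by linarith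
  qed
  define L where "L = uniform_measure lborel {0..1::real}"
  have L: "prob_space L" unfolding L_def by (rule prob_space_uniform_measure) auto
  interpret L: prob_space L by fact
  have setsL[measurable_cong]: "sets L = sets borel" by (simp add: L_def)
  have lev: "(\<integral>r. (if r < c then 1 else 0) \<partial>L) = c" if "0 \<le> c" "c \<le> 1" for c :: real
  proof -
    have "{0..1} \<inter> {r'. r' < c} = {0..<c}" using that by auto
    then have "measure L {r'. r' < c} = c" using that
      by (simp add: L_def measure_uniform_measure)
    then have "(\<integral>r. indicat_real {r'. r' < c} r \<partial>L) = c"
      by (simp add: L_def)
    moreover have "(\<integral>r. (if r < c then 1 else 0) \<partial>L) = (\<integral>r. indicat_real {r'. r' < c} r \<partial>L)"
      by (intro Bochner_Integration.integral_cong) (auto simp: indicator_def)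
    ultimately show ?thesis by simp
  qed
  have layer: "(\<integral>y. h y \<partial>K) = (\<integral>r. measure K {y \<in> space N'. r < h y} \<partial>L)"
    if K: "prob_space K" "sets K = sets N'" for K
  proof -
    interpret K: prob_space K by fact
    interpret pair_prob_space K L ..
    have [measurable_cong]: "sets K = sets N'" by fact
    have sp: "space K = space N'" by (rule sets_eq_imp_space_eq[OF K(2)])
    have [measurable]: "h \<in> borel_measurable N'" by fact
    have int: "integrable (K \<Otimes>\<^sub>M L) (\<lambda>(y, r). if r < h y then 1 else 0 :: real)"
    proof (rule integrable_bounded_prob[where B = 1])
      show "prob_space (K \<Otimes>\<^sub>M L)" by (rule P.prob_space_axioms)
      show "(\<lambda>(y, r). if r < h y then 1 else 0 :: real) \<in> borel_measurable (K \<Otimes>\<^sub>M L)"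
        by measurable
    qed (simp add: split_beta')
    have "(\<integral>y. h y \<partial>K) = (\<integral>y. (\<integral>r. (if r < h y then 1 else 0) \<partial>L) \<partial>K)"
      using h(2) sp by (intro Bochner_Integration.integral_cong) (auto simp: lev)
    also have "\<dots> = (\<integral>r. (\<integral>y. (if r < h y then 1 else 0) \<partial>K) \<partial>L)"
      by (rule Fubini_integral[OF int, symmetric])
    also have "\<dots> = (\<integral>r. measure K {y \<in> space N'. r < h y} \<partial>L)"
    proof (intro Bochner_Integration.integral_cong refl)
      fix r
      have "(\<integral>y. (if r < h y then 1 else 0) \<partial>K) = (\<integral>y. indicat_real {y \<in> space N'. r < h y} y \<partial>K)"
        by (intro Bochner_Integration.integral_cong refl) (auto simp: indicator_def sp)
      also have "\<dots> = measure K ({y \<in> space N'. r < h y} \<inter> space K)" by simp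
      finally show "(\<integral>y. (if r < h y then 1 else 0) \<partial>K) = measure K {y \<in> space N'. r < h y}"
        by (simp add: sp Int_absorb2 Collect_mono_iff inf.absorb1)
    qed
    finally show ?thesis .
  qed
  have m: "(\<lambda>r. measure K {y \<in> space N'. r < h y}) \<in> borel_measurable L"
    if K: "prob_space K" "sets K = sets N'" for K
  proof -
    interpret K: prob_space K by fact
    have [measurable_cong]: "sets K = sets N'" by fact
    have sp: "space K = space N'" by (rule sets_eq_imp_space_eq[OF K(2)])
    have [measurable]: "h \<in> borel_measurable N'" by fact
    have "(\<lambda>r. measure K {y \<in> space K. r < h y}) \<in> borel_measurable L" by measurable
    then show ?thesis by (simp add: sp)
  qed
  have int: "integrable L (\<lambda>r. measure K {y \<in> space N'. r < h y})"
    if K: "prob_space K" "sets K = sets N'" for K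
    using m[OF K] prob_space.prob_le_1[OF K(1)] by (intro integrable_bounded_prob[OF L, where B = 1]) auto
  have "(\<integral>y. h y \<partial>N) - (\<integral>y. h y \<partial>N')
    = (\<integral>r. measure N {y \<in> space N'. r < h y} - measure N' {y \<in> space N'. r < h y} \<partial>L)"
    using layer[of N] layer[of N'] int[of N] int[of N'] assms(1-3) by simp
  also have "\<bar>\<dots>\<bar> \<le> tv_dist N N'"
  proof (rule integral_bounded_prob[OF L])
    show "(\<lambda>r. measure N {y \<in> space N'. r < h y} - measure N' {y \<in> space N'. r < h y}) \<in> borel_measurable L"
      using m[of N] m[of N'] assms(1-3) by simp
    fix r
    have "{y \<in> space N'. r < h y} \<in> sets N'" using h(1) by simp
    then show "\<bar>measure N {y \<in> space N'. r < h y} - measure N' {y \<in> space N'. r < h y}\<bar> \<le> tv_dist N N'"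
      unfolding tv_dist_def by (intro cSUP_upper[OF _ bdd])
  qed
  finally show ?thesis .
qed

section \<open>Semigroups measurable jointly in time and space\<close>

text \<open>Time integrals of \<open>P t\<close> and Fubini's theorem need measurability in
  \<open>(t, y)\<close> jointly, whereas \<open>transition_semigroup\<close> provides it for each
  fixed \<open>t\<close>. The clamp \<open>max 0 t\<close> makes the map total on the Borel line
  without constraining \<open>P\<close> at negative times.\<close>

locale measurable_semigroup =
  fixes E :: "'s measure" and P :: "real \<Rightarrow> 's \<Rightarrow> 's measure"
  assumes semigroup: "transition_semigroup E P"
    and joint_kernel: "(\<lambda>(t, y). P (max 0 t) y) \<in> borel \<Otimes>\<^sub>M E \<rightarrow>\<^sub>M prob_algebra E"
begin

lemma kernel: "0 \<le> t \<Longrightarrow> P t \<in> E \<rightarrow>\<^sub>M prob_algebra E"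
  using semigroup by (auto simp: transition_semigroup_def)

lemma kernel_subprob: "0 \<le> t \<Longrightarrow> P t \<in> E \<rightarrow>\<^sub>M subprob_algebra E"
  by (rule measurable_prob_algebraD[OF kernel])

lemma
  assumes "0 \<le> t" "y \<in> space E"
  shows prob_space_kernel: "prob_space (P t y)"
    and sets_kernel: "sets (P t y) = sets E"
    and space_kernel: "space (P t y) = space E"
  using measurable_space[OF kernel[OF assms(1)] assms(2)]
  by (auto simp: space_prob_algebra dest: sets_eq_imp_space_eq)

lemma borel_measurable_kernel:
  "0 \<le> t \<Longrightarrow> y \<in> space E \<Longrightarrow> h \<in> borel_measurable E \<Longrightarrow> h \<in> borel_measurable (P t y)"
  using measurable_cong_sets[OF sets_kernel refl] by blast

lemma
  assumes "h \<in> borel_measurable E" "\<And>y. y \<in> space E \<Longrightarrow> \<bar>h y :: real\<bar> \<le> B" "0 \<le> t" "y \<in> space E"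
  shows integrable_kernel: "integrable (P t y) h"
    and abs_kernel_le: "\<bar>\<integral>z. h z \<partial>P t y\<bar> \<le> B"
proof -
  note * = prob_space_kernel[OF assms(3,4)] borel_measurable_kernel[OF assms(3,4,1)]
  have "\<bar>h z\<bar> \<le> B" if "z \<in> space (P t y)" for z
    using assms(2) that space_kernel[OF assms(3,4)] by simp
  then show "integrable (P t y) h" "\<bar>\<integral>z. h z \<partial>P t y\<bar> \<le> B"
    using integrable_bounded_prob[OF *] integral_bounded_prob[OF *] by blast+
qed

lemma borel_measurable_joint:
  assumes h[measurable]: "(h :: 's \<Rightarrow> real) \<in> borel_measurable E"
  shows "(\<lambda>(t, y). \<integral>z. h z \<partial>P (max 0 t) y) \<in> borel_measurable (borel \<Otimes>\<^sub>M E)"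
  using measurable_compose[OF measurable_prob_algebraD[OF joint_kernel] integral_measurable_subprob_algebra[OF h]]
  by (simp add: split_beta')

lemma borel_measurable_space:
  assumes h[measurable]: "(h :: 's \<Rightarrow> real) \<in> borel_measurable E" and t: "0 \<le> t"
  shows "(\<lambda>y. \<integral>z. h z \<partial>P t y) \<in> borel_measurable E"
  using measurable_compose[OF kernel_subprob[OF t] integral_measurable_subprob_algebra[OF h]] .

lemma borel_measurable_time:
  assumes h: "(h :: 's \<Rightarrow> real) \<in> borel_measurable E" and y: "y \<in> space E"
  shows "(\<lambda>t. \<integral>z. h z \<partial>P (max 0 t) y) \<in> borel_measurable borel"
  using measurable_compose[OF measurable_Pair2'[OF y] borel_measurable_joint[OF h]] by simp

lemma chapman_kolmogorov:
  assumes h: "h \<in> borel_measurable E" "\<And>y. y \<in> space E \<Longrightarrow> \<bar>h y :: real\<bar> \<le> B"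
    and "0 \<le> s" "0 \<le> t" "y \<in> space E"
  shows "(\<integral>z. (\<integral>v. h v \<partial>P t z) \<partial>P s y) = (\<integral>v. h v \<partial>P (s + t) y)"
proof -
  have "P (s + t) y = P s y \<bind> P t"
    using semigroup assms by (auto simp: transition_semigroup_def)
  moreover have "(\<integral>v. h v \<partial>(P s y \<bind> P t)) = (\<integral>z. (\<integral>v. h v \<partial>P t z) \<partial>P s y)"
  proof (rule integral_bind[where B' = 1, OF h])
    show "P t \<in> P s y \<rightarrow>\<^sub>M subprob_algebra E"
      using kernel_subprob[of t] sets_kernel[of s y] assms by (metis measurable_cong_sets)
    show "finite_measure (P s y)"
      using prob_space_kernel[of s y] assms by (simp add: prob_space_def)
    show "AE z in P s y. emeasure (P t z) (space (P t z)) \<le> ennreal 1"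
      using prob_space_kernel[of t] assms space_kernel[of s y] by (auto simp: prob_space.emeasure_space_1)
  qed auto
  ultimately show ?thesis by simp
qed

end

lemma integrable_exp_decay:
  fixes c b :: real
  assumes "0 < b"
  shows "integrable lborel (\<lambda>t. indicator {0..} t * (c * exp (- b * t)))"
    and "(\<integral>t. indicator {0..} t * (c * exp (- b * t)) \<partial>lborel) = c / b"
proof -
  have "((\<lambda>t. - exp (- b * t) / b) \<longlongrightarrow> 0) at_top"
  proof -
    have "filterlim (\<lambda>t. b * t) at_top at_top"
      using assms by (intro filterlim_tendsto_pos_mult_at_top[OF tendsto_const _ filterlim_ident])
    then have "((\<lambda>t. exp (- (b * t))) \<longlongrightarrow> 0) at_top"
      by (intro filterlim_compose[OF exp_at_bot]) (simp add: filterlim_uminus_at_bot)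
    from tendsto_divide[OF tendsto_minus[OF this] tendsto_const[of b]] show ?thesis using assms by simp
  qed
  then have nn: "(\<integral>\<^sup>+ t. ennreal (exp (- b * t)) * indicator {0..} t \<partial>lborel) = ennreal (0 - (- exp (- b * 0) / b))"
    using assms by (intro nn_integral_FTC_atLeast) (auto intro!: derivative_eq_intros)
  have "has_bochner_integral lborel (\<lambda>t. indicator {0..} t * exp (- b * t)) (1 / b)"
    using assms nn by (intro has_bochner_integral_nn_integral)
      (auto simp: ennreal_mult' ennreal_indicator mult.commute)
  from has_bochner_integral_mult_right[OF this, of c]
  have "has_bochner_integral lborel (\<lambda>t. indicator {0..} t * (c * exp (- b * t))) (c / b)"
    by (simp add: mult_ac)
  then show "integrable lborel (\<lambda>t. indicator {0..} t * (c * exp (- b * t)))"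
    and "(\<integral>t. indicator {0..} t * (c * exp (- b * t)) \<partial>lborel) = c / b"
    by (auto simp: has_bochner_integral_iff)
qed

section \<open>Exponential decay and Dynkin's formula\<close>

locale ergodic_semigroup = measurable_semigroup E P
  for E :: "'s measure" and P +
  fixes \<pi> :: "'s measure"
  assumes stationary: "stationary_distribution E P \<pi>"
    and ergodic: "uniformly_ergodic E P \<pi>"
begin

lemma prob_space_pi: "prob_space \<pi>" and sets_pi: "sets \<pi> = sets E" and space_pi: "space \<pi> = space E"
  using stationary by (auto simp: stationary_distribution_def space_prob_algebra dest: sets_eq_imp_space_eq)

lemma borel_measurable_pi: "h \<in> borel_measurable E \<Longrightarrow> h \<in> borel_measurable \<pi>"
  using measurable_cong_sets[OF sets_pi refl] by blast

lemma integral_kernel_pi: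
  assumes h: "h \<in> borel_measurable E" "\<And>y. y \<in> space E \<Longrightarrow> \<bar>h y :: real\<bar> \<le> B" and t: "0 \<le> t"
  shows "(\<integral>z. (\<integral>v. h v \<partial>P t z) \<partial>\<pi>) = (\<integral>v. h v \<partial>\<pi>)"
proof -
  have "(\<integral>v. h v \<partial>(\<pi> \<bind> P t)) = (\<integral>z. (\<integral>v. h v \<partial>P t z) \<partial>\<pi>)"
  proof (rule integral_bind[where B' = 1, OF h])
    show "P t \<in> \<pi> \<rightarrow>\<^sub>M subprob_algebra E"
      using kernel_subprob[OF t] measurable_cong_sets[OF sets_pi refl] by blast
    show "finite_measure \<pi>" using prob_space_pi by (simp add: prob_space_def)
    show "AE z in \<pi>. emeasure (P t z) (space (P t z)) \<le> ennreal 1"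
      using prob_space_kernel[of t] t space_pi by (auto simp: prob_space.emeasure_space_1)
  qed auto
  then show ?thesis using stationary t by (simp add: stationary_distribution_def)
qed

lemma tv_dist_decay:
  obtains C b where "0 < C" "0 < b"
    "\<And>t y. 0 \<le> t \<Longrightarrow> y \<in> space E \<Longrightarrow> tv_dist (P t y) \<pi> \<le> C * exp (- b * t)"
proof -
  obtain C b where b: "0 < b"
    and C: "\<And>t. 0 \<le> t \<Longrightarrow> (SUP x\<in>space E. tv_dist (P t x) \<pi>) \<le> C * exp (- b * t)"
    using ergodic by (auto simp: uniformly_ergodic_def)
  have "tv_dist (P t y) \<pi> \<le> \<bar>C\<bar> * exp (- b * t) + 0" if t: "0 \<le> t" and y: "y \<in> space E" for t y
  proof -
    interpret pi: prob_space \<pi> by (rule prob_space_pi)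
    have "tv_dist (P t z) \<pi> \<le> 1" if "z \<in> space E" for z
      unfolding tv_dist_def
    proof (rule cSUP_least)
      interpret Pz: prob_space "P t z" by (rule prob_space_kernel[OF t that])
      fix A
      show "\<bar>measure (P t z) A - measure \<pi> A\<bar> \<le> 1"
        using pi.prob_le_1[of A] Pz.prob_le_1[of A] measure_nonneg[of \<pi> A] measure_nonneg[of "P t z" A]
        by linarith
    qed auto
    \<comment> \<open>A real \<open>SUP\<close> is known to dominate its members only when the set
      is bounded above.\<close>
    then have "bdd_above ((\<lambda>z. tv_dist (P t z) \<pi>) ` space E)" by (intro bdd_aboveI2)
    then have "tv_dist (P t y) \<pi> \<le> (SUP x\<in>space E. tv_dist (P t x) \<pi>)" using y by (intro cSUP_upper)
    also have "\<dots> \<le> C * exp (- b * t)" by (rule C[OF t])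
    also have "\<dots> \<le> \<bar>C\<bar> * exp (- b * t)" by (intro mult_right_mono) auto
    finally show ?thesis by simp
  qed
  then have "tv_dist (P t y) \<pi> \<le> (\<bar>C\<bar> + 1) * exp (- b * t)" if "0 \<le> t" "y \<in> space E" for t y
    using that by (smt (verit) distrib_right exp_ge_zero mult_le_cancel_right1 mult_right_mono)
  with b that[of "\<bar>C\<bar> + 1" b] show thesis by simp
qed

text \<open>\<open>tv_dist\<close> is a supremum over events and so controls integrands with values
  in \<open>[0, 1]\<close>. A function bounded by \<open>B\<close> becomes one after affine
  rescaling by \<open>2 * B\<close>, whence twice the constant of
  \<open>tv_dist_decay\<close>.\<close>

lemma kernel_decay:
  obtains C b where "0 < C" "0 < b"
    "\<And>h B t y. h \<in> borel_measurable E \<Longrightarrow> (\<And>z. z \<in> space E \<Longrightarrow> \<bar>h z :: real\<bar> \<le> B) \<Longrightarrow> 0 \<le> t \<Longrightarrow>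
       y \<in> space E \<Longrightarrow> \<bar>(\<integral>z. h z \<partial>P t y) - (\<integral>z. h z \<partial>\<pi>)\<bar> \<le> B * C * exp (- b * t)"
proof -
  obtain C b where C: "0 < C" "0 < b"
    "\<And>t y. 0 \<le> t \<Longrightarrow> y \<in> space E \<Longrightarrow> tv_dist (P t y) \<pi> \<le> C * exp (- b * t)"
    using tv_dist_decay by blast
  have "\<bar>(\<integral>z. h z \<partial>P t y) - (\<integral>z. h z \<partial>\<pi>)\<bar> \<le> B * (2 * C) * exp (- b * t)"
    if h: "h \<in> borel_measurable E" "\<And>z. z \<in> space E \<Longrightarrow> \<bar>h z :: real\<bar> \<le> B"
      and t: "0 \<le> t" and y: "y \<in> space E" for h B t y
  proof (cases "B = 0")
    case True
    have "\<bar>\<integral>z. h z \<partial>P t y\<bar> \<le> 0" using abs_kernel_le[OF h t y] True by simp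
    moreover have "\<bar>\<integral>z. h z \<partial>\<pi>\<bar> \<le> 0"
      using h True by (intro integral_bounded_prob[OF prob_space_pi borel_measurable_pi]) (auto simp: space_pi)
    ultimately show ?thesis using True by simp
  next
    case False
    then have B: "B > 0" using h(2)[OF y] by linarith
    define g where "g z = (h z + B) / (2 * B)" for z
    have g: "g \<in> borel_measurable E" unfolding g_def using h(1) by simp
    have g01: "0 \<le> g z \<and> g z \<le> 1" if "z \<in> space E" for z
      using h(2)[OF that] B by (auto simp: g_def field_simps abs_le_iff)
    have hg: "h = (\<lambda>z. 2 * B * g z - B)" using B by (auto simp: g_def)
    have eq: "(\<integral>z. h z \<partial>K) = 2 * B * (\<integral>z. g z \<partial>K) - B"
      if "prob_space K" "sets K = sets E" for K
    proof -
      interpret K: prob_space K by fact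
      have "integrable K g"
        using g g01 that measurable_cong_sets[OF that(2) refl] sets_eq_imp_space_eq[OF that(2)]
        by (intro integrable_bounded_prob[OF that(1), where B = 1]) auto
      then show ?thesis unfolding hg by (simp add: K.prob_space)
    qed
    have "\<bar>(\<integral>z. g z \<partial>P t y) - (\<integral>z. g z \<partial>\<pi>)\<bar> \<le> tv_dist (P t y) \<pi>"
      using prob_space_kernel[OF t y] prob_space_pi sets_kernel[OF t y] sets_pi borel_measurable_pi[OF g] g01
      by (intro abs_integral_diff_le_tv_dist) (auto simp: space_pi)
    also have "\<dots> \<le> C * exp (- b * t)" by (rule C(3)[OF t y])
    finally have "2 * B * \<bar>(\<integral>z. g z \<partial>P t y) - (\<integral>z. g z \<partial>\<pi>)\<bar> \<le> 2 * B * (C * exp (- b * t))"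
      using B by (intro mult_left_mono) auto
    moreover have "(\<integral>z. h z \<partial>P t y) - (\<integral>z. h z \<partial>\<pi>) = 2 * B * ((\<integral>z. g z \<partial>P t y) - (\<integral>z. g z \<partial>\<pi>))"
      using eq[OF prob_space_kernel[OF t y] sets_kernel[OF t y]] eq[OF prob_space_pi sets_pi]
      by (simp add: algebra_simps)
    ultimately show ?thesis using B by (simp add: abs_mult)
  qed
  with C that[of "2 * C" b] show thesis by simp
qed

text \<open>The indicator and the clamped time are built in so that translation, integration over
  the line and joint measurability need no side condition on \<open>t\<close>.\<close>

definition deviation :: "('s \<Rightarrow> real) \<Rightarrow> real \<Rightarrow> 's \<Rightarrow> real" where
  "deviation h t y = indicator {0..} t * ((\<integral>z. h z \<partial>P (max 0 t) y) - (\<integral>z. h z \<partial>\<pi>))"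

lemma deviation_kernel_eq: "deviation_kernel P \<pi> h y = (\<integral>t. deviation h t y \<partial>lborel)"
  unfolding deviation_kernel_def set_lebesgue_integral_def deviation_def
  by (intro Bochner_Integration.integral_cong) (auto simp: indicator_def)

lemma borel_measurable_deviation_joint:
  assumes "h \<in> borel_measurable E"
  shows "(\<lambda>(t, y). deviation h t y) \<in> borel_measurable (borel \<Otimes>\<^sub>M E)"
proof -
  have [measurable]: "(\<lambda>x. \<integral>z. h z \<partial>P (max 0 (fst x)) (snd x)) \<in> borel_measurable (borel \<Otimes>\<^sub>M E)"
    using borel_measurable_joint[OF assms] by (simp add: split_beta')
  have "(\<lambda>x. indicator {0..} (fst x) * ((\<integral>z. h z \<partial>P (max 0 (fst x)) (snd x)) - (\<integral>z. h z \<partial>\<pi>)))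
    \<in> borel_measurable (borel \<Otimes>\<^sub>M E)" by measurable
  then show ?thesis by (simp add: split_beta' deviation_def)
qed

lemma borel_measurable_deviation_joint':
  assumes "h \<in> borel_measurable E" "sets K = sets E"
  shows "(\<lambda>(y, t). deviation h t y) \<in> borel_measurable (K \<Otimes>\<^sub>M lborel)"
proof -
  have "(\<lambda>(y, t). deviation h t y) \<in> borel_measurable (E \<Otimes>\<^sub>M borel)"
    using measurable_compose[OF measurable_pair_swap' borel_measurable_deviation_joint[OF assms(1)]]
    by (simp add: split_beta')
  moreover have "sets (K \<Otimes>\<^sub>M lborel) = sets (E \<Otimes>\<^sub>M (borel :: real measure))"
    using assms(2) by (intro sets_pair_measure_cong) auto
  ultimately show ?thesis using measurable_cong_sets by blast
qed

lemma borel_measurable_deviation: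
  assumes "h \<in> borel_measurable E" "y \<in> space E"
  shows "(\<lambda>t. deviation h t y) \<in> borel_measurable lborel"
  using measurable_compose[OF measurable_Pair2'[OF assms(2)] borel_measurable_deviation_joint[OF assms(1)]]
  by simp

lemma borel_measurable_deviation_kernel:
  assumes "h \<in> borel_measurable E"
  shows "deviation_kernel P \<pi> h \<in> borel_measurable E"
  unfolding deviation_kernel_eq[abs_def]
  by (intro lborel.borel_measurable_lebesgue_integral borel_measurable_deviation_joint' assms) simp

lemma deviation_bound:
  obtains C b where "0 < C" "0 < b"
    "\<And>h B t y. h \<in> borel_measurable E \<Longrightarrow> (\<And>z. z \<in> space E \<Longrightarrow> \<bar>h z :: real\<bar> \<le> B) \<Longrightarrow>
       y \<in> space E \<Longrightarrow> \<bar>deviation h t y\<bar> \<le> indicator {0..} t * (B * C * exp (- b * t))"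
proof -
  obtain C b where C: "0 < C" "0 < b"
    "\<And>h B t y. h \<in> borel_measurable E \<Longrightarrow> (\<And>z. z \<in> space E \<Longrightarrow> \<bar>h z :: real\<bar> \<le> B) \<Longrightarrow> 0 \<le> t \<Longrightarrow>
       y \<in> space E \<Longrightarrow> \<bar>(\<integral>z. h z \<partial>P t y) - (\<integral>z. h z \<partial>\<pi>)\<bar> \<le> B * C * exp (- b * t)"
    using kernel_decay by blast
  have "\<bar>deviation h t y\<bar> \<le> indicator {0..} t * (B * C * exp (- b * t))"
    if "h \<in> borel_measurable E" "\<And>z. z \<in> space E \<Longrightarrow> \<bar>h z :: real\<bar> \<le> B" "y \<in> space E" for h B t y
    using C(3)[OF that(1,2) _ that(3), of t] by (auto simp: deviation_def indicator_def)
  with C that show thesis by blast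
qed

lemma integrable_deviation:
  assumes h: "h \<in> borel_measurable E" "\<And>z. z \<in> space E \<Longrightarrow> \<bar>h z :: real\<bar> \<le> B" and y: "y \<in> space E"
  shows "integrable lborel (\<lambda>t. deviation h t y)"
proof -
  obtain C b where C: "0 < C" "0 < b"
    "\<And>t. \<bar>deviation h t y\<bar> \<le> indicator {0..} t * (B * C * exp (- b * t))"
    using deviation_bound h y by metis
  show ?thesis
    by (rule Bochner_Integration.integrable_bound[OF integrable_exp_decay(1)[OF C(2), of "B * C"]])
      (use C(3) borel_measurable_deviation[OF h(1) y] in \<open>auto intro!: AE_I2 order_trans[OF C(3)]\<close>)
qed

lemma deviation_kernel_bounded:
  obtains K where "0 < K"
    "\<And>h B y. h \<in> borel_measurable E \<Longrightarrow> (\<And>z. z \<in> space E \<Longrightarrow> \<bar>h z :: real\<bar> \<le> B) \<Longrightarrow>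
       y \<in> space E \<Longrightarrow> \<bar>deviation_kernel P \<pi> h y\<bar> \<le> B * K \<and> (\<integral>t. \<bar>deviation h t y\<bar> \<partial>lborel) \<le> B * K"
proof -
  obtain C b where C: "0 < C" "0 < b"
    "\<And>h B t y. h \<in> borel_measurable E \<Longrightarrow> (\<And>z. z \<in> space E \<Longrightarrow> \<bar>h z :: real\<bar> \<le> B) \<Longrightarrow>
       y \<in> space E \<Longrightarrow> \<bar>deviation h t y\<bar> \<le> indicator {0..} t * (B * C * exp (- b * t))"
    using deviation_bound by blast
  have "\<bar>deviation_kernel P \<pi> h y\<bar> \<le> B * (C / b) \<and> (\<integral>t. \<bar>deviation h t y\<bar> \<partial>lborel) \<le> B * (C / b)"
    if "h \<in> borel_measurable E" "\<And>z. z \<in> space E \<Longrightarrow> \<bar>h z :: real\<bar> \<le> B" "y \<in> space E" for h B y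
  proof -
    have i: "integrable lborel (\<lambda>t. deviation h t y)" by (rule integrable_deviation[OF that])
    have "(\<integral>t. \<bar>deviation h t y\<bar> \<partial>lborel) \<le> (\<integral>t. indicator {0..} t * (B * C * exp (- b * t)) \<partial>lborel)"
      using i integrable_exp_decay(1)[OF C(2)] C(3)[OF that] by (intro integral_mono) auto
    also have "\<dots> = B * (C / b)" using integrable_exp_decay(2)[OF C(2), of "B * C"] by simp
    finally show ?thesis
      using order_trans[OF integral_abs_bound[of lborel "\<lambda>t. deviation h t y"]]
      by (simp add: deviation_kernel_eq)
  qed
  with C that[of "C / b"] show thesis by simp
qed

text \<open>A constant has the same integral under every probability measure, so it cancels at each
  time.\<close>

lemma deviation_kernel_affine:
  assumes h: "h \<in> borel_measurable E" "\<And>z. z \<in> space E \<Longrightarrow> \<bar>h z :: real\<bar> \<le> B" and y: "y \<in> space E"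
  shows "deviation_kernel P \<pi> (\<lambda>z. a * h z + c) y = a * deviation_kernel P \<pi> h y"
proof -
  have eq: "(\<integral>z. a * h z + c \<partial>K) = a * (\<integral>z. h z \<partial>K) + c"
    if "prob_space K" "sets K = sets E" for K
  proof -
    interpret K: prob_space K by fact
    have "integrable K h"
      using h that measurable_cong_sets[OF that(2) refl] sets_eq_imp_space_eq[OF that(2)]
      by (intro integrable_bounded_prob[OF that(1), where B = B]) auto
    then show ?thesis by (simp add: K.prob_space)
  qed
  have "deviation (\<lambda>z. a * h z + c) t y = a * deviation h t y" for t
    using eq[OF prob_space_kernel[of "max 0 t" y] sets_kernel[of "max 0 t" y]] eq[OF prob_space_pi sets_pi] y
    by (simp add: deviation_def algebra_simps)
  then show ?thesis by (simp add: deviation_kernel_eq)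
qed

text \<open>The decay is uniform in the starting point, so the absolute time integrals are bounded
  and Fubini's theorem applies.\<close>

lemma integral_deviation_kernel:
  assumes h: "h \<in> borel_measurable E" "\<And>z. z \<in> space E \<Longrightarrow> \<bar>h z :: real\<bar> \<le> B"
    and K: "prob_space K" "sets K = sets E"
  shows "(\<integral>y. deviation_kernel P \<pi> h y \<partial>K) = (\<integral>t. (\<integral>y. deviation h t y \<partial>K) \<partial>lborel)"
proof -
  interpret K: prob_space K by fact
  interpret pair_sigma_finite K lborel ..
  have sp: "space K = space E" by (rule sets_eq_imp_space_eq[OF K(2)])
  have m[measurable]: "(\<lambda>(y, t). deviation h t y) \<in> borel_measurable (K \<Otimes>\<^sub>M lborel)"
    by (rule borel_measurable_deviation_joint'[OF h(1) K(2)])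
  obtain C where C: "\<And>y. y \<in> space E \<Longrightarrow> (\<integral>t. \<bar>deviation h t y\<bar> \<partial>lborel) \<le> B * C"
    using deviation_kernel_bounded h by metis
  have "(\<lambda>(y, t). \<bar>deviation h t y\<bar>) \<in> borel_measurable (K \<Otimes>\<^sub>M lborel)"
    using m by (auto simp: split_beta')
  then have "(\<lambda>y. \<integral>t. \<bar>deviation h t y\<bar> \<partial>lborel) \<in> borel_measurable K"
    by (rule lborel.borel_measurable_lebesgue_integral)
  then have "integrable K (\<lambda>y. \<integral>t. \<bar>deviation h t y\<bar> \<partial>lborel)"
    using C by (intro integrable_bounded_prob[OF K(1), where B = "B * C"]) (auto simp: sp)
  then have "integrable (K \<Otimes>\<^sub>M lborel) (\<lambda>(y, t). deviation h t y)"
    using integrable_deviation[OF h] by (intro Fubini_integrable) (auto simp: sp intro!: AE_I2)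
  from Fubini_integral[OF this] show ?thesis by (simp add: deviation_kernel_eq)
qed

lemma integral_deviation:
  assumes h: "h \<in> borel_measurable E" "\<And>z. z \<in> space E \<Longrightarrow> \<bar>h z :: real\<bar> \<le> B"
    and K: "prob_space K" "sets K = sets E"
  shows "(\<integral>y. deviation h t y \<partial>K)
    = indicator {0..} t * ((\<integral>y. (\<integral>z. h z \<partial>P (max 0 t) y) \<partial>K) - (\<integral>z. h z \<partial>\<pi>))"
proof -
  interpret K: prob_space K by fact
  have sp: "space K = space E" by (rule sets_eq_imp_space_eq[OF K(2)])
  have "integrable K (\<lambda>y. \<integral>z. h z \<partial>P (max 0 t) y)"
    using borel_measurable_space[OF h(1), of "max 0 t"] abs_kernel_le[OF h, of "max 0 t"]
      measurable_cong_sets[OF K(2) refl]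
    by (intro integrable_bounded_prob[OF K(1), where B = B]) (auto simp: sp)
  then show ?thesis by (simp add: deviation_def K.prob_space)
qed

text \<open>By stationarity every time slice already integrates to 0.\<close>

lemma integral_deviation_kernel_pi:
  assumes h: "h \<in> borel_measurable E" "\<And>z. z \<in> space E \<Longrightarrow> \<bar>h z :: real\<bar> \<le> B"
  shows "(\<integral>y. deviation_kernel P \<pi> h y \<partial>\<pi>) = 0"
  using integral_deviation_kernel[OF h prob_space_pi sets_pi] integral_deviation[OF h prob_space_pi sets_pi]
    integral_kernel_pi[OF h] by simp

text \<open>By Chapman-Kolmogorov, averaging over \<open>P r y\<close> moves each time slice from
  \<open>t\<close> to \<open>r + t\<close>; the shifted time integral misses exactly the part over
  \<open>[0, r]\<close>. This is the Poisson equation in integrated form, free of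
  derivatives.\<close>

lemma deviation_kernel_dynkin:
  assumes h: "h \<in> borel_measurable E" "\<And>z. z \<in> space E \<Longrightarrow> \<bar>h z :: real\<bar> \<le> B"
    and r: "0 \<le> r" and y: "y \<in> space E"
  shows "(\<integral>z. deviation_kernel P \<pi> h z \<partial>P r y)
    = deviation_kernel P \<pi> h y - (LBINT s:{0..r}. (\<integral>z. h z \<partial>P s y) - (\<integral>z. h z \<partial>\<pi>))"
proof -
  note K = prob_space_kernel[OF r y] sets_kernel[OF r y]
  note i = integrable_deviation[OF h y]
  have "(\<integral>z. deviation_kernel P \<pi> h z \<partial>P r y) = (\<integral>t. (\<integral>z. deviation h t z \<partial>P r y) \<partial>lborel)"
    by (rule integral_deviation_kernel[OF h K])
  \<comment> \<open>At \<open>r + t\<close> the indicator of \<open>{r..}\<close> is that of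
    \<open>t >= 0\<close>; the factor 1 matches the affine substitution rule.\<close>
  also have "\<dots> = (\<integral>t. indicator {r..} (r + 1 * t) * deviation h (r + 1 * t) y \<partial>lborel)"
  proof (intro Bochner_Integration.integral_cong refl)
    fix t
    show "(\<integral>z. deviation h t z \<partial>P r y) = indicator {r..} (r + 1 * t) * deviation h (r + 1 * t) y"
      using integral_deviation[OF h K, of t] chapman_kolmogorov[OF h r, of t y] y r
      by (auto simp: deviation_def indicator_def max_def)
  qed
  also have "\<dots> = (\<integral>t. indicator {r..} t * deviation h t y \<partial>lborel)"
    using lborel_integral_real_affine[of 1 "\<lambda>t. indicator {r..} t * deviation h t y" r] by simp
  also have "\<dots> = (\<integral>t. deviation h t y - indicator {0..r} t * deviation h t y \<partial>lborel)"
  proof (rule integral_cong_AE)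
    have "AE t in lborel. t \<noteq> r" by (rule AE_lborel_singleton)
    then show "AE t in lborel. indicator {r..} t * deviation h t y = deviation h t y - indicator {0..r} t * deviation h t y"
      by eventually_elim (auto simp: indicator_def deviation_def)
  qed (use borel_measurable_deviation[OF h(1) y] in auto)
  also have "\<dots> = deviation_kernel P \<pi> h y - (\<integral>t. indicator {0..r} t * deviation h t y \<partial>lborel)"
  proof -
    have "integrable lborel (\<lambda>t. indicator {0..r} t * deviation h t y)"
      using integrable_mult_indicator[OF _ i, of "{0..r}"] by simp
    then show ?thesis using i by (simp add: deviation_kernel_eq)
  qed
  also have "(\<integral>t. indicator {0..r} t * deviation h t y \<partial>lborel)
      = (LBINT s:{0..r}. (\<integral>z. h z \<partial>P s y) - (\<integral>z. h z \<partial>\<pi>))"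
    unfolding set_lebesgue_integral_def
    by (intro Bochner_Integration.integral_cong) (auto simp: indicator_def deviation_def)
  finally show ?thesis .
qed

text \<open>\<open>operator_norm\<close> is a real supremum of real suprema, so both levels need an
  upper bound; \<open>deviation_kernel_bounded\<close> supplies a common one.\<close>

lemma abs_deviation_kernel_le_operator_norm:
  assumes h: "h \<in> borel_measurable E" "\<And>z. z \<in> space E \<Longrightarrow> \<bar>h z :: real\<bar> \<le> 1" and y: "y \<in> space E"
  shows "\<bar>deviation_kernel P \<pi> h y\<bar> \<le> operator_norm E (deviation_kernel P \<pi>)"
proof -
  let ?F = "{f \<in> bounded_functions E. sup_norm E f \<le> 1}"
  obtain K where K: "\<And>h B y. h \<in> borel_measurable E \<Longrightarrow> (\<And>z. z \<in> space E \<Longrightarrow> \<bar>h z :: real\<bar> \<le> B) \<Longrightarrow>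
       y \<in> space E \<Longrightarrow> \<bar>deviation_kernel P \<pi> h y\<bar> \<le> B * K"
    using deviation_kernel_bounded by metis
  have le1: "\<bar>f z\<bar> \<le> 1" if f: "f \<in> ?F" and z: "z \<in> space E" for f z
  proof -
    have "bdd_above ((\<lambda>z. \<bar>f z\<bar>) ` space E)"
      using f unfolding bounded_functions_def bounded_iff bdd_above_def by auto
    then have "\<bar>f z\<bar> \<le> sup_norm E f" unfolding sup_norm_def using z by (intro cSUP_upper)
    then show ?thesis using f by simp
  qed
  have Kf: "\<bar>deviation_kernel P \<pi> f z\<bar> \<le> K" if "f \<in> ?F" "z \<in> space E" for f z
    using K[of f 1 z] le1[OF that(1)] that by (auto simp: bounded_functions_def)
  have "h \<in> ?F"
    using h y by (auto simp: bounded_functions_def bounded_iff sup_norm_def intro!: cSUP_least)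
  have "\<bar>deviation_kernel P \<pi> h y\<bar> \<le> sup_norm E (deviation_kernel P \<pi> h)"
    unfolding sup_norm_def
    by (rule cSUP_upper[OF y]) (use Kf[OF \<open>h \<in> ?F\<close>] in \<open>auto intro!: bdd_aboveI2\<close>)
  also have "\<dots> \<le> operator_norm E (deviation_kernel P \<pi>)"
    unfolding operator_norm_def
  proof (rule cSUP_upper[OF \<open>h \<in> ?F\<close>])
    show "bdd_above ((\<lambda>f. sup_norm E (deviation_kernel P \<pi> f)) ` ?F)"
      using y Kf by (intro bdd_aboveI2[where M = K]) (auto simp: sup_norm_def intro!: cSUP_least)
  qed
  finally show ?thesis .
qed

end

lemma set_integral_affine:
  fixes a c T :: real
  assumes "0 \<le> T"
  shows "set_integrable lborel {0..T} (\<lambda>s. a - c * s)"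
    and "(LBINT s:{0..T}. a - c * s) = a * T - c * T\<^sup>2 / 2"
proof -
  have "has_bochner_integral lborel (\<lambda>s. (a - c * s) * indicator {0..T} s)
      ((a * T - c * T\<^sup>2 / 2) - (a * 0 - c * 0\<^sup>2 / 2))"
    by (rule has_bochner_integral_FTC_Icc_real) (use assms in \<open>auto intro!: derivative_eq_intros continuous_intros\<close>)
  then show "set_integrable lborel {0..T} (\<lambda>s. a - c * s)"
    and "(LBINT s:{0..T}. a - c * s) = a * T - c * T\<^sup>2 / 2"
    by (auto simp: has_bochner_integral_iff set_integrable_def set_lebesgue_integral_def mult.commute)
qed

context ergodic_semigroup
begin

lemma set_integrable_kernel:
  assumes h: "h \<in> borel_measurable E" "\<And>z. z \<in> space E \<Longrightarrow> \<bar>h z :: real\<bar> \<le> B" and y: "y \<in> space E"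
  shows "set_integrable lborel {0..T} (\<lambda>s. (\<integral>z. h z \<partial>P s y) - (\<integral>z. h z \<partial>\<pi>))"
proof -
  have "integrable lborel (\<lambda>t. indicator {0..T} t * deviation h t y)"
    using integrable_mult_indicator[OF _ integrable_deviation[OF h y], of "{0..T}"] by simp
  moreover have "(\<lambda>t. indicator {0..T} t * deviation h t y)
      = (\<lambda>s. indicator {0..T} s * ((\<integral>z. h z \<partial>P s y) - (\<integral>z. h z \<partial>\<pi>)))"
    by (auto simp: fun_eq_iff indicator_def deviation_def)
  ultimately show ?thesis by (simp add: set_integrable_def)
qed

text \<open>Since constants are annihilated, \<open>f\<close> may be traded for
  \<open>2 * f - 1\<close>, which still lies in the unit ball while its image is twice as
  large.\<close>

lemma abs_deviation_kernel_unit_le: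
  assumes q: "\<And>h y. h \<in> borel_measurable E \<Longrightarrow> (\<And>z. z \<in> space E \<Longrightarrow> \<bar>h z :: real\<bar> \<le> 1) \<Longrightarrow>
      y \<in> space E \<Longrightarrow> \<bar>deviation_kernel P \<pi> h y\<bar> \<le> q"
    and f: "f \<in> borel_measurable E" "\<And>z. z \<in> space E \<Longrightarrow> 0 \<le> f z \<and> f z \<le> 1" and y: "y \<in> space E"
  shows "\<bar>deviation_kernel P \<pi> f y\<bar> \<le> q / 2"
proof -
  have "deviation_kernel P \<pi> (\<lambda>z. 2 * f z + (-1)) y = 2 * deviation_kernel P \<pi> f y"
    using f by (intro deviation_kernel_affine[where B = 1] y) auto
  moreover have "\<bar>deviation_kernel P \<pi> (\<lambda>z. 2 * f z + (-1)) y\<bar> \<le> q"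
    using f y by (intro q) (auto simp: abs_le_iff)
  ultimately show ?thesis by simp
qed

text \<open>If the mean of \<open>f\<close> is small, then started near a point where \<open>w = deviation_kernel P \<pi> f\<close> is
  almost minimal, the process \<open>w\<close> can only increase slowly. A test function that decreases
  linearly in \<open>w\<close> therefore has a large deviation there, unless the minimum is moderate.\<close>

lemma deviation_kernel_lower_bound:
  assumes q0: "0 < q"
    and q: "\<And>h y. h \<in> borel_measurable E \<Longrightarrow> (\<And>z. z \<in> space E \<Longrightarrow> \<bar>h z :: real\<bar> \<le> 1) \<Longrightarrow>
      y \<in> space E \<Longrightarrow> \<bar>deviation_kernel P \<pi> h y\<bar> \<le> q"
    and f: "f \<in> borel_measurable E" "\<And>z. z \<in> space E \<Longrightarrow> 0 \<le> f z \<and> f z \<le> 1"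
    and p: "(\<integral>z. f z \<partial>\<pi>) \<le> 7/100" and y: "y \<in> space E"
  shows "- (35/100) * q \<le> deviation_kernel P \<pi> f y"
proof (rule ccontr)
  assume neg: "\<not> ?thesis"
  define w where "w = deviation_kernel P \<pi> f"
  define p where "p = (\<integral>z. f z \<partial>\<pi>)"
  have f1: "\<bar>f z\<bar> \<le> 1" if "z \<in> space E" for z using f(2)[OF that] by auto
  have wq: "\<bar>w z\<bar> \<le> q / 2" if "z \<in> space E" for z
    unfolding w_def using q f that by (rule abs_deviation_kernel_unit_le)
  have wm: "w \<in> borel_measurable E" unfolding w_def by (rule borel_measurable_deviation_kernel[OF f(1)])
  define b where "b = - (INF z\<in>space E. w z)"
  have bdd: "bdd_below (w ` space E)" using wq by (intro bdd_belowI2[where m = "- (q/2)"]) (smt (verit))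
  have bw: "- b \<le> w z" if "z \<in> space E" for z
    using cINF_lower[OF bdd that] by (simp add: b_def)
  have b0: "b > 35/100 * q" using bw[OF y] neg by (simp add: w_def)
  have b1: "b > 0" using q0 b0 by linarith
  define d where "d = q / 2 + b"
  have d: "d > 0" using q0 b1 by (simp add: d_def)
  obtain y' where y': "y' \<in> space E" "w y' < - b + b / 200"
    using cINF_less_iff[OF _ bdd, of "- b + b / 200"] y b1 by (force simp: b_def)
  \<comment> \<open>The decreasing affine image of \<open>w\<close> that takes \<open>- b\<close> to
    1 and \<open>q / 2\<close> to -1, thus the steepest one that stays in the unit ball.\<close>
  define h where "h = (\<lambda>z. (- 2 / d) * w z + (1 - 2 * b / d))"
  have hm: "h \<in> borel_measurable E" unfolding h_def using wm by simp
  have h1: "\<bar>h z\<bar> \<le> 1" if z: "z \<in> space E" for z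
  proof -
    have "h z = 1 - 2 * ((w z + b) / d)" by (simp add: h_def algebra_simps add_divide_distrib)
    moreover have "0 \<le> (w z + b) / d" using bw[OF z] d by simp
    moreover have "(w z + b) / d \<le> 1" using wq[OF z] d by (simp add: d_def abs_le_iff)
    ultimately show ?thesis by linarith
  qed
  have hint: "(\<integral>z. h z \<partial>K) = (- 2 / d) * (\<integral>z. w z \<partial>K) + (1 - 2 * b / d)"
    if "prob_space K" "sets K = sets E" for K
  proof -
    interpret K: prob_space K by fact
    have "integrable K w"
      using wm wq that measurable_cong_sets[OF that(2) refl] sets_eq_imp_space_eq[OF that(2)]
      by (intro integrable_bounded_prob[OF that(1), where B = "q / 2"]) auto
    then show ?thesis unfolding h_def by (simp add: K.prob_space)
  qed
  have hpi: "(\<integral>z. h z \<partial>\<pi>) = 1 - 2 * b / d"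
    using hint[OF prob_space_pi sets_pi] integral_deviation_kernel_pi[OF f(1) f1] by (simp add: w_def)
  have Pw: "(\<integral>z. w z \<partial>P s y') \<le> w y' + 7/100 * s" if s: "0 \<le> s" for s
  proof -
    have "(\<integral>z. w z \<partial>P s y') = w y' - (LBINT r:{0..s}. (\<integral>z. f z \<partial>P r y') - p)"
      unfolding w_def p_def by (rule deviation_kernel_dynkin[OF f(1) f1 s y'(1)])
    moreover have "(LBINT r:{0..s}. - (7/100) - 0 * r) \<le> (LBINT r:{0..s}. (\<integral>z. f z \<partial>P r y') - p)"
    proof (rule set_integral_mono)
      show "set_integrable lborel {0..s} (\<lambda>r. (\<integral>z. f z \<partial>P r y') - p)"
        unfolding p_def by (rule set_integrable_kernel[OF f(1) f1 y'(1)])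
      show "set_integrable lborel {0..s} (\<lambda>r. - (7/100) - 0 * r)" by (rule set_integral_affine[OF s])
      fix r assume "r \<in> {0..s}"
      then have "0 \<le> (\<integral>z. f z \<partial>P r y')"
        using f(2) space_kernel[of r y'] y' by (intro integral_nonneg_AE AE_I2) auto
      then show "- (7/100) - 0 * r \<le> (\<integral>z. f z \<partial>P r y') - p" using p by (simp add: p_def)
    qed
    ultimately show ?thesis using set_integral_affine(2)[OF s, of "- (7/100)" 0] by simp
  qed
  \<comment> \<open>The mean of \<open>w\<close> grows at rate at most 7/100, so it needs about this
    long to climb from \<open>- b\<close> to its stationary value 0. Until about then the mean of
    \<open>h\<close> exceeds its stationary mean.\<close>
  define T where "T = b / (7/100)"
  have T: "T > 0" using b1 by (simp add: T_def)
  have "(LBINT s:{0..T}. (2 * (b - b / 200) / d) - (14/100 / d) * s) \<le> (LBINT s:{0..T}. (\<integral>z. h z \<partial>P s y') - (\<integral>z. h z \<partial>\<pi>))"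
  proof (rule set_integral_mono)
    show "set_integrable lborel {0..T} (\<lambda>s. (2 * (b - b / 200) / d) - (14/100 / d) * s)"
      using T by (intro set_integral_affine) simp
    show "set_integrable lborel {0..T} (\<lambda>s. (\<integral>z. h z \<partial>P s y') - (\<integral>z. h z \<partial>\<pi>))"
      by (rule set_integrable_kernel[OF hm h1 y'(1)])
    fix s assume s: "s \<in> {0..T}"
    then have s0: "0 \<le> s" by simp
    have "(2 / d) * (\<integral>z. w z \<partial>P s y') \<le> (2 / d) * (- b + b / 200 + 7/100 * s)"
      using Pw[OF s0] y'(2) d by (intro mult_left_mono) auto
    moreover have "(\<integral>z. h z \<partial>P s y') - (\<integral>z. h z \<partial>\<pi>) = - (2 / d) * (\<integral>z. w z \<partial>P s y')"
      using hint[OF prob_space_kernel[OF s0 y'(1)] sets_kernel[OF s0 y'(1)]] hpi by simp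
    moreover have "(2 * (b - b / 200) / d) - (14/100 / d) * s = - ((2 / d) * (- b + b / 200 + 7/100 * s))"
      using d by (simp add: field_simps)
    ultimately show "(2 * (b - b / 200) / d) - (14/100 / d) * s \<le> (\<integral>z. h z \<partial>P s y') - (\<integral>z. h z \<partial>\<pi>)"
      by linarith
  qed
  also have "\<dots> = deviation_kernel P \<pi> h y' - (\<integral>z. deviation_kernel P \<pi> h z \<partial>P T y')"
    using deviation_kernel_dynkin[OF hm h1, of T y'] T y' by simp
  also have "\<dots> \<le> 2 * q"
  proof -
    have "\<bar>\<integral>z. deviation_kernel P \<pi> h z \<partial>P T y'\<bar> \<le> q"
      using abs_kernel_le[OF borel_measurable_deviation_kernel[OF hm], of q T y'] q[OF hm h1] T y' by simp
    moreover have "\<bar>deviation_kernel P \<pi> h y'\<bar> \<le> q" by (rule q[OF hm h1 y'(1)])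
    ultimately show ?thesis by linarith
  qed
  finally have "(2 * (b - b / 200) / d) * T - (14/100 / d) * T\<^sup>2 / 2 \<le> 2 * q"
    unfolding set_integral_affine(2)[OF less_imp_le[OF T]] .
  moreover have "(2 * (b - b / 200) / d) * T - (14/100 / d) * T\<^sup>2 / 2 = (99/7 * b\<^sup>2) / d"
    using d by (simp add: T_def field_simps power2_eq_square)
  ultimately have "(99/7 * b\<^sup>2) / d \<le> 2 * q" by metis
  then have "99/7 * b\<^sup>2 \<le> 2 * q * d" unfolding pos_divide_le_eq[OF d] .
  then have "99/7 * b\<^sup>2 \<le> q\<^sup>2 + 2 * q * b" by (simp add: d_def power2_eq_square algebra_simps)
  \<comment> \<open>With \<open>r = b / q\<close> the inequality just obtained reads
    \<open>99/7 * r^2 <= 1 + 2 * r\<close>. Its positive root is about 0.346, which is rounded up to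
    35/100.\<close>
  moreover have "(35/100 * q) * b \<le> b * b" "(35/100 * q) * q \<le> b * q"
    using b0 b1 q0 by (auto intro!: mult_right_mono)
  moreover have "b * b > 0" using b1 by simp
  ultimately show False by (simp add: power2_eq_square mult.commute[of b q])
qed

end

section \<open>Exponential functionals of a Markov process\<close>

lemma
  fixes \<Phi> :: "real \<Rightarrow> 'w \<Rightarrow> real"
  assumes N: "prob_space N"
    and m: "(\<lambda>(r, \<omega>). \<Phi> r \<omega>) \<in> borel_measurable (borel \<Otimes>\<^sub>M N)"
    and bound: "\<And>r \<omega>. r \<in> {a..b} \<Longrightarrow> \<omega> \<in> space N \<Longrightarrow> \<bar>\<Phi> r \<omega>\<bar> \<le> C"
  shows integral_set_integral_swap: "(\<integral>\<omega>. (LBINT r:{a..b}. \<Phi> r \<omega>) \<partial>N) = (LBINT r:{a..b}. (\<integral>\<omega>. \<Phi> r \<omega> \<partial>N))"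
    and set_integrable_path: "\<omega> \<in> space N \<Longrightarrow> set_integrable lborel {a..b} (\<lambda>r. \<Phi> r \<omega>)"
    and set_integrable_expectation: "set_integrable lborel {a..b} (\<lambda>r. \<integral>\<omega>. \<Phi> r \<omega> \<partial>N)"
    and borel_measurable_set_integral: "(\<lambda>\<omega>. LBINT r:{a..b}. \<Phi> r \<omega>) \<in> borel_measurable N"
proof -
  interpret N: prob_space N by fact
  interpret pair_sigma_finite lborel N ..
  have [measurable]: "(\<lambda>x. \<Phi> (fst x) (snd x)) \<in> borel_measurable (lborel \<Otimes>\<^sub>M N)"
    using m by (simp add: split_beta')
  have m1: "(\<lambda>(r, \<omega>). indicator {a..b} r *\<^sub>R \<Phi> r \<omega>) \<in> borel_measurable (lborel \<Otimes>\<^sub>M N)"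
    unfolding split_beta' by measurable
  have bd: "\<bar>indicator {a..b} r *\<^sub>R \<Phi> r \<omega>\<bar> \<le> \<bar>C\<bar> * indicator {a..b} r" if "\<omega> \<in> space N" for r \<omega>
    using bound[of r \<omega>] that by (auto simp: indicator_def)
  have iC: "integrable lborel (\<lambda>r. \<bar>C\<bar> * indicator {a..b} r)"
    by (cases "a \<le> b") (auto intro!: integrable_mult_right simp: emeasure_lborel_Icc_eq)
  have path: "integrable lborel (\<lambda>r. indicator {a..b} r *\<^sub>R \<Phi> r \<omega>)" if "\<omega> \<in> space N" for \<omega>
    by (rule Bochner_Integration.integrable_bound[OF iC])
      (use that bd[OF that] measurable_compose[OF measurable_Pair2'[OF that] m1] in \<open>auto intro!: AE_I2\<close>)
  then show "\<omega> \<in> space N \<Longrightarrow> set_integrable lborel {a..b} (\<lambda>r. \<Phi> r \<omega>)" by (simp add: set_integrable_def)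
  have iN: "integrable N (\<lambda>\<omega>. indicator {a..b} r *\<^sub>R \<Phi> r \<omega>)" for r
    using bd measurable_compose[OF measurable_Pair1'[of r lborel] m1]
    by (intro integrable_bounded_prob[OF N, where B = "\<bar>C\<bar> * indicator {a..b} r"]) auto
  have int: "integrable (lborel \<Otimes>\<^sub>M N) (\<lambda>(r, \<omega>). indicator {a..b} r *\<^sub>R \<Phi> r \<omega>)"
  proof (rule Fubini_integrable[OF m1])
    have m2: "(\<lambda>r. \<integral>\<omega>. norm (indicator {a..b} r *\<^sub>R \<Phi> r \<omega>) \<partial>N) \<in> borel_measurable lborel"
      using m1 by (intro N.borel_measurable_lebesgue_integral) (auto simp: split_beta')
    have "\<bar>\<integral>\<omega>. norm (indicator {a..b} r *\<^sub>R \<Phi> r \<omega>) \<partial>N\<bar> \<le> \<bar>C\<bar> * indicator {a..b} r" for r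
      using iN[of r] bd by (intro integral_bounded_prob[OF N]) auto
    then show "integrable lborel (\<lambda>x. \<integral>y. norm (case (x, y) of (r, \<omega>) \<Rightarrow> indicator {a..b} r *\<^sub>R \<Phi> r \<omega>) \<partial>N)"
      using m2 by (intro Bochner_Integration.integrable_bound[OF iC]) (auto intro!: AE_I2)
    show "AE x in lborel. integrable N (\<lambda>y. case (x, y) of (r, \<omega>) \<Rightarrow> indicator {a..b} r *\<^sub>R \<Phi> r \<omega>)"
      using iN by (intro AE_I2) simp
  qed
  have eq: "(\<integral>\<omega>. indicator {a..b} r *\<^sub>R \<Phi> r \<omega> \<partial>N) = indicator {a..b} r *\<^sub>R (\<integral>\<omega>. \<Phi> r \<omega> \<partial>N)" for r
    by (cases "r \<in> {a..b}") auto
  show "(\<integral>\<omega>. (LBINT r:{a..b}. \<Phi> r \<omega>) \<partial>N) = (LBINT r:{a..b}. (\<integral>\<omega>. \<Phi> r \<omega> \<partial>N))"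
    unfolding set_lebesgue_integral_def using Fubini_integral[OF int] eq by simp
  show "set_integrable lborel {a..b} (\<lambda>r. \<integral>\<omega>. \<Phi> r \<omega> \<partial>N)"
    using integrable_fst[OF int] eq by (simp add: set_integrable_def)
  show "(\<lambda>\<omega>. LBINT r:{a..b}. \<Phi> r \<omega>) \<in> borel_measurable N"
    using integrable_snd[OF int] unfolding set_lebesgue_integral_def by auto
qed

lemma abs_set_integral_le:
  fixes g :: "real \<Rightarrow> real"
  assumes "set_integrable lborel {a..b} g" "\<And>r. r \<in> {a..b} \<Longrightarrow> \<bar>g r\<bar> \<le> C" "a \<le> b"
  shows "\<bar>LBINT r:{a..b}. g r\<bar> \<le> C * (b - a)"
proof -
  have c: "set_integrable lborel {a..b} (\<lambda>r. c :: real)" for c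
    unfolding set_integrable_def using assms(3) by (intro integrable_scaleR_left integrable_real_indicator) auto
  have v: "(LBINT r:{a..b}. c) = c * (b - a)" for c :: real
    using assms(3) by (simp add: set_integral_const mult.commute)
  have "(LBINT r:{a..b}. g r) \<le> (LBINT r:{a..b}. C)" "(LBINT r:{a..b}. - C) \<le> (LBINT r:{a..b}. g r)"
    using assms(2) by (auto intro!: set_integral_mono assms(1) c simp: abs_le_iff minus_le_iff)
  then show ?thesis unfolding v by simp
qed

lemma set_integral_Icc_split:
  fixes g :: "real \<Rightarrow> real"
  assumes "set_integrable lborel {a..c} g" "a \<le> b" "b \<le> c"
  shows "(LBINT r:{a..c}. g r) = (LBINT r:{a..b}. g r) + (LBINT r:{b..c}. g r)"
proof -
  have "AE r in lborel. r \<noteq> b" by (rule AE_lborel_singleton)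
  then have "(LBINT r:{a..b} \<union> {b..c}. g r) = (LBINT r:{a..b}. g r) + (LBINT r:{b..c}. g r)"
    using assms by (intro set_integral_Un_AE set_integrable_subset[OF assms(1)]) auto
  moreover have "{a..b} \<union> {b..c} = {a..c}" using assms by auto
  ultimately show ?thesis by simp
qed

lemma set_integral_shift:
  fixes g :: "real \<Rightarrow> real"
  shows "(LBINT r:{0..h}. g (s + r)) = (LBINT r:{s..s + h}. g r)"
proof -
  have "(LBINT r:{s..s + h}. g r) = (\<integral>r. indicator {s..s + h} (s + 1 * r) *\<^sub>R g (s + 1 * r) \<partial>lborel)"
    unfolding set_lebesgue_integral_def
    using lborel_integral_real_affine[of 1 "\<lambda>r. indicator {s..s + h} r *\<^sub>R g r" s] by simp
  also have "\<dots> = (LBINT r:{0..h}. g (s + r))"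
    unfolding set_lebesgue_integral_def
    by (intro Bochner_Integration.integral_cong) (auto simp: indicator_def)
  finally show ?thesis by simp
qed

text \<open>Telescoping over \<open>n\<close> equal steps leaves an error of order \<open>1 / n\<close>.\<close>

lemma eq_if_quadratic_increments:
  fixes z :: "real \<Rightarrow> real"
  assumes "0 \<le> t" and z: "\<And>s h. 0 \<le> s \<Longrightarrow> 0 \<le> h \<Longrightarrow> s + h \<le> t \<Longrightarrow> \<bar>z (s + h) - z s\<bar> \<le> K * h\<^sup>2"
  shows "z t = z 0"
proof -
  have "\<bar>z t - z 0\<bar> \<le> K * t\<^sup>2 * (1 / real (Suc n))" for n
  proof -
    define h where "h = t / real (Suc n)"
    have h: "0 \<le> h" "real (Suc n) * h = t" using assms(1) by (auto simp: h_def)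
    have "\<bar>z (real i * h) - z 0\<bar> \<le> real i * (K * h\<^sup>2)" if "i \<le> Suc n" for i
      using that
    proof (induction i)
      case (Suc i)
      have "real i * h + h \<le> t"
        using Suc.prems h by (simp add: algebra_simps flip: h(2)) (simp add: mult_left_mono)
      then have "\<bar>z (real i * h + h) - z (real i * h)\<bar> \<le> K * h\<^sup>2" using h by (intro z) auto
      then show ?case using Suc by (simp add: algebra_simps)
    qed simp
    from this[of "Suc n"] have "\<bar>z t - z 0\<bar> \<le> real (Suc n) * (K * h\<^sup>2)" by (simp only: h(2) order_refl)
    also have "\<dots> = K * t\<^sup>2 * (1 / real (Suc n))" by (simp add: h_def power2_eq_square)
    finally show ?thesis .
  qed
  moreover have "(\<lambda>n. K * t\<^sup>2 * (1 / real (Suc n))) \<longlonglongrightarrow> K * t\<^sup>2 * 0"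
    by (intro tendsto_intros LIMSEQ_Suc[OF lim_1_over_n])
  ultimately have "\<bar>z t - z 0\<bar> \<le> K * t\<^sup>2 * 0"
    by (intro LIMSEQ_le_const) auto
  then show ?thesis by simp
qed

section \<open>The Markov property for bounded functions\<close>

text \<open>Adaptedness alone does not make the time integral up to \<open>s\<close> measurable with
  respect to \<open>F s\<close>; progressive measurability does. The clamp
  \<open>min s (max 0 r)\<close> is the identity on \<open>[0, s]\<close> and lets the condition be
  stated on the whole Borel line.\<close>

locale progressive_markov_process = measurable_semigroup E P + prob_space N
  for E :: "'s measure" and P and N :: "'w measure" +
  fixes F :: "real \<Rightarrow> 'w measure" and Y :: "real \<Rightarrow> 'w \<Rightarrow> 's"
  assumes markov: "markov_process N F Y E P"
    and filtration: "\<And>s. 0 \<le> s \<Longrightarrow> subalgebra N (F s)"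
    and filtration_mono: "\<And>r s. 0 \<le> r \<Longrightarrow> r \<le> s \<Longrightarrow> sets (F r) \<subseteq> sets (F s)"
    and progressive: "\<And>s. 0 \<le> s \<Longrightarrow> (\<lambda>(r, \<omega>). Y (min s (max 0 r)) \<omega>) \<in> borel \<Otimes>\<^sub>M F s \<rightarrow>\<^sub>M E"
begin

lemma space_filtration: "0 \<le> s \<Longrightarrow> space (F s) = space N"
  using filtration by (simp add: subalgebra_def)

lemma measurable_filtration: "0 \<le> s \<Longrightarrow> Z \<in> F s \<rightarrow>\<^sub>M K \<Longrightarrow> Z \<in> N \<rightarrow>\<^sub>M K"
  using measurable_from_subalg[OF filtration] by blast

lemma measurable_filtration_mono:
  assumes "0 \<le> r" "r \<le> s" "Z \<in> F r \<rightarrow>\<^sub>M K" shows "Z \<in> F s \<rightarrow>\<^sub>M K"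
proof -
  have "subalgebra (F s) (F r)"
    using filtration_mono[OF assms(1,2)] space_filtration[of r] space_filtration[of s] assms
    by (simp add: subalgebra_def)
  then show ?thesis using assms(3) measurable_from_subalg by blast
qed

lemma adapted: "0 \<le> s \<Longrightarrow> Y s \<in> F s \<rightarrow>\<^sub>M E"
  using markov by (simp add: markov_process_def)

lemma process_space: "0 \<le> s \<Longrightarrow> \<omega> \<in> space N \<Longrightarrow> Y s \<omega> \<in> space E"
  using measurable_space[OF adapted] space_filtration by simp

text \<open>\<open>markov_process\<close> speaks of events; simple functions and monotone limits
  extend it to \<open>h\<close>, in \<open>ennreal\<close> so that no integrability has to be
  tracked. The weight \<open>Z\<close> is kept for later use with factors known at time
  \<open>s\<close>, such as the exponential of the past path integral.\<close>

lemma nn_integral_markov: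
  assumes s: "0 \<le> s" and r: "0 \<le> r"
    and Z: "Z \<in> borel_measurable (F s)" "\<And>\<omega>. \<omega> \<in> space N \<Longrightarrow> 0 \<le> Z \<omega> \<and> Z \<omega> \<le> (C :: real)"
    and h: "h \<in> borel_measurable E"
  shows "(\<integral>\<^sup>+\<omega>. ennreal (Z \<omega>) * h (Y (s + r) \<omega>) \<partial>N) = (\<integral>\<^sup>+\<omega>. ennreal (Z \<omega>) * (\<integral>\<^sup>+y. h y \<partial>P r (Y s \<omega>)) \<partial>N)"
  using h
proof (induction h rule: borel_measurable_induct)
  have ZN[measurable]: "Z \<in> borel_measurable N" by (rule measurable_filtration[OF s Z(1)])
  have Yr[measurable]: "Y (s + r) \<in> N \<rightarrow>\<^sub>M E" using s r by (intro measurable_filtration[OF _ adapted]) auto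
  have Ys[measurable]: "Y s \<in> N \<rightarrow>\<^sub>M E" using s by (intro measurable_filtration[OF _ adapted]) auto
  note [measurable] = kernel_subprob[OF r]
  {
    case (cong f g)
    have "(\<integral>\<^sup>+y. f y \<partial>P r (Y s \<omega>)) = (\<integral>\<^sup>+y. g y \<partial>P r (Y s \<omega>))" if "\<omega> \<in> space N" for \<omega>
      using cong(3) space_kernel[OF r process_space[OF s that]] by (intro nn_integral_cong) auto
    moreover have "f (Y (s + r) \<omega>) = g (Y (s + r) \<omega>)" if "\<omega> \<in> space N" for \<omega>
      using cong(3) process_space[of "s + r" \<omega>] s r that by simp
    ultimately show ?case using cong(4) by (simp cong: nn_integral_cong_simp)
  next
    case (set A)
    interpret finite_measure_subalgebra N "F s" by unfold_locales (rule filtration[OF s])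
    define c where "c = real_cond_exp N (F s) (\<lambda>\<omega>. indicator A (Y (s + r) \<omega>))"
    have cAE: "AE \<omega> in N. c \<omega> = measure (P r (Y s \<omega>)) A"
      using markov s r set unfolding c_def markov_process_def by blast
    have b: "\<bar>Z \<omega> * indicator A (Y (s + r) \<omega>)\<bar> \<le> C" if "\<omega> \<in> space N" for \<omega>
      using Z(2)[OF that] by (auto simp: indicator_def)
    have mA[measurable]: "(\<lambda>\<omega>. indicator A (Y (s + r) \<omega>) :: real) \<in> borel_measurable N"
      using set by measurable
    have i1: "integrable N (\<lambda>\<omega>. Z \<omega> * indicator A (Y (s + r) \<omega>))"
      by (intro integrable_bounded_prob[OF prob_space_axioms _ b]) measurable
    note cond = real_cond_exp_intg[OF i1 Z(1) mA, folded c_def]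
    have mP[measurable]: "(\<lambda>\<omega>. measure (P r (Y s \<omega>)) A) \<in> borel_measurable N"
      using set by measurable
    have i2: "integrable N (\<lambda>\<omega>. Z \<omega> * measure (P r (Y s \<omega>)) A)"
      using cond(1) by (rule integrable_cong_AE_imp) (use cAE in \<open>auto elim!: eventually_mono\<close>)
    have "(\<integral>\<omega>. Z \<omega> * indicator A (Y (s + r) \<omega>) \<partial>N) = (\<integral>\<omega>. Z \<omega> * measure (P r (Y s \<omega>)) A \<partial>N)"
      unfolding cond(2)[symmetric] c_def[symmetric]
      by (intro integral_cong_AE) (use cAE cond(1) in \<open>auto elim!: eventually_mono\<close>)
    then have "(\<integral>\<^sup>+\<omega>. ennreal (Z \<omega> * indicator A (Y (s + r) \<omega>)) \<partial>N)
        = (\<integral>\<^sup>+\<omega>. ennreal (Z \<omega> * measure (P r (Y s \<omega>)) A) \<partial>N)"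
      using Z(2) by (subst (1 2) nn_integral_eq_integral) (auto intro!: i1 i2 AE_I2)
    moreover have "(\<integral>\<^sup>+\<omega>. ennreal (Z \<omega> * indicator A (Y (s + r) \<omega>)) \<partial>N)
        = (\<integral>\<^sup>+\<omega>. ennreal (Z \<omega>) * indicator A (Y (s + r) \<omega>) \<partial>N)"
      using Z(2) by (intro nn_integral_cong) (auto simp: indicator_def)
    moreover have "(\<integral>\<^sup>+\<omega>. ennreal (Z \<omega> * measure (P r (Y s \<omega>)) A) \<partial>N)
        = (\<integral>\<^sup>+\<omega>. ennreal (Z \<omega>) * (\<integral>\<^sup>+y. indicator A y \<partial>P r (Y s \<omega>)) \<partial>N)"
    proof (intro nn_integral_cong)
      fix \<omega> assume w: "\<omega> \<in> space N"
      interpret Q: prob_space "P r (Y s \<omega>)" by (rule prob_space_kernel[OF r process_space[OF s w]])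
      show "ennreal (Z \<omega> * measure (P r (Y s \<omega>)) A) = ennreal (Z \<omega>) * (\<integral>\<^sup>+y. indicator A y \<partial>P r (Y s \<omega>))"
        using Z(2)[OF w] set sets_kernel[OF r process_space[OF s w]]
        by (simp add: ennreal_mult' Q.emeasure_eq_measure)
    qed
    ultimately show ?case by simp
  next
    case (mult u c)
    have [measurable]: "u \<in> borel_measurable E" by fact
    have "(\<integral>\<^sup>+y. c * u y \<partial>P r (Y s \<omega>)) = c * (\<integral>\<^sup>+y. u y \<partial>P r (Y s \<omega>))" if "\<omega> \<in> space N" for \<omega>
      using mult(2) sets_kernel[OF r process_space[OF s that]] measurable_cong_sets
      by (intro nn_integral_cmult) blast
    then have "(\<integral>\<^sup>+\<omega>. ennreal (Z \<omega>) * (\<integral>\<^sup>+y. c * u y \<partial>P r (Y s \<omega>)) \<partial>N)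
      = (\<integral>\<^sup>+\<omega>. c * (ennreal (Z \<omega>) * (\<integral>\<^sup>+y. u y \<partial>P r (Y s \<omega>))) \<partial>N)"
      by (intro nn_integral_cong) (simp add: mult_ac)
    also have "\<dots> = c * (\<integral>\<^sup>+\<omega>. ennreal (Z \<omega>) * (\<integral>\<^sup>+y. u y \<partial>P r (Y s \<omega>)) \<partial>N)"
      by (intro nn_integral_cmult) measurable
    also have "\<dots> = (\<integral>\<^sup>+\<omega>. c * (ennreal (Z \<omega>) * u (Y (s + r) \<omega>)) \<partial>N)"
      unfolding mult(4)[symmetric] by (intro nn_integral_cmult[symmetric]) measurable
    finally show ?case by (simp add: mult_ac)
  next
    case (add u v)
    have [measurable]: "u \<in> borel_measurable E" "v \<in> borel_measurable E" by fact+
    have "(\<integral>\<^sup>+y. v y + u y \<partial>P r (Y s \<omega>)) = (\<integral>\<^sup>+y. v y \<partial>P r (Y s \<omega>)) + (\<integral>\<^sup>+y. u y \<partial>P r (Y s \<omega>))"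
      if "\<omega> \<in> space N" for \<omega>
      using \<open>u \<in> borel_measurable E\<close> \<open>v \<in> borel_measurable E\<close>
        sets_kernel[OF r process_space[OF s that]] measurable_cong_sets
      by (intro nn_integral_add) blast+
    then have "(\<integral>\<^sup>+\<omega>. ennreal (Z \<omega>) * (\<integral>\<^sup>+y. v y + u y \<partial>P r (Y s \<omega>)) \<partial>N)
      = (\<integral>\<^sup>+\<omega>. ennreal (Z \<omega>) * (\<integral>\<^sup>+y. v y \<partial>P r (Y s \<omega>)) + ennreal (Z \<omega>) * (\<integral>\<^sup>+y. u y \<partial>P r (Y s \<omega>)) \<partial>N)"
      by (intro nn_integral_cong) (simp add: distrib_left)
    also have "\<dots> = (\<integral>\<^sup>+\<omega>. ennreal (Z \<omega>) * (\<integral>\<^sup>+y. v y \<partial>P r (Y s \<omega>)) \<partial>N)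
        + (\<integral>\<^sup>+\<omega>. ennreal (Z \<omega>) * (\<integral>\<^sup>+y. u y \<partial>P r (Y s \<omega>)) \<partial>N)"
      by (intro nn_integral_add) measurable
    also have "\<dots> = (\<integral>\<^sup>+\<omega>. ennreal (Z \<omega>) * v (Y (s + r) \<omega>) \<partial>N) + (\<integral>\<^sup>+\<omega>. ennreal (Z \<omega>) * u (Y (s + r) \<omega>) \<partial>N)"
      by (simp add: add.IH)
    also have "\<dots> = (\<integral>\<^sup>+\<omega>. ennreal (Z \<omega>) * v (Y (s + r) \<omega>) + ennreal (Z \<omega>) * u (Y (s + r) \<omega>) \<partial>N)"
      by (intro nn_integral_add[symmetric]) measurable
    finally show ?case by (simp add: distrib_left)
  next
    case (seq U)
    have [measurable]: "U i \<in> borel_measurable E" for i using seq by simp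
    have "(\<integral>\<^sup>+y. (SUP i. U i) y \<partial>P r (Y s \<omega>)) = (SUP i. \<integral>\<^sup>+y. U i y \<partial>P r (Y s \<omega>))" if "\<omega> \<in> space N" for \<omega>
    proof -
      have "U i \<in> borel_measurable (P r (Y s \<omega>))" for i
        using \<open>U i \<in> borel_measurable E\<close> sets_kernel[OF r process_space[OF s that]] measurable_cong_sets by blast
      then show ?thesis
        using seq(3) unfolding SUP_apply by (intro nn_integral_monotone_convergence_SUP)
    qed
    then have "(\<integral>\<^sup>+\<omega>. ennreal (Z \<omega>) * (\<integral>\<^sup>+y. (SUP i. U i) y \<partial>P r (Y s \<omega>)) \<partial>N)
      = (\<integral>\<^sup>+\<omega>. (SUP i. ennreal (Z \<omega>) * (\<integral>\<^sup>+y. U i y \<partial>P r (Y s \<omega>))) \<partial>N)"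
      by (intro nn_integral_cong) (simp add: SUP_mult_left_ennreal)
    also have "\<dots> = (SUP i. \<integral>\<^sup>+\<omega>. ennreal (Z \<omega>) * (\<integral>\<^sup>+y. U i y \<partial>P r (Y s \<omega>)) \<partial>N)"
      using seq(3) by (intro nn_integral_monotone_convergence_SUP)
        (auto simp: incseq_def le_fun_def intro!: mult_left_mono nn_integral_mono)
    also have "\<dots> = (SUP i. \<integral>\<^sup>+\<omega>. ennreal (Z \<omega>) * U i (Y (s + r) \<omega>) \<partial>N)"
      by (simp only: seq.IH)
    also have "\<dots> = (\<integral>\<^sup>+\<omega>. (SUP i. ennreal (Z \<omega>) * U i (Y (s + r) \<omega>)) \<partial>N)"
      using seq(3) by (intro nn_integral_monotone_convergence_SUP[symmetric])
        (auto simp: incseq_def le_fun_def intro!: mult_left_mono)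
    also have "\<dots> = (\<integral>\<^sup>+\<omega>. ennreal (Z \<omega>) * (SUP i. U i) (Y (s + r) \<omega>) \<partial>N)"
      by (simp add: SUP_mult_left_ennreal image_comp)
    finally show ?case by simp
  }
qed

text \<open>Signs are removed by adding constants: \<open>h + B\<close> and \<open>Z + C\<close> are
  nonnegative, and the identity is linear in each factor.\<close>

lemma integral_markov:
  assumes s: "0 \<le> s" and r: "0 \<le> r"
    and Z: "Z \<in> borel_measurable (F s)" "\<And>\<omega>. \<omega> \<in> space N \<Longrightarrow> \<bar>Z \<omega> :: real\<bar> \<le> C"
    and h: "h \<in> borel_measurable E" "\<And>y. y \<in> space E \<Longrightarrow> \<bar>h y :: real\<bar> \<le> B"
  shows "(\<integral>\<omega>. Z \<omega> * h (Y (s + r) \<omega>) \<partial>N) = (\<integral>\<omega>. Z \<omega> * (\<integral>y. h y \<partial>P r (Y s \<omega>)) \<partial>N)"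
proof -
  have ZN[measurable]: "Z \<in> borel_measurable N" by (rule measurable_filtration[OF s Z(1)])
  have Yr[measurable]: "Y (s + r) \<in> N \<rightarrow>\<^sub>M E" using s r by (intro measurable_filtration[OF _ adapted]) auto
  have Ys[measurable]: "Y s \<in> N \<rightarrow>\<^sub>M E" using s by (intro measurable_filtration[OF _ adapted]) auto
  have Yspace: "Y (s + r) \<omega> \<in> space E" "Y s \<omega> \<in> space E" if "\<omega> \<in> space N" for \<omega>
    using process_space s r that by auto
  have nonneg: "(\<integral>\<omega>. Z \<omega> * h (Y (s + r) \<omega>) \<partial>N) = (\<integral>\<omega>. Z \<omega> * (\<integral>y. h y \<partial>P r (Y s \<omega>)) \<partial>N)"
    if Z: "Z \<in> borel_measurable (F s)" "\<And>\<omega>. \<omega> \<in> space N \<Longrightarrow> 0 \<le> Z \<omega> \<and> Z \<omega> \<le> C"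
      and h: "h \<in> borel_measurable E" "\<And>y. y \<in> space E \<Longrightarrow> 0 \<le> h y \<and> h y \<le> B"
    for Z h and C B :: real
  proof -
    have [measurable]: "Z \<in> borel_measurable N" "h \<in> borel_measurable E"
      using measurable_filtration[OF s Z(1)] h(1) by auto
    have h': "\<bar>h y\<bar> \<le> B" if "y \<in> space E" for y using h(2)[OF that] by simp
    have [measurable]: "(\<lambda>y. \<integral>z. h z \<partial>P r y) \<in> borel_measurable E"
      by (rule borel_measurable_space[OF h(1) r])
    have Ph: "0 \<le> (\<integral>z. h z \<partial>P r y) \<and> (\<integral>z. h z \<partial>P r y) \<le> B" if "y \<in> space E" for y
      using abs_kernel_le[OF h(1) h' r that] h(2) space_kernel[OF r that]
      by (auto intro!: integral_nonneg_AE AE_I2)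
    have b: "0 \<le> Z \<omega> * v \<and> Z \<omega> * v \<le> C * B" if "\<omega> \<in> space N" "0 \<le> v \<and> v \<le> B" for \<omega> v
      using Z(2)[OF that(1)] that(2) by (auto intro!: mult_mono)
    have i1: "integrable N (\<lambda>\<omega>. Z \<omega> * h (Y (s + r) \<omega>))"
      using b[OF _ h(2)[OF Yspace(1)]] 
      by (intro integrable_bounded_prob[OF prob_space_axioms, where B = "C * B"]) auto
    have i2: "integrable N (\<lambda>\<omega>. Z \<omega> * (\<integral>y. h y \<partial>P r (Y s \<omega>)))"
      using b[OF _ Ph[OF Yspace(2)]]
      by (intro integrable_bounded_prob[OF prob_space_axioms, where B = "C * B"]) auto
    have "ennreal (\<integral>\<omega>. Z \<omega> * h (Y (s + r) \<omega>) \<partial>N) = (\<integral>\<^sup>+\<omega>. ennreal (Z \<omega> * h (Y (s + r) \<omega>)) \<partial>N)"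
      using b[OF _ h(2)[OF Yspace(1)]] by (intro nn_integral_eq_integral[symmetric] i1) auto
    also have "\<dots> = (\<integral>\<^sup>+\<omega>. ennreal (Z \<omega>) * ennreal (h (Y (s + r) \<omega>)) \<partial>N)"
      using Z(2) by (intro nn_integral_cong) (simp add: ennreal_mult')
    also have "\<dots> = (\<integral>\<^sup>+\<omega>. ennreal (Z \<omega>) * (\<integral>\<^sup>+y. ennreal (h y) \<partial>P r (Y s \<omega>)) \<partial>N)"
      by (rule nn_integral_markov[OF s r Z]) measurable
    also have "\<dots> = (\<integral>\<^sup>+\<omega>. ennreal (Z \<omega> * (\<integral>y. h y \<partial>P r (Y s \<omega>))) \<partial>N)"
    proof (intro nn_integral_cong)
      fix \<omega> assume w: "\<omega> \<in> space N"
      have "(\<integral>\<^sup>+y. ennreal (h y) \<partial>P r (Y s \<omega>)) = ennreal (\<integral>y. h y \<partial>P r (Y s \<omega>))"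
        using h(2) space_kernel[OF r Yspace(2)[OF w]]
        by (intro nn_integral_eq_integral integrable_kernel[OF h(1) h' r Yspace(2)[OF w]]) auto
      then show "ennreal (Z \<omega>) * (\<integral>\<^sup>+y. ennreal (h y) \<partial>P r (Y s \<omega>)) = ennreal (Z \<omega> * (\<integral>y. h y \<partial>P r (Y s \<omega>)))"
        using Z(2)[OF w] by (simp add: ennreal_mult')
    qed
    also have "\<dots> = ennreal (\<integral>\<omega>. Z \<omega> * (\<integral>y. h y \<partial>P r (Y s \<omega>)) \<partial>N)"
      using b[OF _ Ph[OF Yspace(2)]] by (intro nn_integral_eq_integral i2) auto
    finally show ?thesis
      using b[OF _ h(2)[OF Yspace(1)]] b[OF _ Ph[OF Yspace(2)]]
      by (subst (asm) ennreal_inj) (auto intro!: integral_nonneg_AE AE_I2)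
  qed
  have [measurable]: "h \<in> borel_measurable E" by fact
  have Pm[measurable]: "(\<lambda>y. \<integral>z. h z \<partial>P r y) \<in> borel_measurable E" by (rule borel_measurable_space[OF h(1) r])
  have i: "integrable N (\<lambda>\<omega>. Z' \<omega> * v (Y a \<omega>))"
    if [measurable]: "Z' \<in> borel_measurable N" "v \<in> borel_measurable E" and a: "a = s \<or> a = s + r"
      and Z': "\<And>\<omega>. \<omega> \<in> space N \<Longrightarrow> \<bar>Z' \<omega>\<bar> \<le> C'" and v: "\<And>y. y \<in> space E \<Longrightarrow> \<bar>v y\<bar> \<le> B"
    for Z' a C' and v :: "'s \<Rightarrow> real"
  proof (rule integrable_bounded_prob[OF prob_space_axioms, where B = "C' * B"])
    show "(\<lambda>\<omega>. Z' \<omega> * v (Y a \<omega>)) \<in> borel_measurable N" using a by auto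
    fix \<omega> assume "\<omega> \<in> space N"
    then have "\<bar>Z' \<omega>\<bar> \<le> C'" "\<bar>v (Y a \<omega>)\<bar> \<le> B" using Z' v a Yspace by auto
    then show "\<bar>Z' \<omega> * v (Y a \<omega>)\<bar> \<le> C' * B" unfolding abs_mult by (intro mult_mono) auto
  qed
  have hB: "\<And>y. y \<in> space E \<Longrightarrow> 0 \<le> h y + B \<and> h y + B \<le> 2 * B" using h(2) by (fastforce simp: abs_le_iff)
  have shift: "(\<integral>\<omega>. W \<omega> * h (Y (s + r) \<omega>) \<partial>N) = (\<integral>\<omega>. W \<omega> * (\<integral>y. h y \<partial>P r (Y s \<omega>)) \<partial>N)"
    if W: "W \<in> borel_measurable (F s)" "\<And>\<omega>. \<omega> \<in> space N \<Longrightarrow> 0 \<le> W \<omega> \<and> W \<omega> \<le> D" for W D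
  proof -
    have WN: "W \<in> borel_measurable N" by (rule measurable_filtration[OF s W(1)])
    have WD: "\<bar>W \<omega>\<bar> \<le> D" if "\<omega> \<in> space N" for \<omega> using W(2)[OF that] by simp
    have iW: "integrable N (\<lambda>\<omega>. W \<omega> * B)"
      using integrable_bounded_prob[OF prob_space_axioms WN WD] by simp
    have "(\<integral>\<omega>. W \<omega> * (h (Y (s + r) \<omega>) + B) \<partial>N) = (\<integral>\<omega>. W \<omega> * (\<integral>y. h y + B \<partial>P r (Y s \<omega>)) \<partial>N)"
      by (rule nonneg[OF W _ hB]) auto
    moreover have "(\<integral>y. h y + B \<partial>P r (Y s \<omega>)) = (\<integral>y. h y \<partial>P r (Y s \<omega>)) + B" if w: "\<omega> \<in> space N" for \<omega>
    proof -
      interpret Q: prob_space "P r (Y s \<omega>)" by (rule prob_space_kernel[OF r Yspace(2)[OF w]])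
      show ?thesis using integrable_kernel[OF h r Yspace(2)[OF w]] by (simp add: Q.prob_space)
    qed
    ultimately have "(\<integral>\<omega>. W \<omega> * h (Y (s + r) \<omega>) + W \<omega> * B \<partial>N)
        = (\<integral>\<omega>. W \<omega> * (\<integral>y. h y \<partial>P r (Y s \<omega>)) + W \<omega> * B \<partial>N)"
      by (simp add: distrib_left cong: Bochner_Integration.integral_cong)
    then show ?thesis
      using iW i[OF WN h(1) _ WD h(2), of "s + r"] i[OF WN Pm _ WD abs_kernel_le[OF h r], of s] by simp
  qed
  have ZC: "\<And>\<omega>. \<omega> \<in> space N \<Longrightarrow> 0 \<le> Z \<omega> + C \<and> Z \<omega> + C \<le> 2 * C" using Z(2) by (fastforce simp: abs_le_iff)
  obtain \<omega>0 where "\<omega>0 \<in> space N" using not_empty by blast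
  then have C0: "0 \<le> C" using Z(2)[of \<omega>0] by simp
  have "(\<integral>\<omega>. (Z \<omega> + C) * h (Y (s + r) \<omega>) \<partial>N) = (\<integral>\<omega>. (Z \<omega> + C) * (\<integral>y. h y \<partial>P r (Y s \<omega>)) \<partial>N)"
    using Z(1) by (intro shift[OF _ ZC]) auto
  moreover have "(\<integral>\<omega>. C * h (Y (s + r) \<omega>) \<partial>N) = (\<integral>\<omega>. C * (\<integral>y. h y \<partial>P r (Y s \<omega>)) \<partial>N)"
    by (rule shift[of "\<lambda>_. C" C]) (use C0 in auto)
  ultimately show ?thesis
    using i[OF ZN h(1) _ Z(2) h(2), of "s + r"] i[OF ZN Pm _ Z(2) abs_kernel_le[OF h r], of s]
      i[OF borel_measurable_const h(1) _ _ h(2), of "s + r" C "\<bar>C\<bar>"]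
      i[OF borel_measurable_const Pm _ _ abs_kernel_le[OF h r], of s C "\<bar>C\<bar>"]
    by (cases "C = 0") (auto simp: distrib_right)
qed

end

section \<open>The exponential martingale\<close>

lemma exp_remainder_bound:
  fixes x :: real
  shows "\<bar>exp x - 1 - x\<bar> \<le> x\<^sup>2 * exp \<bar>x\<bar>"
proof -
  obtain s where s: "\<bar>s\<bar> \<le> \<bar>x\<bar>" "exp x = (\<Sum>m<2. x ^ m / fact m) + exp s / fact 2 * x ^ 2"
    using Maclaurin_exp_le[of x 2] by blast
  then have "exp x - 1 - x = exp s / 2 * x\<^sup>2" by (simp add: eval_nat_numeral)
  then have "\<bar>exp x - 1 - x\<bar> = exp s / 2 * x\<^sup>2" by (simp only:) (simp add: abs_mult)
  also have "\<dots> \<le> exp \<bar>x\<bar> * x\<^sup>2"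
  proof (rule mult_right_mono)
    have "exp s \<le> exp \<bar>x\<bar>" using s(1) by simp
    then show "exp s / 2 \<le> exp \<bar>x\<bar>" using exp_gt_zero[of s] by linarith
  qed simp
  finally show ?thesis by (simp add: mult.commute)
qed

context progressive_markov_process
begin

definition path_integral :: "('s \<Rightarrow> real) \<Rightarrow> real \<Rightarrow> 'w \<Rightarrow> real" where
  "path_integral V s \<omega> = (LBINT r:{0..s}. V (Y r \<omega>))"

lemma borel_measurable_process_joint:
  assumes V: "V \<in> borel_measurable E" and s: "0 \<le> s"
  shows "(\<lambda>(r, \<omega>). V (Y (min s (max 0 r)) \<omega>) :: real) \<in> borel_measurable (borel \<Otimes>\<^sub>M N)"
    and "(\<lambda>(r, \<omega>). V (Y (min s (max 0 r)) \<omega>) :: real) \<in> borel_measurable (borel \<Otimes>\<^sub>M F s)"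
proof -
  show F: "(\<lambda>(r, \<omega>). V (Y (min s (max 0 r)) \<omega>) :: real) \<in> borel_measurable (borel \<Otimes>\<^sub>M F s)"
    using measurable_compose[OF progressive[OF s] V] by (simp add: split_beta')
  have "(\<lambda>x. x) \<in> borel \<Otimes>\<^sub>M N \<rightarrow>\<^sub>M borel \<Otimes>\<^sub>M F s"
  proof (rule measurable_pair)
    have "(\<lambda>x. x) \<in> N \<rightarrow>\<^sub>M F s" by (rule measurable_filtration[OF s measurable_ident_sets[OF refl]])
    from measurable_compose[OF measurable_snd this]
    show "snd \<circ> (\<lambda>x. x) \<in> borel \<Otimes>\<^sub>M N \<rightarrow>\<^sub>M F s" by (simp add: comp_def)
  qed (simp add: comp_def)
  from measurable_compose[OF this F]
  show "(\<lambda>(r, \<omega>). V (Y (min s (max 0 r)) \<omega>) :: real) \<in> borel_measurable (borel \<Otimes>\<^sub>M N)" .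
qed

lemma
  assumes V: "V \<in> borel_measurable E" "\<And>y. y \<in> space E \<Longrightarrow> \<bar>V y :: real\<bar> \<le> c" and s: "0 \<le> s"
  shows set_integrable_process: "\<omega> \<in> space N \<Longrightarrow> set_integrable lborel {0..s} (\<lambda>r. V (Y r \<omega>))"
    and borel_measurable_path_integral: "path_integral V s \<in> borel_measurable (F s)"
    and abs_path_integral_le: "\<omega> \<in> space N \<Longrightarrow> \<bar>path_integral V s \<omega>\<bar> \<le> c * s"
proof -
  have eq: "set_lebesgue_integral lborel {0..s} (\<lambda>r. V (Y (min s (max 0 r)) \<omega>)) = path_integral V s \<omega>" for \<omega>
    unfolding path_integral_def by (intro set_lebesgue_integral_cong) auto
  have b: "\<bar>V (Y r \<omega>)\<bar> \<le> c" if "0 \<le> r" "\<omega> \<in> space N" for r \<omega>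
    using V(2) process_space[OF that] by simp
  have si: "set_integrable lborel {0..s} (\<lambda>r. V (Y r \<omega>))" if w: "\<omega> \<in> space N" for \<omega>
  proof -
    have "set_integrable lborel {0..s} (\<lambda>r. V (Y (min s (max 0 r)) \<omega>))"
      using b s by (intro set_integrable_path[OF prob_space_axioms borel_measurable_process_joint(1)[OF V(1) s] _ w, where C = c]) auto
    then show ?thesis unfolding set_integrable_def
      by (rule Bochner_Integration.integrable_cong[THEN iffD1, rotated 2]) (auto simp: indicator_def)
  qed
  then show "\<omega> \<in> space N \<Longrightarrow> set_integrable lborel {0..s} (\<lambda>r. V (Y r \<omega>))" .
  show "\<omega> \<in> space N \<Longrightarrow> \<bar>path_integral V s \<omega>\<bar> \<le> c * s"
    using abs_set_integral_le[OF si, of \<omega> c] b s by (simp add: path_integral_def)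
  have "(\<lambda>(\<omega>, r). indicator {0..s} r *\<^sub>R V (Y (min s (max 0 r)) \<omega>)) \<in> borel_measurable (F s \<Otimes>\<^sub>M lborel)"
  proof -
    have [measurable]: "(\<lambda>x. V (Y (min s (max 0 (snd x))) (fst x))) \<in> borel_measurable (F s \<Otimes>\<^sub>M lborel)"
      using measurable_compose[OF measurable_pair_swap' borel_measurable_process_joint(2)[OF V(1) s]]
      by (simp add: split_beta')
    show ?thesis unfolding split_beta' by measurable
  qed
  then have "(\<lambda>\<omega>. \<integral>r. indicator {0..s} r *\<^sub>R V (Y (min s (max 0 r)) \<omega>) \<partial>lborel) \<in> borel_measurable (F s)"
    by (rule lborel.borel_measurable_lebesgue_integral)
  then show "path_integral V s \<in> borel_measurable (F s)"
    unfolding eq[unfolded set_lebesgue_integral_def] by simp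
qed

text \<open>The hypothesis \<open>gen\<close> says that \<open>- V u\<close> is the generator applied to \<open>u\<close>, so that
  \<open>exp (path_integral V s) * u (Y s)\<close> is a martingale. Only the first two terms of the exponential
  matter on a short interval.\<close>

lemma integral_exp_path_integral:
  assumes u: "u \<in> borel_measurable E" "\<And>y. y \<in> space E \<Longrightarrow> \<bar>u y :: real\<bar> \<le> D"
    and V: "V \<in> borel_measurable E" "\<And>y. y \<in> space E \<Longrightarrow> \<bar>V y :: real\<bar> \<le> c"
    and gen: "\<And>r y. 0 \<le> r \<Longrightarrow> y \<in> space E \<Longrightarrow> (\<integral>v. u v \<partial>P r y) = u y - (LBINT s:{0..r}. (\<integral>v. V v * u v \<partial>P s y))"
    and t: "0 \<le> t"
  shows "(\<integral>\<omega>. exp (path_integral V t \<omega>) * u (Y t \<omega>) \<partial>N) = (\<integral>\<omega>. u (Y 0 \<omega>) \<partial>N)"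
proof -
  obtain \<omega>0 where \<omega>0: "\<omega>0 \<in> space N" using not_empty by blast
  have y0: "Y 0 \<omega>0 \<in> space E" using process_space[of 0 \<omega>0] \<omega>0 by simp
  have c0: "0 \<le> c" and D0: "0 \<le> D" using V(2)[OF y0] u(2)[OF y0] by auto
  define z where "z s = (\<integral>\<omega>. exp (path_integral V s \<omega>) * u (Y s \<omega>) \<partial>N)" for s
  \<comment> \<open>One constant for two bounds: it dominates \<open>W\<close> at all times up to
    \<open>t\<close> and also the exponential of \<open>|B|\<close> on a subinterval.\<close>
  define C where "C = exp (c * t)"
  have C1: "1 \<le> C" using c0 t by (simp add: C_def)
  have Vu: "(\<lambda>v. V v * u v) \<in> borel_measurable E" "\<And>y. y \<in> space E \<Longrightarrow> \<bar>V y * u y\<bar> \<le> c * D"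
    using u V c0 by (auto simp: abs_mult intro!: mult_mono)
  have "z t = z 0"
  proof (rule eq_if_quadratic_increments[OF t, where K = "2 * (C * C * c\<^sup>2 * D)"])
    fix s h :: real assume sh: "0 \<le> s" "0 \<le> h" "s + h \<le> t"
    define W where "W \<omega> = exp (path_integral V s \<omega>)" for \<omega>
    define B where "B \<omega> = (LBINT r:{s..s + h}. V (Y r \<omega>))" for \<omega>
    \<comment> \<open>Agrees with \<open>Y\<close> on \<open>[0, t]\<close> and is jointly
      measurable over the whole Borel line after composition with \<open>V\<close> or
      \<open>u\<close>.\<close>
    define Y' where "Y' r = Y (min t (max 0 r))" for r
    have Y'eq: "Y' r = Y r" if "0 \<le> r" "r \<le> t" for r using that by (simp add: Y'_def)
    have Wm: "W \<in> borel_measurable (F s)"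
      unfolding W_def using borel_measurable_path_integral[OF V sh(1)] by simp
    have WN[measurable]: "W \<in> borel_measurable N" by (rule measurable_filtration[OF sh(1) Wm])
    have Wb: "0 < W \<omega>" "W \<omega> \<le> C" "\<bar>W \<omega>\<bar> \<le> C" if "\<omega> \<in> space N" for \<omega>
    proof -
      have "path_integral V s \<omega> \<le> c * s" using abs_path_integral_le[OF V sh(1) that] by simp
      also have "\<dots> \<le> c * t" using c0 sh by (intro mult_left_mono) auto
      finally show "0 < W \<omega>" "W \<omega> \<le> C" "\<bar>W \<omega>\<bar> \<le> C" by (auto simp: W_def C_def)
    qed
    have Yb: "\<bar>u (Y r \<omega>)\<bar> \<le> D" "\<bar>V (Y r \<omega>)\<bar> \<le> c" "Y r \<omega> \<in> space E" if "0 \<le> r" "\<omega> \<in> space N" for r \<omega>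
      using u(2) V(2) process_space[OF that] by auto
    have Y'm[measurable]: "(\<lambda>x. V (Y' (fst x) (snd x))) \<in> borel_measurable (borel \<Otimes>\<^sub>M N)"
        "(\<lambda>x. u (Y' (fst x) (snd x))) \<in> borel_measurable (borel \<Otimes>\<^sub>M N)"
      using borel_measurable_process_joint(1)[OF V(1) t] borel_measurable_process_joint(1)[OF u(1) t]
      by (auto simp: split_beta' Y'_def)
    have um[measurable]: "(\<lambda>\<omega>. u (Y r \<omega>)) \<in> borel_measurable N" if "0 \<le> r" for r
      by (rule measurable_compose[OF measurable_filtration[OF that adapted[OF that]] u(1)])
    have split: "path_integral V (s + h) \<omega> = path_integral V s \<omega> + B \<omega>" if "\<omega> \<in> space N" for \<omega>
      unfolding path_integral_def B_def using sh
      by (intro set_integral_Icc_split set_integrable_process[OF V _ that]) auto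
    have siB: "set_integrable lborel {s..s + h} (\<lambda>r. V (Y r \<omega>))" if "\<omega> \<in> space N" for \<omega>
      using sh by (intro set_integrable_subset[OF set_integrable_process[OF V t that]]) auto
    have Bb: "\<bar>B \<omega>\<bar> \<le> c * h" if "\<omega> \<in> space N" for \<omega>
      unfolding B_def using abs_set_integral_le[OF siB[OF that], of c] Yb(2)[OF _ that] sh by auto
    have BY': "B \<omega> = (LBINT r:{s..s + h}. V (Y' r \<omega>))" for \<omega>
      unfolding B_def using sh by (intro set_lebesgue_integral_cong) (auto simp: Y'eq)
    have Bm[measurable]: "B \<in> borel_measurable N"
      unfolding BY'[abs_def] using Y'm(1) Yb sh
      by (intro borel_measurable_set_integral[OF prob_space_axioms, where C = c]) (auto simp: split_beta' Y'eq)
    \<comment> \<open>With \<open>exp B = 1 + B + R\<close>, the part with \<open>R\<close> is of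
      order \<open>h^2\<close> at once. The part with 1 is treated in \<open>first\<close>, and the
      part with \<open>B\<close> has to cancel the integral left over there up to order
      \<open>h^2\<close>.\<close>
    define R where "R \<omega> = exp (B \<omega>) - 1 - B \<omega>" for \<omega>
    have Rb: "\<bar>R \<omega>\<bar> \<le> C * c\<^sup>2 * h\<^sup>2" if "\<omega> \<in> space N" for \<omega>
    proof -
      have "\<bar>R \<omega>\<bar> \<le> (B \<omega>)\<^sup>2 * exp \<bar>B \<omega>\<bar>" unfolding R_def by (rule exp_remainder_bound)
      also have "\<dots> \<le> (c * h)\<^sup>2 * C"
      proof (rule mult_mono)
        show "(B \<omega>)\<^sup>2 \<le> (c * h)\<^sup>2" using Bb[OF that] by (simp add: abs_le_square_iff[symmetric])
        have "\<bar>B \<omega>\<bar> \<le> c * t" using Bb[OF that] c0 sh mult_left_mono[of h t c] by simp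
        then show "exp \<bar>B \<omega>\<bar> \<le> C" by (simp add: C_def)
      qed auto
      finally show ?thesis by (simp add: power_mult_distrib mult_ac)
    qed
    have i: "integrable N g" if "g \<in> borel_measurable N" "\<And>\<omega>. \<omega> \<in> space N \<Longrightarrow> \<bar>g \<omega>\<bar> \<le> K" for g and K :: real
      using that by (rule integrable_bounded_prob[OF prob_space_axioms])
    have b1: "\<bar>W \<omega> * u (Y (s + h) \<omega>)\<bar> \<le> C * D"
      and b2: "\<bar>W \<omega> * u (Y (s + h) \<omega>) * B \<omega>\<bar> \<le> C * D * (c * h)"
      and b3: "\<bar>W \<omega> * u (Y (s + h) \<omega>) * R \<omega>\<bar> \<le> C * D * (C * c\<^sup>2 * h\<^sup>2)" if "\<omega> \<in> space N" for \<omega>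
    proof -
      show b1: "\<bar>W \<omega> * u (Y (s + h) \<omega>)\<bar> \<le> C * D"
        unfolding abs_mult using Wb[OF that] Yb[OF _ that] sh C1 by (intro mult_mono) auto
      show "\<bar>W \<omega> * u (Y (s + h) \<omega>) * B \<omega>\<bar> \<le> C * D * (c * h)"
        unfolding abs_mult[of _ "B \<omega>"] using b1 Bb[OF that] C1 D0 by (intro mult_mono) auto
      show "\<bar>W \<omega> * u (Y (s + h) \<omega>) * R \<omega>\<bar> \<le> C * D * (C * c\<^sup>2 * h\<^sup>2)"
        unfolding abs_mult[of _ "R \<omega>"] using b1 Rb[OF that] C1 D0 by (intro mult_mono) auto
    qed
    have Rm[measurable]: "R \<in> borel_measurable N" unfolding R_def by measurable
    have ush[measurable]: "(\<lambda>\<omega>. u (Y (s + h) \<omega>)) \<in> borel_measurable N" using sh by (intro um) auto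
    have zsh: "z (s + h) = (\<integral>\<omega>. W \<omega> * u (Y (s + h) \<omega>) \<partial>N) + (\<integral>\<omega>. W \<omega> * u (Y (s + h) \<omega>) * B \<omega> \<partial>N)
        + (\<integral>\<omega>. W \<omega> * u (Y (s + h) \<omega>) * R \<omega> \<partial>N)"
    proof -
      have "z (s + h) = (\<integral>\<omega>. W \<omega> * u (Y (s + h) \<omega>) + W \<omega> * u (Y (s + h) \<omega>) * B \<omega> + W \<omega> * u (Y (s + h) \<omega>) * R \<omega> \<partial>N)"
        unfolding z_def
      proof (intro Bochner_Integration.integral_cong refl)
        fix \<omega> assume w: "\<omega> \<in> space N"
        have e: "exp (path_integral V (s + h) \<omega>) = W \<omega> * exp (B \<omega>)"
          by (simp only: split[OF w] exp_add W_def)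
        show "exp (path_integral V (s + h) \<omega>) * u (Y (s + h) \<omega>)
            = W \<omega> * u (Y (s + h) \<omega>) + W \<omega> * u (Y (s + h) \<omega>) * B \<omega> + W \<omega> * u (Y (s + h) \<omega>) * R \<omega>"
          unfolding e R_def by (simp add: algebra_simps)
      qed
      moreover have I1: "integrable N (\<lambda>\<omega>. W \<omega> * u (Y (s + h) \<omega>))" by (rule i[OF _ b1]) measurable
      moreover have I2: "integrable N (\<lambda>\<omega>. W \<omega> * u (Y (s + h) \<omega>) * B \<omega>)" by (rule i[OF _ b2]) measurable
      moreover have I3: "integrable N (\<lambda>\<omega>. W \<omega> * u (Y (s + h) \<omega>) * R \<omega>)" by (rule i[OF _ b3]) measurable
      ultimately show ?thesis
        by simp
    qed
    \<comment> \<open>The Markov property at time \<open>s\<close> and \<open>gen\<close> produce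
      the drift \<open>- V u\<close>; a second use of the Markov property brings the drift back to
      the process at time \<open>s + r\<close>.\<close>
    have first: "(\<integral>\<omega>. W \<omega> * u (Y (s + h) \<omega>) \<partial>N)
        = z s - (LBINT r:{s..s + h}. (\<integral>\<omega>. W \<omega> * (V (Y r \<omega>) * u (Y r \<omega>)) \<partial>N))"
    proof -
      define G where "G r \<omega> = W \<omega> * (\<integral>v. V v * u v \<partial>P (max 0 r) (Y s \<omega>))" for r \<omega>
      have Ym: "Y s \<in> N \<rightarrow>\<^sub>M E" by (rule measurable_filtration[OF sh(1) adapted[OF sh(1)]])
      have Gm: "(\<lambda>(r, \<omega>). G r \<omega>) \<in> borel_measurable (borel \<Otimes>\<^sub>M N)"
      proof -
        have "(\<lambda>x. (fst x, Y s (snd x))) \<in> borel \<Otimes>\<^sub>M N \<rightarrow>\<^sub>M borel \<Otimes>\<^sub>M E"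
          using Ym by measurable
        from measurable_compose[OF this borel_measurable_joint[OF Vu(1)]]
        have "(\<lambda>x. \<integral>v. V v * u v \<partial>P (max 0 (fst x)) (Y s (snd x))) \<in> borel_measurable (borel \<Otimes>\<^sub>M N)"
          by simp
        then show ?thesis unfolding G_def split_beta' by measurable
      qed
      have Gb: "\<bar>G r \<omega>\<bar> \<le> C * (c * D)" if "\<omega> \<in> space N" for r \<omega>
        unfolding G_def abs_mult using Wb[OF that] C1 abs_kernel_le[OF Vu, of "max 0 r" "Y s \<omega>"] process_space[OF sh(1) that]
        by (intro mult_mono) auto
      have "(\<integral>\<omega>. W \<omega> * u (Y (s + h) \<omega>) \<partial>N) = (\<integral>\<omega>. W \<omega> * (\<integral>v. u v \<partial>P h (Y s \<omega>)) \<partial>N)"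
        by (rule integral_markov[OF sh(1,2) Wm Wb(3) u])
      also have "\<dots> = (\<integral>\<omega>. W \<omega> * u (Y s \<omega>) - (LBINT r:{0..h}. G r \<omega>) \<partial>N)"
      proof (intro Bochner_Integration.integral_cong refl)
        fix \<omega> assume w: "\<omega> \<in> space N"
        have "(LBINT r:{0..h}. G r \<omega>) = (LBINT r:{0..h}. W \<omega> * (\<integral>v. V v * u v \<partial>P r (Y s \<omega>)))"
          by (intro set_lebesgue_integral_cong) (auto simp: G_def)
        then show "W \<omega> * (\<integral>v. u v \<partial>P h (Y s \<omega>)) = W \<omega> * u (Y s \<omega>) - (LBINT r:{0..h}. G r \<omega>)"
          using gen[OF sh(2) process_space[OF sh(1) w]] by (simp add: right_diff_distrib)
      qed
      also have "\<dots> = z s - (\<integral>\<omega>. (LBINT r:{0..h}. G r \<omega>) \<partial>N)"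
      proof -
        have "integrable N (\<lambda>\<omega>. W \<omega> * u (Y s \<omega>))"
          using um[OF sh(1)] Wb Yb[OF sh(1)] C1
          by (intro i[of _ "C * D"]) (auto simp: abs_mult intro!: mult_mono)
        moreover have "integrable N (\<lambda>\<omega>. LBINT r:{0..h}. G r \<omega>)"
        proof (rule i[of _ "C * (c * D) * (h - 0)"])
          show "(\<lambda>\<omega>. LBINT r:{0..h}. G r \<omega>) \<in> borel_measurable N"
            by (rule borel_measurable_set_integral[OF prob_space_axioms Gm Gb])
          fix \<omega> assume w: "\<omega> \<in> space N"
          show "\<bar>LBINT r:{0..h}. G r \<omega>\<bar> \<le> C * (c * D) * (h - 0)"
            by (rule abs_set_integral_le[OF set_integrable_path[OF prob_space_axioms Gm Gb w] Gb[OF w] sh(2)])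
        qed
        ultimately show ?thesis by (simp add: z_def W_def)
      qed
      also have "(\<integral>\<omega>. (LBINT r:{0..h}. G r \<omega>) \<partial>N) = (LBINT r:{0..h}. (\<integral>\<omega>. G r \<omega> \<partial>N))"
        by (rule integral_set_integral_swap[OF prob_space_axioms Gm Gb])
      also have "\<dots> = (LBINT r:{0..h}. (\<integral>\<omega>. W \<omega> * (V (Y (s + r) \<omega>) * u (Y (s + r) \<omega>)) \<partial>N))"
      proof (intro set_lebesgue_integral_cong)
        show "\<forall>r. r \<in> {0..h} \<longrightarrow> (\<integral>\<omega>. G r \<omega> \<partial>N) = (\<integral>\<omega>. W \<omega> * (V (Y (s + r) \<omega>) * u (Y (s + r) \<omega>)) \<partial>N)"
          using integral_markov[OF sh(1) _ Wm Wb(3) Vu] by (simp add: G_def)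
      qed simp
      also have "\<dots> = (LBINT r:{s..s + h}. (\<integral>\<omega>. W \<omega> * (V (Y r \<omega>) * u (Y r \<omega>)) \<partial>N))"
        by (rule set_integral_shift[where g = "\<lambda>r. \<integral>\<omega>. W \<omega> * (V (Y r \<omega>) * u (Y r \<omega>)) \<partial>N"])
      finally show ?thesis .
    qed
    \<comment> \<open>The term with \<open>B\<close> carries \<open>u\<close> at time
      \<open>s + h\<close>, the drift carries it at time \<open>r\<close>; \<open>H\<close> is this
      mismatch.\<close>
    define H where "H r \<omega> = W \<omega> * u (Y (s + h) \<omega>) * V (Y' r \<omega>) - W \<omega> * (V (Y' r \<omega>) * u (Y' r \<omega>))" for r \<omega>
    have Hm: "(\<lambda>(r, \<omega>). H r \<omega>) \<in> borel_measurable (borel \<Otimes>\<^sub>M N)"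
      unfolding H_def split_beta' by measurable
    have second: "(\<integral>\<omega>. W \<omega> * u (Y (s + h) \<omega>) * B \<omega> \<partial>N) - (LBINT r:{s..s + h}. (\<integral>\<omega>. W \<omega> * (V (Y r \<omega>) * u (Y r \<omega>)) \<partial>N))
        = (LBINT r:{s..s + h}. (\<integral>\<omega>. H r \<omega> \<partial>N))"
    proof -
      define H1 where "H1 r \<omega> = W \<omega> * u (Y (s + h) \<omega>) * V (Y' r \<omega>)" for r \<omega>
      define H2 where "H2 r \<omega> = W \<omega> * (V (Y' r \<omega>) * u (Y' r \<omega>))" for r \<omega>
      have m1: "(\<lambda>(r, \<omega>). H1 r \<omega>) \<in> borel_measurable (borel \<Otimes>\<^sub>M N)"
        and m2: "(\<lambda>(r, \<omega>). H2 r \<omega>) \<in> borel_measurable (borel \<Otimes>\<^sub>M N)"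
        unfolding H1_def H2_def split_beta' by measurable
      have Hb: "\<bar>H1 r \<omega>\<bar> \<le> C * D * c" "\<bar>H2 r \<omega>\<bar> \<le> C * (c * D)" if "r \<in> {s..s + h}" "\<omega> \<in> space N" for r \<omega>
      proof -
        have r: "0 \<le> r" "r \<le> t" using that sh by auto
        show "\<bar>H1 r \<omega>\<bar> \<le> C * D * c"
          unfolding H1_def Y'eq[OF r] abs_mult[of _ "V (Y r \<omega>)"]
          using b1[OF that(2)] Yb[OF r(1) that(2)] C1 D0 by (intro mult_mono) auto
        show "\<bar>H2 r \<omega>\<bar> \<le> C * (c * D)"
          unfolding H2_def abs_mult Y'eq[OF r]
          using Wb[OF that(2)] Yb[OF r(1) that(2)] C1 c0 by (intro mult_mono) auto
      qed
      have "(\<integral>\<omega>. W \<omega> * u (Y (s + h) \<omega>) * B \<omega> \<partial>N) = (\<integral>\<omega>. (LBINT r:{s..s + h}. H1 r \<omega>) \<partial>N)"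
        unfolding BY' H1_def by simp
      also have "\<dots> = (LBINT r:{s..s + h}. (\<integral>\<omega>. H1 r \<omega> \<partial>N))"
        by (rule integral_set_integral_swap[OF prob_space_axioms m1 Hb(1)])
      finally have e1: "(\<integral>\<omega>. W \<omega> * u (Y (s + h) \<omega>) * B \<omega> \<partial>N) = (LBINT r:{s..s + h}. (\<integral>\<omega>. H1 r \<omega> \<partial>N))" .
      have e2: "(LBINT r:{s..s + h}. (\<integral>\<omega>. W \<omega> * (V (Y r \<omega>) * u (Y r \<omega>)) \<partial>N)) = (LBINT r:{s..s + h}. (\<integral>\<omega>. H2 r \<omega> \<partial>N))"
        using sh by (intro set_lebesgue_integral_cong) (auto simp: H2_def Y'eq)
      have "(LBINT r:{s..s + h}. (\<integral>\<omega>. H1 r \<omega> \<partial>N)) - (LBINT r:{s..s + h}. (\<integral>\<omega>. H2 r \<omega> \<partial>N))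
          = (LBINT r:{s..s + h}. (\<integral>\<omega>. H1 r \<omega> \<partial>N) - (\<integral>\<omega>. H2 r \<omega> \<partial>N))"
        by (rule set_integral_diff(2)[symmetric])
          (rule set_integrable_expectation[OF prob_space_axioms m1 Hb(1)], assumption+,
           rule set_integrable_expectation[OF prob_space_axioms m2 Hb(2)])
      also have "\<dots> = (LBINT r:{s..s + h}. (\<integral>\<omega>. H r \<omega> \<partial>N))"
      proof (intro set_lebesgue_integral_cong allI impI)
        fix r assume r: "r \<in> {s..s + h}"
        have "integrable N (H1 r)" "integrable N (H2 r)"
          using measurable_compose[OF measurable_Pair1'[of r borel] m1] measurable_compose[OF measurable_Pair1'[of r borel] m2]
          by (auto intro!: i[OF _ Hb(1)[OF r]] i[OF _ Hb(2)[OF r]])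
        then show "(\<integral>\<omega>. H1 r \<omega> \<partial>N) - (\<integral>\<omega>. H2 r \<omega> \<partial>N) = (\<integral>\<omega>. H r \<omega> \<partial>N)"
          unfolding H_def H1_def[symmetric] H2_def[symmetric] by simp
      qed simp
      finally show ?thesis unfolding e1 e2 .
    qed
    \<comment> \<open>Conditioning at time \<open>r\<close> replaces \<open>u (Y (s + h))\<close> by
      \<open>k (Y r)\<close>, and \<open>gen\<close> bounds \<open>k - u\<close> by
      \<open>c * D * h\<close>. Integration over an interval of length \<open>h\<close> supplies the
      second factor \<open>h\<close>.\<close>
    have Hint: "\<bar>\<integral>\<omega>. H r \<omega> \<partial>N\<bar> \<le> C * c\<^sup>2 * D * h" if r: "r \<in> {s..s + h}" for r
    proof -
      have r0: "0 \<le> r" "r \<le> t" "s \<le> r" "r \<le> s + h" using r sh by auto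
      define X where "X \<omega> = W \<omega> * V (Y r \<omega>)" for \<omega>
      have Xm: "X \<in> borel_measurable (F r)"
        unfolding X_def using measurable_filtration_mono[OF sh(1) r0(3) Wm] measurable_compose[OF adapted[OF r0(1)] V(1)]
        by measurable
      have XN: "X \<in> borel_measurable N" by (rule measurable_filtration[OF r0(1) Xm])
      have Xb: "\<bar>X \<omega>\<bar> \<le> C * c" if "\<omega> \<in> space N" for \<omega>
        unfolding X_def abs_mult using Wb[OF that] Yb[OF r0(1) that] C1 by (intro mult_mono) auto
      define k where "k y = (\<integral>v. u v \<partial>P (s + h - r) y)" for y
      have km: "k \<in> borel_measurable E" unfolding k_def using r0 by (intro borel_measurable_space[OF u(1)]) auto
      have kN[measurable]: "(\<lambda>\<omega>. k (Y r \<omega>)) \<in> borel_measurable N"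
        by (rule measurable_compose[OF measurable_filtration[OF r0(1) adapted[OF r0(1)]] km])
      have kb: "\<bar>k y\<bar> \<le> D" if "y \<in> space E" for y
        unfolding k_def using r0 that by (intro abs_kernel_le[OF u]) auto
      have ku: "\<bar>k y - u y\<bar> \<le> c * D * h" if y: "y \<in> space E" for y
      proof -
        have rh: "0 \<le> s + h - r" using r0 by simp
        have "(\<lambda>a. \<integral>v. V v * u v \<partial>P (max 0 a) y) \<in> borel_measurable borel"
          by (rule borel_measurable_time[OF Vu(1) y])
        then have "(\<lambda>(a, \<omega>). \<integral>v. V v * u v \<partial>P (max 0 a) y) \<in> borel_measurable (borel \<Otimes>\<^sub>M N)"
          unfolding split_beta' by measurable
        then have "set_integrable lborel {0..s + h - r} (\<lambda>a. \<integral>v. V v * u v \<partial>P (max 0 a) y)"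
          by (rule set_integrable_path[OF prob_space_axioms _ _ \<omega>0, where C = "c * D"])
            (use abs_kernel_le[OF Vu] y in auto)
        from abs_set_integral_le[OF this, of "c * D"]
        have "\<bar>LBINT a:{0..s + h - r}. \<integral>v. V v * u v \<partial>P (max 0 a) y\<bar> \<le> c * D * (s + h - r - 0)"
          using abs_kernel_le[OF Vu] y rh by auto
        also have "(LBINT a:{0..s + h - r}. \<integral>v. V v * u v \<partial>P (max 0 a) y) = (LBINT a:{0..s + h - r}. \<integral>v. V v * u v \<partial>P a y)"
          by (intro set_lebesgue_integral_cong) auto
        finally have "\<bar>k y - u y\<bar> \<le> c * D * (s + h - r - 0)"
          unfolding k_def gen[OF rh y] by simp
        also have "\<dots> \<le> c * D * h" using r0 c0 D0 by (intro mult_left_mono) auto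
        finally show ?thesis .
      qed
      have uN: "(\<lambda>\<omega>. u (Y r \<omega>)) \<in> borel_measurable N" by (rule um[OF r0(1)])
      have iX: "integrable N (\<lambda>\<omega>. X \<omega> * g \<omega>)"
        if "g \<in> borel_measurable N" "\<And>\<omega>. \<omega> \<in> space N \<Longrightarrow> \<bar>g \<omega>\<bar> \<le> D" for g
        using that XN Xb C1 c0 by (intro i[of _ "C * c * D"]) (auto simp: abs_mult intro!: mult_mono)
      have "(\<integral>\<omega>. H r \<omega> \<partial>N) = (\<integral>\<omega>. X \<omega> * u (Y (s + h) \<omega>) - X \<omega> * u (Y r \<omega>) \<partial>N)"
        unfolding H_def X_def Y'eq[OF r0(1,2)] by (simp add: mult_ac)
      also have "\<dots> = (\<integral>\<omega>. X \<omega> * u (Y (s + h) \<omega>) \<partial>N) - (\<integral>\<omega>. X \<omega> * u (Y r \<omega>) \<partial>N)"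
        using iX[OF ush] iX[OF uN] Yb r0 sh by (intro Bochner_Integration.integral_diff) auto
      also have "(\<integral>\<omega>. X \<omega> * u (Y (s + h) \<omega>) \<partial>N) = (\<integral>\<omega>. X \<omega> * k (Y r \<omega>) \<partial>N)"
        using integral_markov[OF r0(1) _ Xm Xb u, of "s + h - r"] r0 by (simp add: k_def)
      also have "\<dots> - (\<integral>\<omega>. X \<omega> * u (Y r \<omega>) \<partial>N) = (\<integral>\<omega>. X \<omega> * (k (Y r \<omega>) - u (Y r \<omega>)) \<partial>N)"
        using iX[OF kN] iX[OF uN] Yb r0 kb by (simp add: right_diff_distrib)
      also have "\<bar>\<dots>\<bar> \<le> C * c * (c * D * h)"
      proof (rule integral_bounded_prob[OF prob_space_axioms])
        show "(\<lambda>\<omega>. X \<omega> * (k (Y r \<omega>) - u (Y r \<omega>))) \<in> borel_measurable N" using XN uN by measurable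
        fix \<omega> assume w: "\<omega> \<in> space N"
        show "\<bar>X \<omega> * (k (Y r \<omega>) - u (Y r \<omega>))\<bar> \<le> C * c * (c * D * h)"
          unfolding abs_mult using Xb[OF w] ku[OF Yb(3)[OF r0(1) w]] C1 c0 by (intro mult_mono) auto
      qed
      finally show ?thesis by (simp add: power2_eq_square mult_ac)
    qed
    have "z (s + h) - z s = (LBINT r:{s..s + h}. (\<integral>\<omega>. H r \<omega> \<partial>N)) + (\<integral>\<omega>. W \<omega> * u (Y (s + h) \<omega>) * R \<omega> \<partial>N)"
      using zsh first second by linarith
    moreover have "\<bar>LBINT r:{s..s + h}. (\<integral>\<omega>. H r \<omega> \<partial>N)\<bar> \<le> C * c\<^sup>2 * D * h * (s + h - s)"
    proof (rule abs_set_integral_le[OF _ Hint])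
      have "\<bar>H r \<omega>\<bar> \<le> C * D * c + C * (c * D)" if "r \<in> {s..s + h}" "\<omega> \<in> space N" for r \<omega>
      proof -
        have r: "0 \<le> r" "r \<le> t" using that sh by auto
        have "\<bar>W \<omega> * u (Y (s + h) \<omega>) * V (Y r \<omega>)\<bar> \<le> C * D * c"
          unfolding abs_mult[of _ "V (Y r \<omega>)"]
          using b1[OF that(2)] Yb[OF r(1) that(2)] C1 D0 by (intro mult_mono) auto
        moreover have "\<bar>W \<omega> * (V (Y r \<omega>) * u (Y r \<omega>))\<bar> \<le> C * (c * D)"
          unfolding abs_mult using Wb[OF that(2)] Yb[OF r(1) that(2)] C1 c0 by (intro mult_mono) auto
        ultimately show ?thesis unfolding H_def Y'eq[OF r] by linarith
      qed
      then show "set_integrable lborel {s..s + h} (\<lambda>r. \<integral>\<omega>. H r \<omega> \<partial>N)"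
        by (rule set_integrable_expectation[OF prob_space_axioms Hm])
    qed (use sh in auto)
    moreover have "\<bar>\<integral>\<omega>. W \<omega> * u (Y (s + h) \<omega>) * R \<omega> \<partial>N\<bar> \<le> C * D * (C * c\<^sup>2 * h\<^sup>2)"
      by (rule integral_bounded_prob[OF prob_space_axioms _ b3]) measurable
    moreover have "C * c\<^sup>2 * D * h * (s + h - s) \<le> C * C * c\<^sup>2 * D * h\<^sup>2"
    proof -
      have "1 * (C * c\<^sup>2 * D * h\<^sup>2) \<le> C * (C * c\<^sup>2 * D * h\<^sup>2)"
        using C1 c0 D0 by (intro mult_right_mono) auto
      then show ?thesis by (simp add: power2_eq_square mult_ac)
    qed
    ultimately show "\<bar>z (s + h) - z s\<bar> \<le> 2 * (C * C * c\<^sup>2 * D) * h\<^sup>2"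
      by (simp add: mult_ac)
  qed
  moreover have "z 0 = (\<integral>\<omega>. u (Y 0 \<omega>) \<partial>N)"
  proof -
    have "path_integral V 0 \<omega> = 0" if "\<omega> \<in> space N" for \<omega>
      using abs_path_integral_le[OF V order_refl that] by simp
    then show ?thesis unfolding z_def by (intro Bochner_Integration.integral_cong) auto
  qed
  ultimately show ?thesis by (simp add: z_def)
qed

end

section \<open>Concentration of time averages\<close>

locale ergodic_markov_process = ergodic_semigroup E P \<pi> + progressive_markov_process E P N F Y
  for E :: "'s measure" and P \<pi> and N :: "'w measure" and F Y
begin

text \<open>Chernoff's bound with \<open>u = 1 + \<theta> w\<close>, where \<open>w = deviation_kernel P \<pi> f\<close>, and
  \<open>V = \<theta> (f - p) / u\<close>. Bounding \<open>u\<close> from above where \<open>f\<close> is large and from below where \<open>f\<close> is small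
  makes the lower bound for \<open>V\<close> affine in \<open>f\<close>.\<close>

lemma prob_mean_ge_le:
  fixes f :: "'s \<Rightarrow> real" and a b e t \<theta> :: real
  assumes f: "f \<in> borel_measurable E" "\<And>y. y \<in> space E \<Longrightarrow> 0 \<le> f y \<and> f y \<le> 1"
    and w: "\<And>y. y \<in> space E \<Longrightarrow> - b \<le> deviation_kernel P \<pi> f y \<and> deviation_kernel P \<pi> f y \<le> a"
    and \<theta>: "0 < \<theta>" "\<theta> * b < 1" "0 \<le> a" and t: "0 < t"
  defines "p \<equiv> \<integral>y. f y \<partial>\<pi>"
  shows "measure N {\<omega> \<in> space N. p + e \<le> 1 / t * (LBINT s:{0..t}. f (Y s \<omega>))}
    \<le> (1 + \<theta> * a) / (1 - \<theta> * b) *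
       exp (- (t * \<theta> * ((1 - p) * (p + e) / (1 + \<theta> * a) - p * (1 - p - e) / (1 - \<theta> * b))))"
proof -
  define w where "w = deviation_kernel P \<pi> f"
  define u where "u y = 1 + \<theta> * w y" for y
  define V where "V y = \<theta> * (f y - p) / u y" for y
  define \<alpha> where "\<alpha> = 1 + \<theta> * a"
  define \<beta> where "\<beta> = 1 - \<theta> * b"
  have \<alpha>: "\<alpha> > 0" using \<theta> by (simp add: \<alpha>_def add_pos_nonneg)
  have \<beta>: "\<beta> > 0" using \<theta> by (simp add: \<beta>_def)
  have f1: "\<bar>f y\<bar> \<le> 1" if "y \<in> space E" for y using f(2)[OF that] by auto
  have p: "0 \<le> p" "p \<le> 1"
  proof -
    show "0 \<le> p" unfolding p_def using f(2) by (intro integral_nonneg_AE AE_I2) (auto simp: space_pi)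
    have "\<bar>p\<bar> \<le> 1" unfolding p_def
      using f1 by (intro integral_bounded_prob[OF prob_space_pi borel_measurable_pi[OF f(1)]]) (auto simp: space_pi)
    then show "p \<le> 1" by simp
  qed
  have u: "\<beta> \<le> u y" "u y \<le> \<alpha>" if "y \<in> space E" for y
    using w[OF that] \<theta>(1) mult_left_mono[of "- b" "w y" \<theta>] mult_left_mono[of "w y" a \<theta>]
    by (auto simp: u_def \<alpha>_def \<beta>_def w_def)
  have upos: "0 < u y" if "y \<in> space E" for y using u(1)[OF that] \<beta> by simp
  have wm: "w \<in> borel_measurable E" unfolding w_def by (rule borel_measurable_deviation_kernel[OF f(1)])
  have um: "u \<in> borel_measurable E" unfolding u_def using wm by simp
  have Vm: "V \<in> borel_measurable E" unfolding V_def using um f(1) by simp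
  have ub: "\<bar>u y\<bar> \<le> \<alpha>" if "y \<in> space E" for y using u[OF that] upos[OF that] by simp
  have wb: "\<bar>w y\<bar> \<le> max a b" if "y \<in> space E" for y using w[OF that] by (auto simp: w_def)
  have Vb: "\<bar>V y\<bar> \<le> \<theta> / \<beta>" if y: "y \<in> space E" for y
  proof -
    have "\<bar>\<theta> * (f y - p)\<bar> \<le> \<theta> * 1"
      unfolding abs_mult using f(2)[OF y] p \<theta>(1) by (intro mult_mono) (auto simp: abs_le_iff)
    then show ?thesis unfolding V_def abs_divide using u(1)[OF y] \<beta> upos[OF y] \<theta> by (intro frac_le) auto
  qed
  have gen: "(\<integral>v. u v \<partial>P r y) = u y - (LBINT s:{0..r}. (\<integral>v. V v * u v \<partial>P s y))"
    if r: "0 \<le> r" and y: "y \<in> space E" for r y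
  proof -
    interpret Q: prob_space "P r y" by (rule prob_space_kernel[OF r y])
    have "(\<integral>v. V v * u v \<partial>P s y) = \<theta> * ((\<integral>v. f v \<partial>P s y) - p)" if s: "0 \<le> s" for s
    proof -
      interpret S: prob_space "P s y" by (rule prob_space_kernel[OF s y])
      have "(\<integral>v. V v * u v \<partial>P s y) = (\<integral>v. \<theta> * (f v - p) \<partial>P s y)"
        using upos space_kernel[OF s y] by (intro Bochner_Integration.integral_cong refl) (force simp: V_def)
      also have "\<dots> = \<theta> * ((\<integral>v. f v \<partial>P s y) - p)"
        using integrable_kernel[OF f(1) f1 s y] by (simp add: S.prob_space)
      finally show ?thesis .
    qed
    then have "(LBINT s:{0..r}. (\<integral>v. V v * u v \<partial>P s y)) = (LBINT s:{0..r}. \<theta> * ((\<integral>v. f v \<partial>P s y) - p))"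
      by (intro set_lebesgue_integral_cong) auto
    also have "\<dots> = \<theta> * (LBINT s:{0..r}. (\<integral>v. f v \<partial>P s y) - p)"
      by (rule set_integral_mult_right)
    finally have 1: "(LBINT s:{0..r}. (\<integral>v. V v * u v \<partial>P s y)) = \<theta> * (LBINT s:{0..r}. (\<integral>v. f v \<partial>P s y) - p)" .
    have 2: "(\<integral>v. u v \<partial>P r y) = 1 + \<theta> * (\<integral>v. w v \<partial>P r y)"
      unfolding u_def using integrable_kernel[OF wm wb r y] by (simp add: Q.prob_space)
    have 3: "(\<integral>v. w v \<partial>P r y) = w y - (LBINT s:{0..r}. (\<integral>v. f v \<partial>P s y) - p)"
      unfolding w_def p_def by (rule deviation_kernel_dynkin[OF f(1) f1 r y])
    show ?thesis unfolding 1 2 3 by (simp add: u_def right_diff_distrib)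
  qed
  have t0: "0 \<le> t" using t by simp
  have martingale: "(\<integral>\<omega>. exp (path_integral V t \<omega>) * u (Y t \<omega>) \<partial>N) = (\<integral>\<omega>. u (Y 0 \<omega>) \<partial>N)"
    by (rule integral_exp_path_integral[OF um ub Vm Vb gen t0])
  \<comment> \<open>The slope of the minorant of \<open>V\<close> is
    \<open>\<theta> * \<kappa>\<close>. It comes from \<open>f - p = (1 - p) f - p (1 - f)\<close>:
    both products are nonnegative, so \<open>u\<close> is replaced by \<open>\<alpha>\<close> under
    the first and by \<open>\<beta>\<close> under the second.\<close>
  define \<kappa> where "\<kappa> = (1 - p) / \<alpha> + p / \<beta>"
  have \<kappa>: "0 \<le> \<kappa>" using p \<alpha> \<beta> by (simp add: \<kappa>_def)
  have Vlow: "\<theta> * \<kappa> * f y - \<theta> * (p / \<beta>) \<le> V y" if y: "y \<in> space E" for y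
  proof -
    have "(1 - p) * f y / \<alpha> \<le> (1 - p) * f y / u y"
      using u(2)[OF y] upos[OF y] f(2)[OF y] p \<alpha> by (intro divide_left_mono) auto
    moreover have "p * (1 - f y) / u y \<le> p * (1 - f y) / \<beta>"
      using u(1)[OF y] upos[OF y] f(2)[OF y] p \<beta> by (intro divide_left_mono) auto
    ultimately have "(1 - p) * f y / \<alpha> - p * (1 - f y) / \<beta> \<le> (1 - p) * f y / u y - p * (1 - f y) / u y"
      by linarith
    also have "\<dots> = (f y - p) / u y" by (simp add: diff_divide_distrib[symmetric] algebra_simps)
    finally have "\<theta> * ((1 - p) * f y / \<alpha> - p * (1 - f y) / \<beta>) \<le> \<theta> * ((f y - p) / u y)"
      using \<theta>(1) by (intro mult_left_mono) auto
    moreover have "(1 - p) * f y / \<alpha> - p * (1 - f y) / \<beta> = \<kappa> * f y - p / \<beta>"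
      by (simp add: \<kappa>_def algebra_simps diff_divide_distrib)
    ultimately have "\<theta> * (\<kappa> * f y - p / \<beta>) \<le> \<theta> * ((f y - p) / u y)" by (simp only:)
    moreover have "\<theta> * \<kappa> * f y - \<theta> * (p / \<beta>) = \<theta> * (\<kappa> * f y - p / \<beta>)" by (simp add: right_diff_distrib)
    moreover have "V y = \<theta> * ((f y - p) / u y)" by (simp add: V_def)
    ultimately show ?thesis by (simp only:)
  qed
  define L where "L = t * \<theta> * ((1 - p) * (p + e) / \<alpha> - p * (1 - p - e) / \<beta>)"
  define A where "A = {\<omega> \<in> space N. p + e \<le> 1 / t * path_integral f t \<omega>}"
  have pm: "path_integral f t \<in> borel_measurable N" "path_integral V t \<in> borel_measurable N"
    using measurable_filtration[OF t0 borel_measurable_path_integral[OF f(1) f1 t0]]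
      measurable_filtration[OF t0 borel_measurable_path_integral[OF Vm Vb t0]] by auto
  have A: "A \<in> sets N" unfolding A_def using pm(1) by measurable
  have path: "L \<le> path_integral V t \<omega>" if "\<omega> \<in> A" for \<omega>
  proof -
    have \<omega>: "\<omega> \<in> space N" and I: "t * (p + e) \<le> path_integral f t \<omega>"
      using that t by (auto simp: A_def field_simps)
    note si = set_integrable_process[OF f(1) f1 t0 \<omega>]
    note aff = set_integral_affine[OF t0, of "\<theta> * (p / \<beta>)" 0]
    have "L = \<theta> * \<kappa> * (t * (p + e)) - \<theta> * (p / \<beta>) * t"
      using \<alpha> \<beta> by (simp add: L_def \<kappa>_def field_simps)
    also have "\<dots> \<le> \<theta> * \<kappa> * path_integral f t \<omega> - \<theta> * (p / \<beta>) * t"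
      using I \<theta> \<kappa> by (intro diff_right_mono mult_left_mono) auto
    also have "\<dots> = (LBINT r:{0..t}. \<theta> * \<kappa> * f (Y r \<omega>) - (\<theta> * (p / \<beta>) - 0 * r))"
      unfolding path_integral_def
      by (subst set_integral_diff) (use si aff in \<open>auto intro!: set_integrable_mult_right\<close>)
    also have "\<dots> \<le> path_integral V t \<omega>"
      unfolding path_integral_def
    proof (rule set_integral_mono)
      show "set_integrable lborel {0..t} (\<lambda>r. \<theta> * \<kappa> * f (Y r \<omega>) - (\<theta> * (p / \<beta>) - 0 * r))"
        by (intro set_integral_diff(1) set_integrable_mult_right si aff(1)) 
      show "set_integrable lborel {0..t} (\<lambda>r. V (Y r \<omega>))" by (rule set_integrable_process[OF Vm Vb t0 \<omega>])
      fix r assume "r \<in> {0..t}"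
      then show "\<theta> * \<kappa> * f (Y r \<omega>) - (\<theta> * (p / \<beta>) - 0 * r) \<le> V (Y r \<omega>)"
        using Vlow[OF process_space[of r \<omega>]] \<omega> by simp
    qed
    finally show ?thesis .
  qed
  have Ym: "(\<lambda>\<omega>. u (Y r \<omega>)) \<in> borel_measurable N" if "0 \<le> r" for r
    by (rule measurable_compose[OF measurable_filtration[OF that adapted[OF that]] um])
  have bnd: "\<bar>exp (path_integral V t \<omega>) * u (Y t \<omega>)\<bar> \<le> exp (\<theta> / \<beta> * t) * \<alpha>" if "\<omega> \<in> space N" for \<omega>
    unfolding abs_mult using abs_path_integral_le[OF Vm Vb t0 that] ub[OF process_space[OF t0 that]] \<alpha>
    by (intro mult_mono) auto
  have int: "integrable N (\<lambda>\<omega>. exp (path_integral V t \<omega>) * u (Y t \<omega>))"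
    using pm(2) Ym[OF t0] by (intro integrable_bounded_prob[OF prob_space_axioms _ bnd]) auto
  \<comment> \<open>Markov's inequality: the martingale is at least \<open>exp L * \<beta>\<close>
    on \<open>A\<close> and positive elsewhere.\<close>
  have "exp L * \<beta> * measure N A = (\<integral>\<omega>. exp L * \<beta> * indicator A \<omega> \<partial>N)"
    using A sets.sets_into_space[OF A] by (simp add: Int_absorb2)
  also have "\<dots> \<le> (\<integral>\<omega>. exp (path_integral V t \<omega>) * u (Y t \<omega>) \<partial>N)"
  proof (rule integral_mono[OF _ int])
    show "integrable N (\<lambda>\<omega>. exp L * \<beta> * indicator A \<omega>)"
      using A by (intro integrable_mult_right integrable_real_indicator) (auto simp: emeasure_eq_measure)
    fix \<omega> assume \<omega>: "\<omega> \<in> space N"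
    show "exp L * \<beta> * indicator A \<omega> \<le> exp (path_integral V t \<omega>) * u (Y t \<omega>)"
    proof (cases "\<omega> \<in> A")
      case True
      then have "exp L * \<beta> \<le> exp (path_integral V t \<omega>) * u (Y t \<omega>)"
        using path[OF True] u(1)[OF process_space[OF t0 \<omega>]] \<beta> by (intro mult_mono) auto
      then show ?thesis using True by simp
    next
      case False
      then show ?thesis using upos[OF process_space[OF t0 \<omega>]] by simp
    qed
  qed
  also have "\<dots> \<le> \<alpha>"
  proof -
    have "\<bar>\<integral>\<omega>. u (Y 0 \<omega>) \<partial>N\<bar> \<le> \<alpha>"
      using ub process_space by (intro integral_bounded_prob[OF prob_space_axioms Ym[OF order_refl]]) auto
    then show ?thesis unfolding martingale by simp
  qed
  finally have "measure N A \<le> \<alpha> / (exp L * \<beta>)" using \<beta> by (simp add: pos_le_divide_eq mult.commute)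
  also have "\<dots> = \<alpha> / \<beta> * exp (- L)" by (simp add: exp_minus field_simps)
  finally show ?thesis unfolding A_def path_integral_def L_def \<alpha>_def \<beta>_def .
qed

text \<open>Rescaling to values in \<open>[0, 1]\<close> divides deviations by
  \<open>2 * norm_f\<close>, which turns the constant 2 of the theorem into 8. An arbitrary positive
  bound \<open>q\<close> replaces the operator norm because the proof divides by it.\<close>

lemma prob_mean_ge_le_exp:
  fixes f :: "'s \<Rightarrow> real" and q e t :: real
  assumes q0: "0 < q"
    and q: "\<And>h y. h \<in> borel_measurable E \<Longrightarrow> (\<And>z. z \<in> space E \<Longrightarrow> \<bar>h z :: real\<bar> \<le> 1) \<Longrightarrow>
      y \<in> space E \<Longrightarrow> \<bar>deviation_kernel P \<pi> h y\<bar> \<le> q"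
    and f: "f \<in> borel_measurable E" "\<And>y. y \<in> space E \<Longrightarrow> 0 \<le> f y \<and> f y \<le> 1"
    and e: "0 < e" and te: "q < t * e" and t: "0 < t"
  defines "p \<equiv> \<integral>y. f y \<partial>\<pi>"
  shows "measure N {\<omega> \<in> space N. p + e \<le> 1 / t * (LBINT s:{0..t}. f (Y s \<omega>))}
    \<le> exp (- (8 * (t * e - q)\<^sup>2 / ((t + 1) * (2 * q + 1)\<^sup>2)))"
proof (cases "p + e \<le> 1")
  \<comment> \<open>Time averages of \<open>f\<close> are at most 1, so the event is empty. The
    other case then has \<open>e <= 1\<close> and \<open>p <= 1 - e\<close>.\<close>
  case False
  have f1: "\<bar>f y\<bar> \<le> 1" if "y \<in> space E" for y using f(2)[OF that] by auto
  have "1 / t * (LBINT s:{0..t}. f (Y s \<omega>)) \<le> 1" if "\<omega> \<in> space N" for \<omega>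
    using abs_path_integral_le[OF f(1) f1 less_imp_le[OF t] that] t
    by (simp add: path_integral_def abs_le_iff)
  then have "{\<omega> \<in> space N. p + e \<le> 1 / t * (LBINT s:{0..t}. f (Y s \<omega>))} = {}"
    using False by force
  then show ?thesis by (simp only: measure_empty exp_ge_zero)
next
  case pe: True
  define T where "T = t / q"
  have p: "0 \<le> p"
    unfolding p_def using f(2) by (intro integral_nonneg_AE AE_I2) (auto simp: space_pi)
  have e1: "e \<le> 1" using pe p by simp
  have Te: "1 < T * e" using te q0 by (simp add: T_def field_simps)
  have "t * e \<le> t" using t e1 by simp
  then have tq: "q \<le> t" using te by simp
  have wq: "- (q / 2) \<le> deviation_kernel P \<pi> f y \<and> deviation_kernel P \<pi> f y \<le> q / 2" if "y \<in> space E" for y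
  proof -
    have "\<bar>deviation_kernel P \<pi> f y\<bar> \<le> q / 2"
      using q f that by (rule abs_deviation_kernel_unit_le)
    then show ?thesis by (intro conjI) linarith+
  qed
  let ?A = "{\<omega> \<in> space N. p + e \<le> 1 / t * (LBINT s:{0..t}. f (Y s \<omega>))}"
  have "measure N ?A \<le> exp (- ((T * e - 1)\<^sup>2 * (T + 4) / (T\<^sup>2 + 6 * T + 4)))"
  \<comment> \<open>For \<open>T <= 27/10\<close> the parameter \<open>k\<close> stays below 46/100,
    and for \<open>e <= 93/100\<close> below 93/100. Otherwise \<open>p <= 1 - e < 7/100\<close>,
    and the sharper lower bound for the deviation kernel allows
    \<open>\<theta> = 2 / q\<close>.\<close>
  proof (cases "T \<le> 27/10 \<or> e \<le> 93/100")
    case True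
    define k where "k = (T * e - 1) / (T + 1)"
    note k = exponent_bound_small_mean[OF e e1 Te True, folded k_def]
    have "measure N ?A \<le> (1 + (2 * k / q) * (q / 2)) / (1 - (2 * k / q) * (q / 2)) *
       exp (- (t * (2 * k / q) * ((1 - p) * (p + e) / (1 + (2 * k / q) * (q / 2)) - p * (1 - p - e) / (1 - (2 * k / q) * (q / 2)))))"
      unfolding p_def using k(1,2) q0 t by (intro prob_mean_ge_le[OF f wq]) auto
    also have "(2 * k / q) * (q / 2) = k" using q0 by simp
    also have "t * (2 * k / q) = T * (2 * k)" by (simp add: T_def)
    finally show ?thesis using k(3)[of p] by linarith
  next
    case False
    have w: "- (35/100 * q) \<le> deviation_kernel P \<pi> f y \<and> deviation_kernel P \<pi> f y \<le> q / 2" if "y \<in> space E" for y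
    proof -
      have "(\<integral>y. f y \<partial>\<pi>) \<le> 7/100" using pe False by (simp add: p_def)
      with q0 q f have "- (35/100) * q \<le> deviation_kernel P \<pi> f y"
        using that by (rule deviation_kernel_lower_bound)
      then show ?thesis using wq[OF that] by simp
    qed
    have "measure N ?A \<le> (1 + (2 / q) * (q / 2)) / (1 - (2 / q) * (35/100 * q)) *
       exp (- (t * (2 / q) * ((1 - p) * (p + e) / (1 + (2 / q) * (q / 2)) - p * (1 - p - e) / (1 - (2 / q) * (35/100 * q)))))"
      unfolding p_def using q0 t by (intro prob_mean_ge_le[OF f w]) auto
    also have "(2 / q) * (q / 2) = 1" using q0 by simp
    also have "(2 / q) * (35/100 * q) = 7/10" using q0 by simp
    also have "t * (2 / q) = T * 2" by (simp add: T_def)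
    finally have "measure N ?A \<le> (1 + 1) / (1 - 7/10) *
        exp (- (T * 2 * ((1 - p) * (p + e) / (1 + 1) - p * (1 - p - e) / (1 - 7/10))))" .
    moreover have "\<dots> \<le> exp (- ((T * e - 1)\<^sup>2 * (T + 4) / (T\<^sup>2 + 6 * T + 4)))"
      using False e1 p pe by (intro exponent_bound_large_mean) auto
    ultimately show ?thesis by (rule order_trans)
  qed
  also have "\<dots> \<le> exp (- (8 * (t * e - q)\<^sup>2 / ((t + 1) * (2 * q + 1)\<^sup>2)))"
    using time_rescaling[OF q0 tq, of e] by (simp add: T_def)
  finally show ?thesis .
qed

end

section \<open>Joint measurability of continuous processes\<close>

text \<open>Rounding time down to multiples of \<open>1 / (n + 1)\<close> leaves countably many
  times, each with a measurable section; path continuity recovers \<open>Z\<close> in the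
  limit.\<close>

lemma borel_measurable_continuous_process:
  fixes Z :: "real \<Rightarrow> 'w \<Rightarrow> real"
  assumes Z: "\<And>r. Z r \<in> borel_measurable G"
    and cont: "\<And>\<omega>. \<omega> \<in> space G \<Longrightarrow> continuous_on UNIV (\<lambda>r. Z r \<omega>)"
  shows "(\<lambda>(r, \<omega>). Z r \<omega>) \<in> borel_measurable (borel \<Otimes>\<^sub>M G)"
proof (rule borel_measurable_LIMSEQ_real)
  let ?r = "\<lambda>n r::real. of_int \<lfloor>real (Suc n) * r\<rfloor> / real (Suc n) :: real"
  fix n
  have "(\<lambda>x. Z (of_int \<lfloor>real (Suc n) * fst x\<rfloor> / real (Suc n)) (snd x)) \<in> borel_measurable (borel \<Otimes>\<^sub>M G)"
  proof (rule measurable_compose_countable[where f = "\<lambda>i x. Z (of_int i / real (Suc n)) (snd x)"])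
    show "(\<lambda>x. Z (of_int i / real (Suc n)) (snd x)) \<in> borel_measurable (borel \<Otimes>\<^sub>M G)" for i :: int
      using measurable_compose[OF measurable_snd Z] .
    show "(\<lambda>x. \<lfloor>real (Suc n) * fst x\<rfloor>) \<in> borel \<Otimes>\<^sub>M G \<rightarrow>\<^sub>M count_space UNIV" by measurable
  qed
  then show "(\<lambda>x. Z (?r n (fst x)) (snd x)) \<in> borel_measurable (borel \<Otimes>\<^sub>M G)" .
next
  let ?r = "\<lambda>n r::real. of_int \<lfloor>real (Suc n) * r\<rfloor> / real (Suc n) :: real"
  fix x :: "real \<times> 'w" assume x: "x \<in> space (borel \<Otimes>\<^sub>M G)"
  have "(\<lambda>n. ?r n (fst x)) \<longlonglongrightarrow> fst x"
  proof (rule tendsto_sandwich)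
    show "(\<lambda>n. fst x - 1 / real (Suc n)) \<longlonglongrightarrow> fst x"
      using tendsto_diff[OF tendsto_const LIMSEQ_Suc[OF lim_1_over_n], of "fst x"] by simp
    show "\<forall>\<^sub>F n in sequentially. fst x - 1 / real (Suc n) \<le> ?r n (fst x)"
    proof (intro always_eventually allI)
      fix n
      have "real (Suc n) * fst x - 1 \<le> of_int \<lfloor>real (Suc n) * fst x\<rfloor>" by linarith
      then have "(real (Suc n) * fst x - 1) / real (Suc n) \<le> ?r n (fst x)" by (intro divide_right_mono) auto
      then show "fst x - 1 / real (Suc n) \<le> ?r n (fst x)" by (simp add: diff_divide_distrib)
    qed
    show "\<forall>\<^sub>F n in sequentially. ?r n (fst x) \<le> fst x"
    proof (intro always_eventually allI)
      fix n
      have "of_int \<lfloor>real (Suc n) * fst x\<rfloor> \<le> real (Suc n) * fst x" by linarith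
      then have "?r n (fst x) \<le> (real (Suc n) * fst x) / real (Suc n)" by (intro divide_right_mono) auto
      then show "?r n (fst x) \<le> fst x" by simp
    qed
  qed simp
  moreover have "isCont (\<lambda>r. Z r (snd x)) (fst x)"
    using cont[of "snd x"] x by (auto simp: space_pair_measure continuous_on_eq_continuous_at)
  ultimately show "(\<lambda>n. Z (?r n (fst x)) (snd x)) \<longlonglongrightarrow> (case x of (r, \<omega>) \<Rightarrow> Z r \<omega>)"
    using isCont_tendsto_compose by (auto simp: split_beta')
qed

lemma space_generated_by: "space (generated_by \<Omega> T X E) = \<Omega>"
  unfolding generated_by_def by (rule space_measure_of) auto

lemma sets_generated_by:
  "sets (generated_by \<Omega> T X E) = sigma_sets \<Omega> {X s -` A \<inter> \<Omega> | s A. s \<in> T \<and> A \<in> sets E}"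
  unfolding generated_by_def by (rule sets_measure_of) auto

lemma sets_generated_by_mono: "T \<subseteq> T' \<Longrightarrow> sets (generated_by \<Omega> T X E) \<subseteq> sets (generated_by \<Omega> T' X E)"
  unfolding sets_generated_by by (rule sigma_sets_mono') blast

lemma measurable_generated_by:
  assumes "s \<in> T" "\<And>\<omega>. \<omega> \<in> \<Omega> \<Longrightarrow> X s \<omega> \<in> space E"
  shows "X s \<in> generated_by \<Omega> T X E \<rightarrow>\<^sub>M E"
proof (rule measurableI)
  fix A assume "A \<in> sets E"
  then have "X s -` A \<inter> \<Omega> \<in> {X s -` A \<inter> \<Omega> | s A. s \<in> T \<and> A \<in> sets E}" using assms(1) by blast
  then show "X s -` A \<inter> space (generated_by \<Omega> T X E) \<in> sets (generated_by \<Omega> T X E)"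
    unfolding space_generated_by sets_generated_by by (rule sigma_sets.Basic)
qed (use assms(2) in \<open>simp add: space_generated_by\<close>)

section \<open>From diffusions to ergodic Markov processes\<close>

context diffusion
begin

abbreviation (input) E where "E \<equiv> state_space l u"

abbreviation (input) G where "G T \<equiv> generated_by (space M) T X (state_space l u)"

lemma space_state_space: "space E = einterval l u"
  by (simp add: space_restrict_space)

lemma X_space: "0 \<le> t \<Longrightarrow> \<omega> \<in> space M \<Longrightarrow> X t \<omega> \<in> space E"
  using markov subalg[of t] measurable_space[of "X t" "F t" E \<omega>]
  by (auto simp: markov_process_def subalgebra_def)

text \<open>The clamp \<open>c\<close> has two uses: \<open>max 0 r\<close> for joint measurability
  over all times and \<open>min s (max 0 r)\<close> for progressive measurability. It keeps the time
  where the paths are known to be continuous.\<close>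

lemma measurable_X_clamped:
  fixes c :: "real \<Rightarrow> real"
  assumes c: "continuous_on UNIV c" "\<And>r. 0 \<le> c r" "\<And>r. c r \<in> T"
  shows "(\<lambda>(r, \<omega>). X (c r) \<omega>) \<in> borel \<Otimes>\<^sub>M G T \<rightarrow>\<^sub>M E"
proof (rule measurable_restrict_space2)
  show "(\<lambda>(r, \<omega>). X (c r) \<omega>) \<in> space (borel \<Otimes>\<^sub>M G T) \<rightarrow> einterval l u"
    using X_space c(2) by (auto simp: space_pair_measure space_generated_by space_state_space)
  have "X (c r) \<in> G T \<rightarrow>\<^sub>M E" for r
    using c X_space by (intro measurable_generated_by) auto
  then have "X (c r) \<in> borel_measurable (G T)" for r
    by (simp add: measurable_restrict_space2_iff)
  then show "(\<lambda>(r, \<omega>). X (c r) \<omega>) \<in> borel_measurable (borel \<Otimes>\<^sub>M G T)"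
  proof (rule borel_measurable_continuous_process[where Z = "\<lambda>r. X (c r)"])
    fix \<omega> assume "\<omega> \<in> space (G T)"
    then have "continuous_on {0..} (\<lambda>t. X t \<omega>)" by (intro continuous_paths) (simp add: space_generated_by)
    then show "continuous_on UNIV (\<lambda>r. X (c r) \<omega>)"
      by (rule continuous_on_compose2[OF _ c(1)]) (use c(2) in auto)
  qed
qed

lemma
  assumes "y \<in> einterval l u"
  shows prob_space_Px: "prob_space (Px y)"
    and sets_Px: "sets (Px y) = sets (G {0..})"
    and space_Px: "space (Px y) = space M"
proof -
  have "Px y \<in> space (prob_algebra (G {0..}))"
    using measurable_space[OF Px_kernel, of y] assms by (simp add: space_state_space)
  then show "prob_space (Px y)" "sets (Px y) = sets (G {0..})" by (auto simp: space_prob_algebra)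
  then show "space (Px y) = space M" using sets_eq_imp_space_eq space_generated_by by metis
qed

lemma subalgebra_Px:
  assumes "y \<in> einterval l u" "0 \<le> s"
  shows "subalgebra (Px y) (G {0..s})"
  using sets_generated_by_mono[of "{0..s}" "{0..}" "space M" X E]
  by (auto simp: subalgebra_def space_Px[OF assms(1)] sets_Px[OF assms(1)] space_generated_by)

text \<open>Under \<open>Px y\<close> the process starts at \<open>y\<close> almost surely, so the
  Markov property at time 0, integrated, identifies the law of \<open>X t\<close>. This transfers
  measurability in time from the paths to \<open>P\<close>.\<close>

lemma distr_Px:
  assumes y: "y \<in> einterval l u" and t: "0 \<le> t"
  shows "P t y = distr (Px y) E (X t)"
proof (rule measure_eqI)
  have K: "P t z \<in> space (prob_algebra E)" if "z \<in> space E" for z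
    using semigroup t measurable_space[of "P t" E "prob_algebra E" z] that by (simp add: transition_semigroup_def)
  then have Py: "prob_space (P t y)" and setsP: "sets (P t y) = sets E"
    using y by (auto simp: space_prob_algebra space_state_space)
  then show "sets (P t y) = sets (distr (Px y) E (X t))" by simp
  interpret Py: prob_space "P t y" by fact
  interpret N: prob_space "Px y" by (rule prob_space_Px[OF y])
  interpret finite_measure_subalgebra "Px y" "G {0..0}"
    by unfold_locales (rule subalgebra_Px[OF y order_refl])
  have Xt: "X t \<in> Px y \<rightarrow>\<^sub>M E"
    using measurable_generated_by[of t "{0..}" "space M" X E] X_space t
      measurable_cong_sets[OF sets_Px[OF y] refl] by auto
  fix A assume "A \<in> sets (P t y)"
  then have A: "A \<in> sets E" using setsP by simp
  have m: "(\<lambda>\<omega>. indicator A (X t \<omega>) :: real) \<in> borel_measurable (Px y)"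
    using Xt A by measurable
  have i: "integrable (Px y) (\<lambda>\<omega>. indicator A (X t \<omega>) :: real)"
    by (rule integrable_bounded_prob[OF N.prob_space_axioms m, where B = 1]) (simp add: indicator_def)
  have "AE \<omega> in Px y. real_cond_exp (Px y) (G {0..0}) (\<lambda>\<omega>. indicator A (X (0 + t) \<omega>)) \<omega> = measure (P t (X 0 \<omega>)) A"
    using Px_markov[OF y] t A unfolding markov_process_def by blast
  with Px_start[OF y]
  have ae: "AE \<omega> in Px y. real_cond_exp (Px y) (G {0..0}) (\<lambda>\<omega>. indicator A (X t \<omega>)) \<omega> = measure (P t y) A"
    by eventually_elim simp
  have "measure (Px y) (X t -` A \<inter> space (Px y)) = (\<integral>\<omega>. indicator (X t -` A \<inter> space (Px y)) \<omega> \<partial>Px y)"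
    by simp
  also have "\<dots> = (\<integral>\<omega>. indicator A (X t \<omega>) \<partial>Px y)"
    by (intro Bochner_Integration.integral_cong refl) (auto simp: indicator_def)
  also have "\<dots> = (\<integral>\<omega>. real_cond_exp (Px y) (G {0..0}) (\<lambda>\<omega>. indicator A (X t \<omega>)) \<omega> \<partial>Px y)"
    by (rule real_cond_exp_int(2)[OF i, symmetric])
  also have "\<dots> = (\<integral>\<omega>. measure (P t y) A \<partial>Px y)"
    using ae by (intro integral_cong_AE) auto
  also have "\<dots> = measure (P t y) A" by (simp add: N.prob_space)
  finally show "emeasure (P t y) A = emeasure (distr (Px y) E (X t)) A"
    using Xt A by (simp add: emeasure_distr Py.emeasure_eq_measure N.emeasure_eq_measure)
qed

text \<open>By \<open>distr_Px\<close> the measure \<open>P t y\<close> is the image of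
  \<open>Px y\<close> under evaluation at time \<open>t\<close>. The kernel \<open>Px\<close> is
  measurable in \<open>y\<close>, and evaluation is measurable in time and path jointly.\<close>

lemma measurable_semigroup_P: "measurable_semigroup E P"
proof
  show "transition_semigroup E P" by (rule semigroup)
  have "(\<lambda>x. distr (Px (snd x)) E (X (max 0 (fst x)))) \<in> borel \<Otimes>\<^sub>M E \<rightarrow>\<^sub>M prob_algebra E"
  proof (rule measurable_distr_prob_space2)
    show "(\<lambda>x. Px (snd x)) \<in> borel \<Otimes>\<^sub>M E \<rightarrow>\<^sub>M prob_algebra (G {0..})"
      by (rule measurable_compose[OF measurable_snd Px_kernel])
    have "(\<lambda>(r, \<omega>). X (max 0 r) \<omega>) \<in> borel \<Otimes>\<^sub>M G {0..} \<rightarrow>\<^sub>M E"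
      by (rule measurable_X_clamped) (auto intro!: continuous_intros)
    then have X: "(\<lambda>x. X (max 0 (fst x)) (snd x)) \<in> borel \<Otimes>\<^sub>M G {0..} \<rightarrow>\<^sub>M E" by (simp add: split_beta')
    have "(\<lambda>x. (fst (fst x), snd x)) \<in> (borel \<Otimes>\<^sub>M E) \<Otimes>\<^sub>M G {0..} \<rightarrow>\<^sub>M borel \<Otimes>\<^sub>M G {0..}"
      by measurable
    from measurable_compose[OF this X]
    show "(\<lambda>(x, \<omega>). X (max 0 (fst x)) \<omega>) \<in> (borel \<Otimes>\<^sub>M E) \<Otimes>\<^sub>M G {0..} \<rightarrow>\<^sub>M E"
      by (simp add: split_beta')
  qed
  then show "(\<lambda>(t, y). P (max 0 t) y) \<in> borel \<Otimes>\<^sub>M E \<rightarrow>\<^sub>M prob_algebra E"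
    by (rule measurable_cong[THEN iffD1, rotated]) (auto simp: space_pair_measure space_state_space distr_Px)
qed

text \<open>The filtration is the natural one of \<open>X\<close> because \<open>Px x\<close> lives
  on the sigma-algebra generated by \<open>X\<close>, where the sets of \<open>F\<close> need not be
  measurable.\<close>

lemma ergodic_markov_process_Px:
  assumes "stationary_distribution E P \<pi>" "uniformly_ergodic E P \<pi>" and x: "x \<in> einterval l u"
  shows "ergodic_markov_process E P \<pi> (Px x) (\<lambda>t. G {0..t}) X"
proof -
  interpret measurable_semigroup E P by (rule measurable_semigroup_P)
  interpret N: prob_space "Px x" by (rule prob_space_Px[OF x])
  show ?thesis
  proof
    show "stationary_distribution E P \<pi>" "uniformly_ergodic E P \<pi>" by fact+
    show "markov_process (Px x) (\<lambda>t. G {0..t}) X E P" by (rule Px_markov[OF x])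
    show "\<And>s. 0 \<le> s \<Longrightarrow> subalgebra (Px x) (G {0..s})" by (rule subalgebra_Px[OF x])
    show "\<And>r s. 0 \<le> r \<Longrightarrow> r \<le> s \<Longrightarrow> sets (G {0..r}) \<subseteq> sets (G {0..s})"
      by (intro sets_generated_by_mono) auto
    show "\<And>s. 0 \<le> s \<Longrightarrow> (\<lambda>(r, \<omega>). X (min s (max 0 r)) \<omega>) \<in> borel \<Otimes>\<^sub>M G {0..s} \<rightarrow>\<^sub>M E"
      by (intro measurable_X_clamped continuous_intros) auto
  qed
qed

end

section \<open>Rescaling and passage to the operator norm\<close>

theorem theorem1p1:
  fixes M :: "'w measure" and F :: "real \<Rightarrow> 'w measure"
    and X :: "real \<Rightarrow> 'w \<Rightarrow> real" and Px :: "real \<Rightarrow> 'w measure"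
    and P :: "real \<Rightarrow> real \<Rightarrow> real measure" and \<pi> :: "real measure"
    and l u :: ereal and \<mu> \<sigma> f :: "real \<Rightarrow> real"
    and \<epsilon> t x norm_f norm_Q :: real
  assumes "diffusion M F X Px P l u \<mu> \<sigma>"
    and "stationary_distribution (state_space l u) P \<pi>"
    and "uniformly_ergodic (state_space l u) P \<pi>"
    and "f \<in> bounded_functions (state_space l u)"
  defines "norm_f \<equiv> sup_norm (state_space l u) f"
    and "norm_Q \<equiv> operator_norm (state_space l u) (deviation_kernel P \<pi>)"
  assumes "\<epsilon> > 0" and "t > 2 * norm_f * norm_Q / \<epsilon>" and "x \<in> einterval l u"
  shows "\<P>(\<omega> in Px x. 1 / t * (LBINT s:{0..t}. f (X s \<omega>)) - (\<integral>y. f y \<partial>\<pi>) \<ge> \<epsilon>)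
    \<le> exp (- 2 * (t * \<epsilon> - 2 * norm_f * norm_Q)\<^sup>2
             / ((t + 1) * norm_f\<^sup>2 * (2 * norm_Q + 1)\<^sup>2))"
proof -
  let ?E = "state_space l u"
  interpret D: diffusion M F X Px P l u \<mu> \<sigma> by fact
  interpret N: ergodic_markov_process ?E P \<pi> "Px x" "\<lambda>t. generated_by (space M) {0..t} X ?E" X
    by (rule D.ergodic_markov_process_Px) fact+
  have x: "x \<in> space ?E" using assms(9) by (simp add: D.space_state_space)
  have fm: "f \<in> borel_measurable ?E" using assms(4) by (simp add: bounded_functions_def)
  have fb: "\<bar>f y\<bar> \<le> norm_f" if "y \<in> space ?E" for y
  proof -
    have "bdd_above ((\<lambda>z. \<bar>f z\<bar>) ` space ?E)"
      using assms(4) unfolding bounded_functions_def bounded_iff bdd_above_def by auto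
    then show ?thesis unfolding norm_f_def sup_norm_def using that by (intro cSUP_upper)
  qed
  have Qb: "\<bar>deviation_kernel P \<pi> h y\<bar> \<le> norm_Q"
    if "h \<in> borel_measurable ?E" "\<And>z. z \<in> space ?E \<Longrightarrow> \<bar>h z :: real\<bar> \<le> 1" "y \<in> space ?E" for h y
    unfolding norm_Q_def using that by (rule N.abs_deviation_kernel_le_operator_norm)
  have Q0: "0 \<le> norm_Q" using Qb[of "\<lambda>_. 0" x] x by simp
  have F0: "0 \<le> norm_f" using fb[OF x] by simp
  show ?thesis
  \<comment> \<open>For \<open>norm_f = 0\<close> the exponent is a division by zero, hence 0, and
    the claimed bound is the trivial 1.\<close>
  proof (cases "norm_f = 0")
    case True
    then show ?thesis by (simp add: N.prob_le_1)
  next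
    case False
    then have F: "0 < norm_f" using F0 by simp
    have t: "0 < t" using assms(7,8) F0 Q0 by (smt (verit) divide_nonneg_pos mult_nonneg_nonneg)
    \<comment> \<open>The affine map behind \<open>g\<close> takes \<open>[- norm_f, norm_f]\<close>
      onto \<open>[0, 1]\<close>, so \<open>\<epsilon>\<close> shrinks by the factor
      \<open>2 * norm_f\<close>.\<close>
    define e where "e = \<epsilon> / (2 * norm_f)"
    define g where "g y = (f y / norm_f + 1) / 2" for y
    have e: "0 < e" using assms(7) F by (simp add: e_def)
    have te: "norm_Q < t * e" using assms(7,8) F by (simp add: e_def field_simps)
    have gm: "g \<in> borel_measurable ?E" unfolding g_def using fm by simp
    have g01: "0 \<le> g y \<and> g y \<le> 1" if "y \<in> space ?E" for y
      using fb[OF that] F by (auto simp: g_def field_simps abs_le_iff)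
    have g1: "\<bar>g y\<bar> \<le> 1" if "y \<in> space ?E" for y using g01[OF that] by auto
    have gpi: "(\<integral>y. g y \<partial>\<pi>) = ((\<integral>y. f y \<partial>\<pi>) / norm_f + 1) / 2"
    proof -
      interpret pi: prob_space \<pi> by (rule N.prob_space_pi)
      have "integrable \<pi> f"
        using fb by (intro integrable_bounded_prob[OF N.prob_space_pi N.borel_measurable_pi[OF fm]]) (auto simp: N.space_pi)
      then show ?thesis by (simp add: g_def pi.prob_space)
    qed
    have gint: "1 / t * (LBINT s:{0..t}. g (X s \<omega>)) = ((1 / t * (LBINT s:{0..t}. f (X s \<omega>))) / norm_f + 1) / 2"
      if \<omega>: "\<omega> \<in> space (Px x)" for \<omega>
    proof -
      note si = N.set_integrable_process[OF fm fb less_imp_le[OF t] \<omega>]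
      note aff = set_integral_affine[OF less_imp_le[OF t], of "- (1 / 2)" 0]
      have "(LBINT s:{0..t}. g (X s \<omega>)) = (LBINT s:{0..t}. 1 / (2 * norm_f) * f (X s \<omega>) - (- (1 / 2) - 0 * s))"
        by (intro set_lebesgue_integral_cong) (auto simp: g_def add_divide_distrib)
      also have "\<dots> = 1 / (2 * norm_f) * (LBINT s:{0..t}. f (X s \<omega>)) - (- (1 / 2) * t - 0 * t\<^sup>2 / 2)"
        using set_integral_diff(2)[OF set_integrable_mult_right[OF si] aff(1)]
        unfolding aff(2) set_integral_mult_right .
      finally show ?thesis using t F by (simp add: field_simps)
    qed
    let ?A = "{\<omega> \<in> space (Px x). (\<integral>y. g y \<partial>\<pi>) + e \<le> 1 / t * (LBINT s:{0..t}. g (X s \<omega>))}"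
    have event: "{\<omega> \<in> space (Px x). 1 / t * (LBINT s:{0..t}. f (X s \<omega>)) - (\<integral>y. f y \<partial>\<pi>) \<ge> \<epsilon>} = ?A"
    proof (intro Collect_cong conj_cong refl)
      have gen: "(\<epsilon> \<le> m - c) = ((c / norm_f + 1) / 2 + \<epsilon> / (2 * norm_f) \<le> (m / norm_f + 1) / 2)" for m c
        using F mult_le_cancel_right_pos[of "norm_f * 2" "\<epsilon> + c" m] by (simp add: field_simps)
      fix \<omega> assume \<omega>: "\<omega> \<in> space (Px x)"
      show "(\<epsilon> \<le> 1 / t * (LBINT s:{0..t}. f (X s \<omega>)) - (\<integral>y. f y \<partial>\<pi>))
          = ((\<integral>y. g y \<partial>\<pi>) + e \<le> 1 / t * (LBINT s:{0..t}. g (X s \<omega>)))"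
        unfolding gint[OF \<omega>] gpi e_def by (rule gen)
    qed
    define B where "B q = exp (- (8 * (t * e - q)\<^sup>2 / ((t + 1) * (2 * q + 1)\<^sup>2)))" for q
    \<comment> \<open>Taking \<open>q\<close> strictly above \<open>norm_Q\<close> makes it positive
      without deciding whether \<open>norm_Q\<close> is; strictness of the hypothesis on
      \<open>t\<close> leaves room below \<open>t * e\<close>, and continuity of \<open>B\<close>
      gives the bound at \<open>norm_Q\<close>.\<close>
    have bound: "measure (Px x) ?A \<le> B q" if q: "norm_Q < q" "q < t * e" for q
      unfolding B_def
    proof (rule N.prob_mean_ge_le_exp[OF _ _ gm g01 e q(2) t])
      show "0 < q" using Q0 q by simp
      fix h y assume "h \<in> borel_measurable ?E" "\<And>z. z \<in> space ?E \<Longrightarrow> \<bar>h z :: real\<bar> \<le> 1" "y \<in> space ?E"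
      then have "\<bar>deviation_kernel P \<pi> h y\<bar> \<le> norm_Q" by (rule Qb)
      then show "\<bar>deviation_kernel P \<pi> h y\<bar> \<le> q" using q(1) by simp
    qed
    have "(B \<longlongrightarrow> B norm_Q) (at_right norm_Q)"
      unfolding B_def using t Q0 by (intro tendsto_intros) auto
    moreover have "\<forall>\<^sub>F q in at_right norm_Q. measure (Px x) ?A \<le> B q"
      unfolding eventually_at_right_field using te bound by blast
    ultimately have "measure (Px x) ?A \<le> B norm_Q"
      by (intro tendsto_lowerbound) auto
    also have "B norm_Q = exp (- 2 * (t * \<epsilon> - 2 * norm_f * norm_Q)\<^sup>2
             / ((t + 1) * norm_f\<^sup>2 * (2 * norm_Q + 1)\<^sup>2))"
    proof -
      have "t * \<epsilon> - 2 * norm_f * norm_Q = 2 * norm_f * (t * e - norm_Q)"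
        using F by (simp add: e_def right_diff_distrib)
      then have "- 2 * (t * \<epsilon> - 2 * norm_f * norm_Q)\<^sup>2 = norm_f\<^sup>2 * (- 8 * (t * e - norm_Q)\<^sup>2)"
        by (simp add: power_mult_distrib)
      then show ?thesis unfolding B_def using F by simp
    qed
    finally show ?thesis unfolding event .
  qed
qed

end
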